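(* Let $d$ and $k$ be constant positive integers. Let $P$ be a set of $n$ points in $\mathbb{R}^d$, let $\varepsilon\in(0,1)$, and let $f: P\to\mathbb{R}^k$ be a given mapping. Then one can compute, in $O\bigl(n\log n + n/\varepsilon^{\max(d,k)}\bigr)$ time, a quantity $\ell$ such that $$\mathrm{distortion}(f)\ \le\ \ell\ \le\ (1+\varepsilon)\,\mathrm{distortion}(f).$$
   Context: Distances in $\mathbb{R}^d$ and $\mathbb{R}^k$ are Euclidean. For $K\ge 1$, the mapping $f:P\to\mathbb{R}^k$ is $K$-bi-Lipschitz if there exists a constant $c>0$ such that $$ c K^{-1}\,\|x-y\| \le \|f(x)-f(y)\| \le c\,\|x-y\|\qquad\text{for all } x,y\in P.$$ The least $K$ for which $f$ is $K$-bi-Lipschitz is the distortion of $f$, denoted $\mathrm{distortion}(f)$. If $f$ is not one-to-one, the distortion is infinite, and the algorithm is to report $\ell=+\infty$. The mapping is given by listing $f(p)$ for every $p\in P$. The constants hidden in the $O(\cdot)$ notation may depend on $d$ and $k$; the model of computation is the standard (real RAM) model used in computational geometry. *)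

theory Defs
  imports "HOL-Analysis.Analysis"
begin

section \<open>Distortion\<close>

definition bi_lipschitz ::
    "real \<Rightarrow> 'a::metric_space set \<Rightarrow> ('a \<Rightarrow> 'b::metric_space) \<Rightarrow> bool" where
  "bi_lipschitz K P f \<longleftrightarrow> K \<ge> 1 \<and>
     (\<exists>c>0. \<forall>x\<in>P. \<forall>y\<in>P.
        c * inverse K * dist x y \<le> dist (f x) (f y) \<and> dist (f x) (f y) \<le> c * dist x y)"

text \<open>The minimum exists whenever \<open>P\<close> is finite and \<open>f\<close> is one-to-one on \<open>P\<close>;
  see \<open>least_distortion_exists\<close> below.\<close>

definition distortion ::
    "'a::metric_space set \<Rightarrow> ('a \<Rightarrow> 'b::metric_space) \<Rightarrow> ereal" where
  "distortion P f = (if inj_on f P then ereal (LEAST K. bi_lipschitz K P f) else \<infinity>)"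

lemma bi_lipschitz_imp_inj_on: "bi_lipschitz K P f \<Longrightarrow> inj_on f P"
proof (rule inj_onI)
  fix x y assume *: "bi_lipschitz K P f" "x \<in> P" "y \<in> P" "f x = f y"
  then obtain c where c: "c > 0" "K \<ge> 1" "c * inverse K * dist x y \<le> dist (f x) (f y)"
    unfolding bi_lipschitz_def by blast
  have "0 < c * inverse K" using c by simp
  then have "x \<noteq> y \<Longrightarrow> 0 < c * inverse K * dist x y" 
    by (rule mult_pos_pos) simp
  with c * show "x = y" by fastforce
qed

lemma least_distortion_exists:
  assumes fin: "finite P" and inj: "inj_on f P"
  shows "\<exists>K. bi_lipschitz K P f \<and> (\<forall>K'. bi_lipschitz K' P f \<longrightarrow> K \<le> K')"
proof (cases "\<exists>x\<in>P. \<exists>y\<in>P. x \<noteq> y")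
  case False
  then have "bi_lipschitz 1 P f"
    unfolding bi_lipschitz_def by (intro conjI exI[of _ 1]) auto
  then show ?thesis unfolding bi_lipschitz_def by blast
next
  case True
  define D where "D = {(x, y) \<in> P \<times> P. x \<noteq> y}"
  define r where "r = (\<lambda>(x, y). dist (f x) (f y) / dist x y)"
  have D: "finite D" "D \<noteq> {}"
    using True fin by (auto simp: D_def intro: finite_subset[of _ "P \<times> P"])
  have rpos: "r p > 0" if "p \<in> D" for p
    using that inj by (auto simp: D_def r_def inj_on_def intro!: divide_pos_pos)
  define M where "M = Max (r ` D)"
  define m where "m = Min (r ` D)"
  have "M \<in> r ` D" "m \<in> r ` D" using D by (auto simp: M_def m_def)
  then obtain p q where p: "p \<in> D" "M = r p" and q: "q \<in> D" "m = r q" by blast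
  have pos: "M > 0" "m > 0" using rpos p q by auto
  have mM: "m \<le> r z" "r z \<le> M" if "z \<in> D" for z
    using that D by (auto simp: M_def m_def)
  have "bi_lipschitz (M / m) P f"
    unfolding bi_lipschitz_def
  proof (intro conjI exI[of _ M] ballI)
    show "1 \<le> M / m" using mM[OF p(1)] p pos by simp
    show "M > 0" by fact
    fix x y assume xy: "x \<in> P" "y \<in> P"
    show "M * inverse (M / m) * dist x y \<le> dist (f x) (f y)"
    proof (cases "x = y")
      case False
      then have "m \<le> dist (f x) (f y) / dist x y" using mM(1)[of "(x, y)"] xy
        by (simp add: D_def r_def)
      then show ?thesis using False pos by (simp add: field_simps)
    qed simp
    show "dist (f x) (f y) \<le> M * dist x y"
    proof (cases "x = y")
      case False
      then have "dist (f x) (f y) / dist x y \<le> M" using mM(2)[of "(x, y)"] xy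
        by (simp add: D_def r_def)
      then show ?thesis using False by (simp add: field_simps)
    qed simp
  qed
  moreover have "M / m \<le> K'" if K': "bi_lipschitz K' P f" for K'
  proof -
    obtain c where c: "c > 0" "K' \<ge> 1" and
      b: "\<And>x y. x \<in> P \<Longrightarrow> y \<in> P \<Longrightarrow>
        c * inverse K' * dist x y \<le> dist (f x) (f y) \<and> dist (f x) (f y) \<le> c * dist x y"
      using K' unfolding bi_lipschitz_def by blast
    obtain x y where xy: "p = (x, y)" "x \<in> P" "y \<in> P" "x \<noteq> y" using p by (auto simp: D_def)
    obtain u v where uv: "q = (u, v)" "u \<in> P" "v \<in> P" "u \<noteq> v" using q by (auto simp: D_def)
    have "M = dist (f x) (f y) / dist x y" "m = dist (f u) (f v) / dist u v"
      using xy uv p q by (simp_all add: r_def)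
    then have 1: "M \<le> c" and 2: "c * inverse K' \<le> m"
      using b[OF xy(2,3)] b[OF uv(2,3)] xy uv
      by (metis pos_divide_le_eq zero_less_dist_iff, metis pos_le_divide_eq zero_less_dist_iff)
    have "M \<le> K' * m" using 1 2 c by (simp add: field_simps)
    then show ?thesis using pos by (simp add: field_simps)
  qed
  ultimately show ?thesis by blast
qed

lemma bi_lipschitz_LEAST:
  assumes "finite P" "inj_on f P"
  shows "bi_lipschitz (LEAST K. bi_lipschitz K P f) P f"
    and "bi_lipschitz K' P f \<Longrightarrow> (LEAST K. bi_lipschitz K P f) \<le> K'"
proof -
  obtain K where K: "bi_lipschitz K P f" "\<And>K'. bi_lipschitz K' P f \<Longrightarrow> K \<le> K'"
    using least_distortion_exists[OF assms] by blast
  then have "(LEAST K. bi_lipschitz K P f) = K" by (intro Least_equality)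
  then show "bi_lipschitz (LEAST K. bi_lipschitz K P f) P f"
    and "bi_lipschitz K' P f \<Longrightarrow> (LEAST K. bi_lipschitz K P f) \<le> K'" using K by auto
qed


section \<open>Real RAM\<close>

text \<open>
  Programs are finite while-programs over two disjoint kinds of memory cells: cells holding exact
  reals and cells holding natural numbers, the latter serving as addresses. A program uses finitely
  many named arrays of each kind, with unbounded indices; a scalar variable is cell 0 of
  an array. Real arithmetic is \<open>+, -, *, /, sqrt\<close> and comparison, each at unit cost.
  There is no floor function or other conversion from reals to naturals: reals influence the
  addresses only through comparisons. Natural-number arithmetic is restricted to addition and
  truncated subtraction, and the constants in a program are integers, so that neither large
  integers nor constants can be used to gain unit-cost computing power.

  The HOL conventions \<open>x / 0 = 0\<close> and \<open>sqrt (- x) = - sqrt x\<close> make the operations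
  total; a program can test for these cases by comparisons.
\<close>

datatype iexp =
    IConst nat
  | IGet string iexp
  | IAdd iexp iexp
  | ISub iexp iexp

datatype rexp =
    RConst int
  | RGet string iexp
  | RAdd rexp rexp
  | RSub rexp rexp
  | RMul rexp rexp
  | RDiv rexp rexp
  | RSqrt rexp

datatype bexp =
    ILess iexp iexp
  | RLess rexp rexp
  | BNot bexp
  | BAnd bexp bexp

datatype com =
    Skip
  | IAssign string iexp iexp
  | RAssign string iexp rexp
  | Seq com com
  | Cond bexp com com
  | While bexp com

record store =
  icell :: "string \<Rightarrow> nat \<Rightarrow> nat"
  rcell :: "string \<Rightarrow> nat \<Rightarrow> real"

primrec ival :: "iexp \<Rightarrow> store \<Rightarrow> nat" where
  "ival (IConst m) s = m"
| "ival (IGet a e) s = icell s a (ival e s)"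
| "ival (IAdd e1 e2) s = ival e1 s + ival e2 s"
| "ival (ISub e1 e2) s = ival e1 s - ival e2 s"

primrec rval :: "rexp \<Rightarrow> store \<Rightarrow> real" where
  "rval (RConst z) s = of_int z"
| "rval (RGet a e) s = rcell s a (ival e s)"
| "rval (RAdd e1 e2) s = rval e1 s + rval e2 s"
| "rval (RSub e1 e2) s = rval e1 s - rval e2 s"
| "rval (RMul e1 e2) s = rval e1 s * rval e2 s"
| "rval (RDiv e1 e2) s = rval e1 s / rval e2 s"
| "rval (RSqrt e) s = sqrt (rval e s)"

primrec bval :: "bexp \<Rightarrow> store \<Rightarrow> bool" where
  "bval (ILess e1 e2) s \<longleftrightarrow> ival e1 s < ival e2 s"
| "bval (RLess e1 e2) s \<longleftrightarrow> rval e1 s < rval e2 s"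
| "bval (BNot b) s \<longleftrightarrow> \<not> bval b s"
| "bval (BAnd b1 b2) s \<longleftrightarrow> bval b1 s \<and> bval b2 s"

text \<open>The cost of evaluating an expression is the number of its operations, memory accesses and
  constants.\<close>

primrec icost :: "iexp \<Rightarrow> nat" where
  "icost (IConst m) = 1"
| "icost (IGet a e) = 1 + icost e"
| "icost (IAdd e1 e2) = 1 + icost e1 + icost e2"
| "icost (ISub e1 e2) = 1 + icost e1 + icost e2"

primrec rcost :: "rexp \<Rightarrow> nat" where
  "rcost (RConst z) = 1"
| "rcost (RGet a e) = 1 + icost e"
| "rcost (RAdd e1 e2) = 1 + rcost e1 + rcost e2"
| "rcost (RSub e1 e2) = 1 + rcost e1 + rcost e2"
| "rcost (RMul e1 e2) = 1 + rcost e1 + rcost e2"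
| "rcost (RDiv e1 e2) = 1 + rcost e1 + rcost e2"
| "rcost (RSqrt e) = 1 + rcost e"

primrec bcost :: "bexp \<Rightarrow> nat" where
  "bcost (ILess e1 e2) = 1 + icost e1 + icost e2"
| "bcost (RLess e1 e2) = 1 + rcost e1 + rcost e2"
| "bcost (BNot b) = 1 + bcost b"
| "bcost (BAnd b1 b2) = 1 + bcost b1 + bcost b2"

definition iupd :: "string \<Rightarrow> nat \<Rightarrow> nat \<Rightarrow> store \<Rightarrow> store" where
  "iupd a i m s = s\<lparr>icell := (icell s)(a := (icell s a)(i := m))\<rparr>"

definition rupd :: "string \<Rightarrow> nat \<Rightarrow> real \<Rightarrow> store \<Rightarrow> store" where
  "rupd a i x s = s\<lparr>rcell := (rcell s)(a := (rcell s a)(i := x))\<rparr>"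

text \<open>\<open>exec c s t s'\<close>: started in \<open>s\<close>, the program \<open>c\<close> halts in \<open>s'\<close> after time \<open>t\<close>.\<close>

inductive exec :: "com \<Rightarrow> store \<Rightarrow> nat \<Rightarrow> store \<Rightarrow> bool" where
  Skip: "exec Skip s 1 s"
| IAssign: "exec (IAssign a e1 e2) s (1 + icost e1 + icost e2) (iupd a (ival e1 s) (ival e2 s) s)"
| RAssign: "exec (RAssign a e1 e2) s (1 + icost e1 + rcost e2) (rupd a (ival e1 s) (rval e2 s) s)"
| Seq: "exec c1 s t1 s' \<Longrightarrow> exec c2 s' t2 s'' \<Longrightarrow> exec (Seq c1 c2) s (t1 + t2) s''"
| CondTrue: "bval b s \<Longrightarrow> exec c1 s t s' \<Longrightarrow> exec (Cond b c1 c2) s (1 + bcost b + t) s'"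
| CondFalse: "\<not> bval b s \<Longrightarrow> exec c2 s t s' \<Longrightarrow> exec (Cond b c1 c2) s (1 + bcost b + t) s'"
| WhileFalse: "\<not> bval b s \<Longrightarrow> exec (While b c) s (1 + bcost b) s"
| WhileTrue: "bval b s \<Longrightarrow> exec c s t1 s' \<Longrightarrow> exec (While b c) s' t2 s'' \<Longrightarrow>
    exec (While b c) s (1 + bcost b + t1 + t2) s''"

inductive_cases exec_SkipE: "exec Skip s t s'"
inductive_cases exec_IAssignE: "exec (IAssign a e1 e2) s t s'"
inductive_cases exec_RAssignE: "exec (RAssign a e1 e2) s t s'"
inductive_cases exec_SeqE: "exec (Seq c1 c2) s t s'"
inductive_cases exec_CondE: "exec (Cond b c1 c2) s t s'"
inductive_cases exec_WhileE: "exec (While b c) s t s'"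

lemma exec_deterministic:
  "exec c s t s' \<Longrightarrow> exec c s u r \<Longrightarrow> u = t \<and> r = s'"
proof (induction arbitrary: u r rule: exec.induct)
  case (Skip s)
  then show ?case by (auto elim: exec_SkipE)
next
  case (IAssign a e1 e2 s)
  then show ?case by (auto elim: exec_IAssignE)
next
  case (RAssign a e1 e2 s)
  then show ?case by (auto elim: exec_RAssignE)
next
  case (Seq c1 s t1 s' c2 t2 s'')
  obtain u1 u2 r1 where u: "u = u1 + u2" "exec c1 s u1 r1" "exec c2 r1 u2 r"
    using Seq.prems by (rule exec_SeqE)
  have "u1 = t1 \<and> r1 = s'" by (rule Seq.IH(1)[OF u(2)])
  moreover from this have "u2 = t2 \<and> r = s''" using u(3) by (intro Seq.IH(2)) simp
  ultimately show ?case using u(1) by simp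
next
  case (CondTrue b s c1 t s' c2)
  obtain u1 where u: "u = 1 + bcost b + u1" "exec c1 s u1 r"
    using CondTrue.prems CondTrue.hyps(1) by (auto elim: exec_CondE)
  show ?case using CondTrue.IH[OF u(2)] u(1) by simp
next
  case (CondFalse b s c2 t s' c1)
  obtain u1 where u: "u = 1 + bcost b + u1" "exec c2 s u1 r"
    using CondFalse.prems CondFalse.hyps(1) by (auto elim: exec_CondE)
  show ?case using CondFalse.IH[OF u(2)] u(1) by simp
next
  case (WhileFalse b s c)
  then show ?case by (auto elim: exec_WhileE)
next
  case (WhileTrue b s c t1 s' t2 s'')
  obtain u1 u2 r1 where u: "u = 1 + bcost b + u1 + u2" "exec c s u1 r1" "exec (While b c) r1 u2 r"
    using WhileTrue.prems WhileTrue.hyps(1) by (auto elim: exec_WhileE)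
  have "u1 = t1 \<and> r1 = s'" by (rule WhileTrue.IH(1)[OF u(2)])
  moreover from this have "u2 = t2 \<and> r = s''" using u(3) by (intro WhileTrue.IH(2)) simp
  ultimately show ?case using u(1) by simp
qed


section \<open>Input and output\<close>

text \<open>The coordinates of a point in \<open>real ^ 'd\<close> are listed in a fixed order of the index type
  \<open>'d\<close>: \<open>from_nat_into UNIV\<close> maps \<open>{..<CARD('d)}\<close> bijectively onto it.\<close>

definition coordinate :: "real ^ 'd::finite \<Rightarrow> nat \<Rightarrow> real" where
  "coordinate x j = x $ from_nat_into UNIV j"

text \<open>Row-major layout: coordinate \<open>j\<close> of the \<open>i\<close>-th point is stored in cell \<open>i * CARD('d) + j\<close>.\<close>

definition point_array :: "(real ^ 'd::finite) list \<Rightarrow> nat \<Rightarrow> real" where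
  "point_array xs m =
     (if m < length xs * CARD('d)
      then coordinate (xs ! (m div CARD('d))) (m mod CARD('d)) else 0)"

text \<open>The points \<open>P\<close> are given by a list \<open>xs\<close>, the mapping by the list of its values in the
  same order. All remaining cells are 0.\<close>

definition input_store ::
    "(real ^ 'd::finite) list \<Rightarrow> (real ^ 'd \<Rightarrow> real ^ 'k::finite) \<Rightarrow> real \<Rightarrow> store" where
  "input_store xs f \<epsilon> =
     \<lparr>icell = (\<lambda>a i. if a = ''n'' \<and> i = 0 then length xs else 0),
      rcell = (\<lambda>a i.
        if a = ''eps'' \<and> i = 0 then \<epsilon>
        else if a = ''P'' then point_array xs i
        else if a = ''fP'' then point_array (map f xs) i
        else 0)\<rparr>"

text \<open>The program reports \<open>+\<infinity>\<close> by a nonzero flag in the address cell \<open>infinite\<close>.\<close>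

definition reported :: "store \<Rightarrow> ereal" where
  "reported s = (if icell s ''infinite'' 0 \<noteq> 0 then \<infinity> else ereal (rcell s ''result'' 0))"

end

theory Submission
  imports Defs "HOL-Library.Discrete_Functions"
begin

text \<open>
  The distortion is the product of the Lipschitz constants of \<open>f\<close> and of its inverse. If a pair of
  points attains the Lipschitz constant, so does, up to a factor \<open>1 + O(\<epsilon>)\<close>, every pair of points
  that are close to them relative to their distance. Hence it suffices to look at one representative
  pair for each of the \<open>O(n / \<epsilon> ^ d)\<close> pairs of a well-separated pair decomposition.

  The decomposition is obtained without a floor function as follows. The coordinates of all points, in
  all dimensions together, are sorted and split recursively at the midpoints of their ranges; the gap at
  which an interval is split gets the length of that interval as its weight. The greatest weight
  between two coordinates is an ultrametric that dominates their distance, and weights of at least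
  \<open>r\<close> are spread out at distance \<open>r / 2\<close>. The maximum of these ultrametrics over the coordinates plays
  the role of the quadtree: range maximum queries compare two points in Z-order in constant time, sorting
  the points in this order makes all clusters contiguous, and the clusters are again found by
  range maximum queries on the gaps between consecutive points.
\<close>

section \<open>Reasoning about programs\<close>

text \<open>The decomposition is computed twice, for \<open>P\<close> in dimension d and for its
  image in dimension k; hence the exponent max(d, k). The obstacle is that the ultrametric may
  exceed the distance by an unbounded factor, because two close points can be separated by a heavy
  split. Two properties remain and suffice: a weight bounds a diameter from above, which makes
  representatives accurate, and a window contains few heavy splits, which bounds the number of
  pairs. To apply the second one, the interval of greater weight is always split: the split is
  charged to its gap and to the position of the partner interval, and the partners of one gap are
  near it and mutually separated by gaps at least as heavy. As for the constants, passing from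
  weights to Euclidean distances costs a factor \<open>D\<close>, so the threshold \<epsilon> / (24
  * D) keeps each displacement below \<epsilon> / 24 of the separation. Each Lipschitz constant is
  then found up to the factor 1 + \<epsilon> / 3, and (1 + \<epsilon> / 3)^2 \<le> 1 +
  \<epsilon>.\<close>

notation Seq (infixr ";;" 60)

abbreviation iscalar :: "string \<Rightarrow> iexp" where "iscalar a \<equiv> IGet a (IConst 0)"
abbreviation rscalar :: "string \<Rightarrow> rexp" where "rscalar a \<equiv> RGet a (IConst 0)"
abbreviation iset :: "string \<Rightarrow> iexp \<Rightarrow> com" (infix ":=\<^sub>i" 61) where "a :=\<^sub>i e \<equiv> IAssign a (IConst 0) e"
abbreviation rset :: "string \<Rightarrow> rexp \<Rightarrow> com" (infix ":=\<^sub>r" 61) where "a :=\<^sub>r e \<equiv> RAssign a (IConst 0) e"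

lemma icell_iupd [simp]: "icell (iupd a i m s) = (icell s)(a := (icell s a)(i := m))"
  and rcell_iupd [simp]: "rcell (iupd a i m s) = rcell s"
  and icell_rupd [simp]: "icell (rupd a i x s) = icell s"
  and rcell_rupd [simp]: "rcell (rupd a i x s) = (rcell s)(a := (rcell s a)(i := x))"
  by (simp_all add: iupd_def rupd_def)

section \<open>Cost and weakest preconditions of straight-line code\<close>

primrec ccost :: "com \<Rightarrow> nat" where
  "ccost Skip = 1"
| "ccost (IAssign a e1 e2) = 1 + icost e1 + icost e2"
| "ccost (RAssign a e1 e2) = 1 + icost e1 + rcost e2"
| "ccost (Seq c1 c2) = ccost c1 + ccost c2"
| "ccost (Cond b c1 c2) = 1 + bcost b + max (ccost c1) (ccost c2)"
| "ccost (While b c) = 0"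

text \<open>\<open>wp\<close> and \<open>ccost\<close> are meaningful for loop-free programs only; \<open>wp\<close> is false for loops.\<close>

primrec wp :: "com \<Rightarrow> (store \<Rightarrow> bool) \<Rightarrow> store \<Rightarrow> bool" where
  "wp Skip Q s = Q s"
| "wp (IAssign a e1 e2) Q s = Q (iupd a (ival e1 s) (ival e2 s) s)"
| "wp (RAssign a e1 e2) Q s = Q (rupd a (ival e1 s) (rval e2 s) s)"
| "wp (Seq c1 c2) Q s = wp c1 (wp c2 Q) s"
| "wp (Cond b c1 c2) Q s = (if bval b s then wp c1 Q s else wp c2 Q s)"
| "wp (While b c) Q s = False"

text \<open>One halting run within the bound is asked for; as \<open>exec\<close> is deterministic,
  this is total correctness with a time bound.\<close>

definition runs :: "com \<Rightarrow> store \<Rightarrow> nat \<Rightarrow> (store \<Rightarrow> bool) \<Rightarrow> bool" where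
  "runs c s T Q \<longleftrightarrow> (\<exists>t s'. exec c s t s' \<and> t \<le> T \<and> Q s')"

lemma wp_exec: "wp c Q s \<Longrightarrow> \<exists>t s'. exec c s t s' \<and> t \<le> ccost c \<and> Q s'"
proof (induction c arbitrary: Q s)
  case Skip
  then show ?case using exec.Skip by fastforce
next
  case (IAssign a e1 e2)
  then show ?case using exec.IAssign by (metis ccost.simps(2) order_refl wp.simps(2))
next
  case (RAssign a e1 e2)
  then show ?case using exec.RAssign by (metis ccost.simps(3) order_refl wp.simps(3))
next
  case (Seq c1 c2)
  from Seq.prems have "wp c1 (wp c2 Q) s" by simp
  from Seq.IH(1)[OF this] obtain t1 s1 where 1: "exec c1 s t1 s1" "t1 \<le> ccost c1" "wp c2 Q s1" by blast
  from Seq.IH(2)[OF this(3)] obtain t2 s2 where 2: "exec c2 s1 t2 s2" "t2 \<le> ccost c2" "Q s2" by blast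
  have "exec (c1 ;; c2) s (t1 + t2) s2" using 1 2 by (blast intro: exec.Seq)
  with 1 2 show ?case by (metis add_mono ccost.simps(4))
next
  case (Cond b c1 c2)
  show ?case
  proof (cases "bval b s")
    case True
    with Cond.prems have "wp c1 Q s" by simp
    from Cond.IH(1)[OF this] obtain t s1 where "exec c1 s t s1" "t \<le> ccost c1" "Q s1" by blast
    with True show ?thesis
      by (intro exI[of _ "1 + bcost b + t"] exI[of _ s1]) (auto intro!: exec.CondTrue[simplified])
  next
    case False
    with Cond.prems have "wp c2 Q s" by simp
    from Cond.IH(2)[OF this] obtain t s1 where "exec c2 s t s1" "t \<le> ccost c2" "Q s1" by blast
    with False show ?thesis
      by (intro exI[of _ "1 + bcost b + t"] exI[of _ s1]) (auto intro!: exec.CondFalse[simplified])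
  qed
qed simp

lemma runs_wp: "wp c Q s \<Longrightarrow> ccost c \<le> T \<Longrightarrow> runs c s T Q"
  unfolding runs_def using wp_exec by (meson order_trans)

section \<open>Write sets and frame conditions\<close>

primrec iwrites :: "com \<Rightarrow> string set" where
  "iwrites Skip = {}"
| "iwrites (IAssign a e1 e2) = {a}"
| "iwrites (RAssign a e1 e2) = {}"
| "iwrites (Seq c1 c2) = iwrites c1 \<union> iwrites c2"
| "iwrites (Cond b c1 c2) = iwrites c1 \<union> iwrites c2"
| "iwrites (While b c) = iwrites c"

primrec rwrites :: "com \<Rightarrow> string set" where
  "rwrites Skip = {}"
| "rwrites (IAssign a e1 e2) = {}"
| "rwrites (RAssign a e1 e2) = {a}"
| "rwrites (Seq c1 c2) = rwrites c1 \<union> rwrites c2"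
| "rwrites (Cond b c1 c2) = rwrites c1 \<union> rwrites c2"
| "rwrites (While b c) = rwrites c"

text \<open>Whole arrays are the unit, so the condition can be read off the program text. It keeps
  invariants short: they speak only of arrays that the code changes, and the rules for consequence,
  sequencing and loops supply the frame condition for all others.\<close>

definition frame :: "com \<Rightarrow> store \<Rightarrow> store \<Rightarrow> bool" where
  "frame c s s' \<longleftrightarrow>
     (\<forall>a. a \<notin> iwrites c \<longrightarrow> icell s' a = icell s a) \<and> (\<forall>a. a \<notin> rwrites c \<longrightarrow> rcell s' a = rcell s a)"

lemma frame_icell: "frame c s s' \<Longrightarrow> a \<notin> iwrites c \<Longrightarrow> icell s' a = icell s a"
  and frame_rcell: "frame c s s' \<Longrightarrow> a \<notin> rwrites c \<Longrightarrow> rcell s' a = rcell s a"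
  by (auto simp: frame_def)

lemma frame_refl [simp]: "frame c s s"
  by (simp add: frame_def)

lemma frame_trans: "frame c s s' \<Longrightarrow> frame c s' s'' \<Longrightarrow> frame c s s''"
  by (simp add: frame_def)

lemma exec_frame: "exec c s t s' \<Longrightarrow> frame c s s'"
  by (induction rule: exec.induct) (auto simp: frame_def)

lemma wp_mono: "wp c R s \<Longrightarrow> (\<And>s'. R s' \<Longrightarrow> Q s') \<Longrightarrow> wp c Q s"
proof (induction c arbitrary: Q R s)
  case (Seq c1 c2)
  from Seq.prems(1) have "wp c1 (wp c2 R) s" by simp
  then have "wp c1 (wp c2 Q) s" by (rule Seq.IH(1)) (rule Seq.IH(2)[OF _ Seq.prems(2)])
  then show ?case by simp
next
  case (Cond b c1 c2)
  show ?case using Cond.prems(1) Cond.IH(1)[OF _ Cond.prems(2)] Cond.IH(2)[OF _ Cond.prems(2)] by auto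
qed simp_all

lemma wp_frame: "wp c Q s \<Longrightarrow> wp c (\<lambda>s'. Q s' \<and> frame c s s') s"
proof (induction c arbitrary: Q s)
  case (Seq c1 c2)
  from Seq.prems have "wp c1 (wp c2 Q) s" by simp
  then have "wp c1 (\<lambda>s'. wp c2 Q s' \<and> frame c1 s s') s" by (rule Seq.IH(1))
  then have "wp c1 (wp c2 (\<lambda>s''. Q s'' \<and> frame (c1 ;; c2) s s'')) s"
  proof (rule wp_mono)
    fix s' assume "wp c2 Q s' \<and> frame c1 s s'"
    then have "wp c2 (\<lambda>s''. Q s'' \<and> frame c2 s' s'') s'" and f: "frame c1 s s'"
      using Seq.IH(2) by auto
    from this(1) show "wp c2 (\<lambda>s''. Q s'' \<and> frame (c1 ;; c2) s s'') s'"
      by (rule wp_mono) (use f in \<open>auto simp: frame_def\<close>)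
  qed
  then show ?case by simp
next
  case (Cond b c1 c2)
  have "wp c1 (\<lambda>s'. Q s' \<and> frame (Cond b c1 c2) s s') s" if "wp c1 Q s"
    by (rule wp_mono[OF Cond.IH(1)[OF that]]) (auto simp: frame_def)
  moreover have "wp c2 (\<lambda>s'. Q s' \<and> frame (Cond b c1 c2) s s') s" if "wp c2 Q s"
    by (rule wp_mono[OF Cond.IH(2)[OF that]]) (auto simp: frame_def)
  ultimately show ?case using Cond.prems by auto
qed (auto simp: frame_def)

lemma wp_conseq: "wp c R s \<Longrightarrow> (\<And>s'. R s' \<Longrightarrow> frame c s s' \<Longrightarrow> Q s') \<Longrightarrow> wp c Q s"
  using wp_frame wp_mono by (metis (no_types, lifting))

lemma wp_seq:
  "wp c1 R s \<Longrightarrow> (\<And>s'. R s' \<Longrightarrow> frame c1 s s' \<Longrightarrow> wp c2 Q s') \<Longrightarrow> wp (c1 ;; c2) Q s"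
  unfolding wp.simps by (rule wp_conseq)

section \<open>Running-time rules for composed programs\<close>

lemma runs_conseq:
  "runs c s T R \<Longrightarrow> (\<And>s'. R s' \<Longrightarrow> frame c s s' \<Longrightarrow> Q s') \<Longrightarrow> T \<le> T' \<Longrightarrow> runs c s T' Q"
  unfolding runs_def using exec_frame by (meson order_trans)

lemma runs_seq:
  assumes "runs c1 s X R" "\<And>s'. R s' \<Longrightarrow> frame c1 s s' \<Longrightarrow> runs c2 s' Y Q" "X + Y \<le> T"
  shows "runs (c1 ;; c2) s T Q"
proof -
  obtain t1 s1 where 1: "exec c1 s t1 s1" "t1 \<le> X" "R s1" using assms(1) by (auto simp: runs_def)
  then obtain t2 s2 where 2: "exec c2 s1 t2 s2" "t2 \<le> Y" "Q s2"
    using assms(2) exec_frame unfolding runs_def by blast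
  have "exec (c1 ;; c2) s (t1 + t2) s2" using 1 2 by (blast intro: exec.Seq)
  then show ?thesis unfolding runs_def using 1 2 assms(3)
    by (intro exI[of _ "t1 + t2"] exI[of _ s2]) auto
qed

lemma runs_seq_wp:
  assumes "wp c1 (\<lambda>s'. runs c2 s' Y Q) s" "ccost c1 + Y \<le> T"
  shows "runs (c1 ;; c2) s T Q"
  by (rule runs_seq[OF runs_wp[OF assms(1) order_refl] _ assms(2)])

lemma runs_cond:
  assumes "bval b s \<Longrightarrow> runs c1 s T Q" "\<not> bval b s \<Longrightarrow> runs c2 s T Q" "1 + bcost b + T \<le> T'"
  shows "runs (Cond b c1 c2) s T' Q"
proof (cases "bval b s")
  case True
  with assms(1) obtain t s' where "exec c1 s t s'" "t \<le> T" "Q s'" by (auto simp: runs_def)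
  then show ?thesis unfolding runs_def using assms(3) exec.CondTrue[OF True, of c1 t s' c2]
    by (intro exI[of _ "1 + bcost b + t"] exI[of _ s']) auto
next
  case False
  with assms(2) obtain t s' where "exec c2 s t s'" "t \<le> T" "Q s'" by (auto simp: runs_def)
  then show ?thesis unfolding runs_def using assms(3) exec.CondFalse[OF False, of c2 t s' c1]
    by (intro exI[of _ "1 + bcost b + t"] exI[of _ s']) auto
qed

text \<open>The variant \<open>\<mu>\<close> bounds the number of iterations, and all of them share
  the bound \<open>T\<close>; the summand 1 in \<open>\<mu> s + 1\<close> pays for the last, failing
  test. Frame conditions compose, so every intermediate store is related to the store before the
  loop.\<close>

lemma runs_while:
  fixes \<mu> :: "store \<Rightarrow> nat"
  assumes "I s"
    and "\<And>s1. I s1 \<Longrightarrow> bval b s1 \<Longrightarrow> frame c s s1 \<Longrightarrow> runs c s1 T (\<lambda>s2. I s2 \<and> \<mu> s2 < \<mu> s1)"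
    and "\<And>s'. I s' \<Longrightarrow> \<not> bval b s' \<Longrightarrow> frame c s s' \<Longrightarrow> Q s'"
    and "(\<mu> s + 1) * (T + 1 + bcost b) \<le> T'"
  shows "runs (While b c) s T' Q"
proof -
  have "\<exists>t s'. exec (While b c) s1 t s' \<and> t \<le> (\<mu> s1 + 1) * (T + 1 + bcost b) \<and> Q s'"
    if "I s1" "frame c s s1" for s1
    using that
  proof (induction "\<mu> s1" arbitrary: s1 rule: less_induct)
    case less
    show ?case
    proof (cases "bval b s1")
      case False
      then show ?thesis using less.prems assms(3) exec.WhileFalse[OF False]
        by (intro exI[of _ "1 + bcost b"] exI[of _ s1]) auto
    next
      case True
      then obtain t1 s2 where 1: "exec c s1 t1 s2" "t1 \<le> T" "I s2" "\<mu> s2 < \<mu> s1"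
        using assms(2) less.prems unfolding runs_def by blast
      have f: "frame c s s2" using frame_trans[OF less.prems(2) exec_frame[OF 1(1)]] .
      obtain t2 s' where 2: "exec (While b c) s2 t2 s'"
        "t2 \<le> (\<mu> s2 + 1) * (T + 1 + bcost b)" "Q s'"
        using less.hyps[OF 1(4) 1(3) f] by blast
      have "t2 \<le> \<mu> s1 * (T + 1 + bcost b)"
        using 2(2) mult_le_mono1[of "\<mu> s2 + 1" "\<mu> s1" "T + 1 + bcost b"] 1(4) by linarith
      then have "1 + bcost b + t1 + t2 \<le> (\<mu> s1 + 1) * (T + 1 + bcost b)"
        using 1(2) by simp
      then show ?thesis using exec.WhileTrue[OF True 1(1) 2(1)] 2(3) by blast
    qed
  qed
  from this[OF assms(1) frame_refl] show ?thesis
    unfolding runs_def using assms(4) by (meson order_trans)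
qed

text \<open>Addresses cannot be multiplied. As the dimension is a constant, the product is unrolled
  into additions, which costs only a constant factor.\<close>

primrec imult :: "nat \<Rightarrow> iexp \<Rightarrow> iexp" where
  "imult 0 e = IConst 0"
| "imult (Suc d) e = IAdd e (imult d e)"

lemma ival_imult [simp]: "ival (imult d e) s = d * ival e s"
  by (induction d) auto

section \<open>Window maxima and fair splits of sorted sequences\<close>

text \<open>Gap \<open>m\<close> lies between the positions \<open>m\<close> and
  \<open>m + 1\<close>, hence the half-open range. The inserted 0 gives a value to the empty window
  and makes all values nonnegative.\<close>

definition wmax :: "(nat \<Rightarrow> real) \<Rightarrow> nat \<Rightarrow> nat \<Rightarrow> real" where
  "wmax g i k = Max (insert 0 (g ` {min i k..<max i k}))"

lemma wmax_le_iff: "wmax g i k \<le> r \<longleftrightarrow> 0 \<le> r \<and> (\<forall>m. min i k \<le> m \<and> m < max i k \<longrightarrow> g m \<le> r)"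
  unfolding wmax_def by (subst Max_le_iff) auto

lemma wmax_less_iff: "wmax g i k < r \<longleftrightarrow> 0 < r \<and> (\<forall>m. min i k \<le> m \<and> m < max i k \<longrightarrow> g m < r)"
  unfolding wmax_def by (subst Max_less_iff) auto

lemma le_wmax_iff: "r \<le> wmax g i k \<longleftrightarrow> r \<le> 0 \<or> (\<exists>m. min i k \<le> m \<and> m < max i k \<and> r \<le> g m)"
  using wmax_less_iff[of g i k r] by (meson not_le)

lemma wmax_nonneg [simp]: "0 \<le> wmax g i k"
  by (simp add: le_wmax_iff)

lemma wmax_same [simp]: "wmax g i i = 0"
  by (simp add: wmax_def)

lemma wmax_commute: "wmax g i k = wmax g k i"
  by (simp add: wmax_def min.commute max.commute)

lemma wmax_ge: "i \<le> m \<Longrightarrow> m < k \<Longrightarrow> g m \<le> wmax g i k"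
  by (auto simp: le_wmax_iff)

lemma wmax_eqI:
  "i \<le> m \<Longrightarrow> m < k \<Longrightarrow> 0 \<le> g m \<Longrightarrow> (\<And>j. i \<le> j \<Longrightarrow> j < k \<Longrightarrow> g j \<le> g m) \<Longrightarrow> wmax g i k = g m"
  by (intro antisym) (auto simp: le_wmax_iff wmax_le_iff)

lemma wmax_split: "i \<le> k \<Longrightarrow> k \<le> l \<Longrightarrow> wmax g i l = max (wmax g i k) (wmax g k l)"
proof (rule antisym)
  assume ik: "i \<le> k" "k \<le> l"
  have "g m \<le> max (wmax g i k) (wmax g k l)" if "i \<le> m" "m < l" for m
    using wmax_ge[of i m k g] wmax_ge[of k m l g] that by (cases "m < k") (auto simp: le_max_iff_disj)
  moreover have "0 \<le> max (wmax g i k) (wmax g k l)" by (simp add: le_max_iff_disj)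
  ultimately show "wmax g i l \<le> max (wmax g i k) (wmax g k l)"
    using ik unfolding wmax_le_iff[of g i l] by simp
  show "max (wmax g i k) (wmax g k l) \<le> wmax g i l"
    using ik by (auto simp: wmax_le_iff intro!: wmax_ge)
qed

text \<open>Wherever \<open>k\<close> lies, each gap between \<open>i\<close> and \<open>l\<close>
  is a gap between \<open>i\<close> and \<open>k\<close> or between \<open>k\<close> and
  \<open>l\<close>.\<close>

lemma wmax_triangle: "wmax g i l \<le> max (wmax g i k) (wmax g k l)"
proof -
  have *: "wmax g i l \<le> max (wmax g i k) (wmax g k l)" if "i \<le> l" for i l
  proof -
    consider "k \<le> i" | "i \<le> k" "k \<le> l" | "l \<le> k" by linarith
    then show ?thesis
    proof cases
      case 1
      then show ?thesis using wmax_split[of k i l g] that by simp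
    next
      case 2
      then show ?thesis using wmax_split[of i k l g] by simp
    next
      case 3
      then show ?thesis using wmax_split[of i l k g] that by simp
    qed
  qed
  show ?thesis
    using *[of i l] *[of l i] by (cases "i \<le> l") (auto simp: wmax_commute max.commute)
qed

text \<open>In an ultrametric the two longest sides of a triangle are equal.\<close>

lemma wmax_isosceles:
  assumes "wmax g k l < wmax g i k"
  shows "wmax g i l = wmax g i k"
  using wmax_triangle[of g i l k] wmax_triangle[of g i k l] assms
  by (auto simp: wmax_commute[of g l k])

text \<open>If \<open>l\<close> lay to the left of \<open>i\<close>, the window from
  \<open>l\<close> to \<open>k\<close> would contain the window from \<open>i\<close> to
  \<open>k\<close>, and its maximum could not be smaller.\<close>

lemma wmax_order:
  assumes "wmax g k l < wmax g i k" "i \<le> k"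
  shows "i \<le> l"
proof (rule ccontr)
  assume "\<not> i \<le> l"
  then have "wmax g l k = max (wmax g l i) (wmax g i k)" using assms by (intro wmax_split) auto
  then show False using assms(1) wmax_commute[of g k l] by simp
qed

lemma wmax_order':
  assumes "wmax g i k < wmax g k l" "k \<le> l"
  shows "i \<le> l"
proof (rule ccontr)
  assume "\<not> i \<le> l"
  then have "wmax g k i = max (wmax g k l) (wmax g l i)" using assms by (intro wmax_split) auto
  then show False using assms(1) wmax_commute[of g k i] by simp
qed

text \<open>The weight \<open>g m\<close> of a gap is the length of the interval that is split there. Equal values are
  never separated by a positive weight.\<close>

inductive fair :: "(nat \<Rightarrow> real) \<Rightarrow> (nat \<Rightarrow> real) \<Rightarrow> nat \<Rightarrow> nat \<Rightarrow> bool" for x g where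
  leaf: "fair x g a a"
| node: "a \<le> m \<Longrightarrow> m < b \<Longrightarrow> g m = x b - x a \<Longrightarrow> x m \<le> (x a + x b) / 2 \<Longrightarrow>
    (x a + x b) / 2 < x (Suc m) \<or> x a = x b \<Longrightarrow> fair x g a m \<Longrightarrow> fair x g (Suc m) b \<Longrightarrow> fair x g a b"

section \<open>Diameter and spacing of fair splits\<close>

text \<open>The split that separates the two positions has as its weight the length of an interval
  that contains both values.\<close>

lemma fair_diam:
  assumes "fair x g a b" "\<And>i k. a \<le> i \<Longrightarrow> i \<le> k \<Longrightarrow> k \<le> b \<Longrightarrow> x i \<le> x k" "a \<le> i" "i \<le> k" "k \<le> b"
  shows "x k - x i \<le> wmax g i k"
  using assms
proof (induction arbitrary: i k rule: fair.induct)
  case (leaf a)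
  then have "i = a" "k = a" by auto
  then show ?case by simp
next
  case (node a m b)
  consider "k \<le> m" | "Suc m \<le> i" | "i \<le> m" "m < k" by linarith
  then show ?case
  proof cases
    case 1
    then show ?thesis using node.IH(1)[of i k] node.prems node.hyps by auto
  next
    case 2
    then show ?thesis using node.IH(2)[of i k] node.prems node.hyps by auto
  next
    case 3
    have "x k \<le> x b" "x a \<le> x i" using node.prems by auto
    then have "x k - x i \<le> g m" using node.hyps(3) by simp
    also have "\<dots> \<le> wmax g i k" using 3 by (intro wmax_ge) auto
    finally show ?thesis .
  qed
qed

lemma fair_nonneg:
  assumes "fair x g a b" "\<And>i k. a \<le> i \<Longrightarrow> i \<le> k \<Longrightarrow> k \<le> b \<Longrightarrow> x i \<le> x k" "a \<le> i" "i < b"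
  shows "0 \<le> g i"
  using assms
proof (induction rule: fair.induct)
  case (node a m b)
  consider "i < m" | "i = m" | "Suc m \<le> i" by linarith
  then show ?case using node by cases auto
qed simp

text \<open>A positive weight excludes the alternative \<open>x a = x b\<close>, so the midpoint
  lies strictly below the right neighbour.\<close>

lemma fair_pos:
  assumes "fair x g a b" "\<And>i k. a \<le> i \<Longrightarrow> i \<le> k \<Longrightarrow> k \<le> b \<Longrightarrow> x i \<le> x k" "a \<le> i" "i < b" "0 < g i"
  shows "x i < x (Suc i)"
  using assms
proof (induction rule: fair.induct)
  case (node a m b)
  consider "i < m" | "i = m" | "Suc m \<le> i" by linarith
  then show ?case using node by cases auto
qed simp

text \<open>\<open>z i\<close> is the midpoint at which gap \<open>i\<close> is split. The bounds in
  terms of \<open>x a\<close> and \<open>x b\<close> carry the induction: this midpoint is half the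
  weight \<open>g i\<close> away from both ends of every enclosing interval, hence also from the
  midpoint of every split above it. Two gaps on different sides of a split are separated by the
  midpoint of that split.\<close>

lemma fair_midpoints:
  assumes "fair x g a b" "\<And>i k. a \<le> i \<Longrightarrow> i \<le> k \<Longrightarrow> k \<le> b \<Longrightarrow> x i \<le> x k"
  shows "\<exists>z. (\<forall>i. a \<le> i \<and> i < b \<longrightarrow> x i \<le> z i \<and> z i \<le> x (Suc i) \<and> x a + g i / 2 \<le> z i \<and> z i \<le> x b - g i / 2) \<and>
    (\<forall>i k. a \<le> i \<and> i < k \<and> k < b \<longrightarrow> z i + min (g i) (g k) / 2 \<le> z k)"
  using assms
proof (induction rule: fair.induct)
  case (leaf a)
  then show ?case by auto
next
  case (node a m b)
  have mono: "x i \<le> x k" if "a \<le> i" "i \<le> k" "k \<le> b" for i k using node.prems that by blast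
  have "\<exists>z. (\<forall>i. a \<le> i \<and> i < m \<longrightarrow> x i \<le> z i \<and> z i \<le> x (Suc i) \<and> x a + g i / 2 \<le> z i \<and> z i \<le> x m - g i / 2) \<and>
    (\<forall>i k. a \<le> i \<and> i < k \<and> k < m \<longrightarrow> z i + min (g i) (g k) / 2 \<le> z k)"
    using node.prems node.hyps(1,2) by (intro node.IH(1)) auto
  then obtain z1 where z1: "\<And>i. a \<le> i \<Longrightarrow> i < m \<Longrightarrow> x i \<le> z1 i \<and> z1 i \<le> x (Suc i) \<and> x a + g i / 2 \<le> z1 i \<and> z1 i \<le> x m - g i / 2"
    "\<And>i k. a \<le> i \<Longrightarrow> i < k \<Longrightarrow> k < m \<Longrightarrow> z1 i + min (g i) (g k) / 2 \<le> z1 k"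
    by blast
  have "\<exists>z. (\<forall>i. Suc m \<le> i \<and> i < b \<longrightarrow> x i \<le> z i \<and> z i \<le> x (Suc i) \<and> x (Suc m) + g i / 2 \<le> z i \<and> z i \<le> x b - g i / 2) \<and>
    (\<forall>i k. Suc m \<le> i \<and> i < k \<and> k < b \<longrightarrow> z i + min (g i) (g k) / 2 \<le> z k)"
    using node.prems node.hyps(1,2) by (intro node.IH(2)) auto
  then obtain z2 where z2: "\<And>i. Suc m \<le> i \<Longrightarrow> i < b \<Longrightarrow> x i \<le> z2 i \<and> z2 i \<le> x (Suc i) \<and> x (Suc m) + g i / 2 \<le> z2 i \<and> z2 i \<le> x b - g i / 2"
    "\<And>i k. Suc m \<le> i \<Longrightarrow> i < k \<Longrightarrow> k < b \<Longrightarrow> z2 i + min (g i) (g k) / 2 \<le> z2 k"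
    by blast
  define c where "c = (x a + x b) / 2"
  have c: "x m \<le> c" "c \<le> x (Suc m)" "x a + g m / 2 = c" "x b - g m / 2 = c"
    using node.hyps mono[of a "Suc m"] by (auto simp: c_def field_simps)
  define z where "z = (\<lambda>i. if i < m then z1 i else if i = m then c else z2 i)"
  have gi: "0 \<le> g i" if "a \<le> i" "i < b" for i
    using fair_nonneg[OF fair.node[OF node.hyps] mono that] by blast
  have "x i \<le> z i \<and> z i \<le> x (Suc i) \<and> x a + g i / 2 \<le> z i \<and> z i \<le> x b - g i / 2" if i: "a \<le> i" "i < b" for i
  proof -
    consider "i < m" | "i = m" | "m < i" by linarith
    then show ?thesis
    proof cases
      case 1
      then show ?thesis using z1(1)[of i] i mono[of m b] node.hyps by (auto simp: z_def)
    next
      case 2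
      then show ?thesis using c by (simp add: z_def)
    next
      case 3
      then show ?thesis using z2(1)[of i] i mono[of a "Suc m"] node.hyps by (auto simp: z_def)
    qed
  qed
  moreover have "z i + min (g i) (g k) / 2 \<le> z k" if ik: "a \<le> i" "i < k" "k < b" for i k
  proof -
    have left: "z i + g i / 2 \<le> c" if "i < m" using z1(1)[of i] c that ik by (auto simp: z_def)
    have right: "c + g k / 2 \<le> z k" if "m < k" using z2(1)[of k] c that ik by (auto simp: z_def)
    consider "k < m" | "k = m" | "m < i" | "i = m" | "i < m" "m < k" using ik by linarith
    then show ?thesis
    proof cases
      case 1
      then show ?thesis using z1(2)[of i k] ik by (simp add: z_def)
    next
      case 2
      have "z i + g i / 2 \<le> z k" using left 2 ik by (simp add: z_def)
      then show ?thesis by (auto simp: min_def)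
    next
      case 3
      then show ?thesis using z2(2)[of i k] ik by (simp add: z_def)
    next
      case 4
      have "z i + g k / 2 \<le> z k" using right 4 ik by (simp add: z_def)
      then show ?thesis by (auto simp: min_def)
    next
      case 5
      then have "z i + g i / 2 \<le> z k" using left right gi[of k] ik by fastforce
      then show ?thesis by (auto simp: min_def)
    qed
  qed
  ultimately show ?case by blast
qed

text \<open>Induction removes the largest index; each of the remaining steps contributes a spacing
  of \<open>s\<close>.\<close>

lemma separated_card:
  fixes f :: "nat \<Rightarrow> real"
  assumes "finite S" "S \<noteq> {}" "\<And>i k. i \<in> S \<Longrightarrow> k \<in> S \<Longrightarrow> i < k \<Longrightarrow> f i + s \<le> f k"
    and "\<And>i. i \<in> S \<Longrightarrow> lo \<le> f i"
  shows "lo + (real (card S) - 1) * s \<le> f (Max S)"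
  using assms
proof (induction S rule: finite_linorder_max_induct)
  case (insert b A)
  show ?case
  proof (cases "A = {}")
    case True
    then show ?thesis using insert.prems by simp
  next
    case False
    have "lo + (real (card A) - 1) * s \<le> f (Max A)" using insert False by auto
    also have "f (Max A) + s \<le> f b" using insert False by (intro insert.prems) auto
    finally have "lo + (real (card A) - 1) * s + s \<le> f b" by simp
    moreover have "Max (insert b A) = b" using insert.hyps False
      by (intro Max_eqI) (auto intro: less_imp_le)
    moreover have "card (insert b A) = Suc (card A)" using insert.hyps by (intro card_insert_disjoint) auto
    ultimately show ?thesis by (simp add: algebra_simps)
  qed
qed simp

text \<open>Splits of weight at least \<open>r\<close> have midpoints that are \<open>r / 2\<close> apart.\<close>

lemma fair_packing:
  assumes "fair x g a b" "\<And>i k. a \<le> i \<Longrightarrow> i \<le> k \<Longrightarrow> k \<le> b \<Longrightarrow> x i \<le> x k"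
    and "a \<le> i" "i \<le> k" "k \<le> b" "0 < r"
  shows "real (card {m. i \<le> m \<and> m < k \<and> r \<le> g m}) \<le> 2 * (x k - x i) / r + 1"
proof -
  let ?S = "{m. i \<le> m \<and> m < k \<and> r \<le> g m}"
  obtain z where z: "\<And>i. a \<le> i \<Longrightarrow> i < b \<Longrightarrow> x i \<le> z i \<and> z i \<le> x (Suc i)"
    "\<And>i k. a \<le> i \<Longrightarrow> i < k \<Longrightarrow> k < b \<Longrightarrow> z i + min (g i) (g k) / 2 \<le> z k"
    using fair_midpoints[OF assms(1,2)] by blast
  show ?thesis
  proof (cases "?S = {}")
    case True
    then show ?thesis using assms(2)[of i k] assms(3-6) by (simp only: True card.empty) simp
  next
    case False
    have fin: "finite ?S" by simp
    have "x i + (real (card ?S) - 1) * (r / 2) \<le> z (Max ?S)"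
    proof (rule separated_card[OF fin False])
      fix m m' assume m: "m \<in> ?S" "m' \<in> ?S" "m < m'"
      have "z m + min (g m) (g m') / 2 \<le> z m'" using z(2)[of m m'] m assms by simp
      moreover have "r \<le> min (g m) (g m')" using m by simp
      ultimately show "z m + r / 2 \<le> z m'" by linarith
    next
      fix m assume "m \<in> ?S"
      then show "x i \<le> z m" using z(1)[of m] assms(2)[of i m] assms by fastforce
    qed
    also have "z (Max ?S) \<le> x k"
    proof -
      have "Max ?S \<in> ?S" using fin False by (rule Max_in)
      then show ?thesis using z(1)[of "Max ?S"] assms(2)[of "Suc (Max ?S)" k] assms by fastforce
    qed
    finally have "(real (card ?S) - 1) * r \<le> 2 * (x k - x i)" by (simp add: algebra_simps)
    then show ?thesis using assms(6) by (simp add: field_simps)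
  qed
qed

section \<open>The combined ultrametric and its Z-order\<close>

text \<open>\<open>rk p j\<close> is the position of coordinate \<open>j\<close> of the point \<open>p\<close> in the sorted sequence of the
  coordinates of all points in all dimensions. As in a quadtree, all dimensions share one
  hierarchy of scales.\<close>

definition coord_level :: "(nat \<Rightarrow> real) \<Rightarrow> (nat \<Rightarrow> nat \<Rightarrow> nat) \<Rightarrow> nat \<Rightarrow> nat \<Rightarrow> nat \<Rightarrow> real" where
  "coord_level g rk p q j = wmax g (rk p j) (rk q j)"

definition level :: "nat \<Rightarrow> (nat \<Rightarrow> real) \<Rightarrow> (nat \<Rightarrow> nat \<Rightarrow> nat) \<Rightarrow> nat \<Rightarrow> nat \<Rightarrow> real" where
  "level D g rk p q = Max (insert 0 (coord_level g rk p q ` {..<D}))"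

section \<open>The Z-order\<close>

definition first_max :: "nat \<Rightarrow> (nat \<Rightarrow> real) \<Rightarrow> nat \<Rightarrow> bool" where
  "first_max D u j \<longleftrightarrow> j < D \<and> (\<forall>i<j. u i < u j) \<and> (\<forall>i<D. u i \<le> u j)"

text \<open>On a grid, Z-order compares two points in the coordinate with the highest differing bit.
  Here the greatest weight between them stands for that bit, and ties go to the first
  coordinate.\<close>

definition zle :: "nat \<Rightarrow> (nat \<Rightarrow> real) \<Rightarrow> (nat \<Rightarrow> nat \<Rightarrow> nat) \<Rightarrow> nat \<Rightarrow> nat \<Rightarrow> bool" where
  "zle D g rk p q \<longleftrightarrow> (\<exists>j. first_max D (coord_level g rk p q) j \<and> rk p j \<le> rk q j)"

lemma first_max_unique: "first_max D u i \<Longrightarrow> first_max D u j \<Longrightarrow> i = j"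
  unfolding first_max_def by (metis linorder_neqE_nat not_less)

lemma first_max_exists: "0 < D \<Longrightarrow> \<exists>j. first_max D u j"
proof (induction D)
  case (Suc D)
  show ?case
  proof (cases "D = 0")
    case True
    then show ?thesis by (intro exI[of _ 0]) (simp add: first_max_def)
  next
    case False
    then obtain j where j: "first_max D u j" using Suc by auto
    show ?thesis
    proof (cases "u j < u D")
      case True
      then have "first_max (Suc D) u D"
        using j by (auto simp: first_max_def less_Suc_eq intro: le_less_trans less_imp_le)
      then show ?thesis ..
    next
      case False
      then have "first_max (Suc D) u j" using j by (auto simp: first_max_def less_Suc_eq)
      then show ?thesis ..
    qed
  qed
qed simp

lemma coord_level_nonneg [simp]: "0 \<le> coord_level g rk p q j"
  by (simp add: coord_level_def)

lemma coord_level_commute: "coord_level g rk p q = coord_level g rk q p"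
  by (rule ext) (simp add: coord_level_def wmax_commute)

lemma level_commute: "level D g rk p q = level D g rk q p"
  by (simp add: level_def coord_level_commute[of g rk p])

lemma level_nonneg [simp]: "0 \<le> level D g rk p q"
  unfolding level_def by (intro Max_ge) auto

lemma level_same [simp]: "level D g rk p p = 0"
  unfolding level_def by (intro Max_eqI) (auto simp: coord_level_def)

lemma coord_level_le_level: "j < D \<Longrightarrow> coord_level g rk p q j \<le> level D g rk p q"
  unfolding level_def by (intro Max_ge) auto

lemma level_eq_first_max: "first_max D (coord_level g rk p q) j \<Longrightarrow> level D g rk p q = coord_level g rk p q j"
  unfolding level_def first_max_def by (intro Max_eqI) auto

lemma le_level_iff:
  "0 < r \<Longrightarrow> r \<le> level D g rk p q \<longleftrightarrow> (\<exists>j<D. r \<le> coord_level g rk p q j)"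
  unfolding level_def by (subst Max_ge_iff) auto

lemma zle_total: "0 < D \<Longrightarrow> zle D g rk p q \<or> zle D g rk q p"
  using first_max_exists[of D "coord_level g rk p q"] coord_level_commute[of g rk q p]
  unfolding zle_def by (metis nat_le_linear)

text \<open>Besides transitivity, the point is the equality for the levels, of which the ultrametric
  inequality gives only one half. The coordinate that decides for the pair of greater level, or on
  equal levels the smaller of the two deciding coordinates, also decides for \<open>x\<close> and
  \<open>z\<close>.\<close>

lemma zle_trans_level:
  assumes xy: "zle D g rk x y" and yz: "zle D g rk y z"
  shows "zle D g rk x z \<and> level D g rk x z = max (level D g rk x y) (level D g rk y z)"
proof -
  let ?A = "coord_level g rk x y" and ?B = "coord_level g rk y z" and ?C = "coord_level g rk x z"
  obtain i where i: "first_max D ?A i" "rk x i \<le> rk y i" using xy by (auto simp: zle_def)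
  obtain j where j: "first_max D ?B j" "rk y j \<le> rk z j" using yz by (auto simp: zle_def)
  have tri: "?C l \<le> max (?A l) (?B l)" for l
    unfolding coord_level_def by (rule wmax_triangle)
  have lev: "level D g rk x y = ?A i" "level D g rk y z = ?B j"
    using level_eq_first_max i j by blast+
  have I: "i < D" "\<And>l. l < i \<Longrightarrow> ?A l < ?A i" "\<And>l. l < D \<Longrightarrow> ?A l \<le> ?A i"
    and J: "j < D" "\<And>l. l < j \<Longrightarrow> ?B l < ?B j" "\<And>l. l < D \<Longrightarrow> ?B l \<le> ?B j"
    using i j by (auto simp: first_max_def)
  \<comment> \<open>In the first two cases one pair is strictly heavier in its deciding coordinate,
    and the isosceles property transfers weight and order to \<open>x\<close> and \<open>z\<close>.
    In the third case both pairs are decided in the same coordinate with equal weight, and the two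
    windows are adjacent.\<close>
  consider "?B i < ?A i" "?B j \<le> ?A i" "\<And>l. l < i \<Longrightarrow> ?B l < ?A i"
    | "?A j < ?B j" "?A i \<le> ?B j" "\<And>l. l < j \<Longrightarrow> ?A l < ?B j" | "i = j" "?A i = ?B j"
  proof -
    consider "?B j < ?A i" | "?A i < ?B j" | "?A i = ?B j" "i < j" | "?A i = ?B j" "j < i"
      | "?A i = ?B j" "i = j" by linarith
    then show thesis
    proof cases
      case 1
      then have "?B l < ?A i" if "l < D" for l using J(3)[OF that] by linarith
      then show thesis using that(1) 1 I(1) by (meson less_imp_le less_trans)
    next
      case 2
      then have "?A l < ?B j" if "l < D" for l using I(3)[OF that] by linarith
      then show thesis using that(2) 2 J(1) by (meson less_imp_le less_trans)
    next
      case 3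
      then show thesis using that(1) J(2) by (metis less_trans order_refl)
    next
      case 4
      then show thesis using that(2) I(2) by (metis less_trans order_refl)
    next
      case 5
      then show thesis using that(3) by simp
    qed
  qed
  then show ?thesis
  proof cases
    case 1
    have C: "?C i = ?A i" using wmax_isosceles 1(1) unfolding coord_level_def by blast
    have "rk x i \<le> rk z i" using wmax_order 1(1) i(2) unfolding coord_level_def by blast
    moreover have "first_max D ?C i" unfolding first_max_def C
    proof (intro conjI allI impI I(1))
      fix l assume "l < i" then show "?C l < ?A i" using tri[of l] I(2) 1(3) by (metis le_less_trans max_less_iff_conj)
    next
      fix l assume "l < D" then show "?C l \<le> ?A i" using tri[of l] I(3)[of l] J(3)[of l] 1(2) by (simp add: max_def split: if_splits)
    qed
    ultimately show ?thesis using lev level_eq_first_max[of D g rk x z i] C 1(2) by (auto simp: zle_def)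
  next
    case 2
    have C: "?C j = ?B j"
      using wmax_isosceles[of g "rk y j" "rk x j" "rk z j"] 2(1)
      unfolding coord_level_def by (metis wmax_commute)
    have "rk x j \<le> rk z j" using wmax_order' 2(1) j(2) unfolding coord_level_def by blast
    moreover have "first_max D ?C j" unfolding first_max_def C
    proof (intro conjI allI impI J(1))
      fix l assume "l < j" then show "?C l < ?B j" using tri[of l] J(2) 2(3) by (metis le_less_trans max_less_iff_conj)
    next
      fix l assume "l < D" then show "?C l \<le> ?B j" using tri[of l] I(3)[of l] J(3)[of l] 2(2) by (simp add: max_def split: if_splits)
    qed
    ultimately show ?thesis using lev level_eq_first_max[of D g rk x z j] C 2(2) by (auto simp: zle_def)
  next
    case 3
    have C: "?C i = ?A i"
      using wmax_split[of "rk x i" "rk y i" "rk z i" g] i(2) j(2) 3 unfolding coord_level_def by simp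
    have "first_max D ?C i" unfolding first_max_def C
    proof (intro conjI allI impI I(1))
      fix l assume "l < i" then show "?C l < ?A i" using tri[of l] I(2)[of l] J(2)[of l] 3 by (metis le_less_trans max_less_iff_conj)
    next
      fix l assume "l < D" then show "?C l \<le> ?A i" using tri[of l] I(3)[of l] J(3)[of l] 3 by (simp add: max_def split: if_splits)
    qed
    then show ?thesis using lev level_eq_first_max[of D g rk x z i] C 3 i(2) j(2) by (auto simp: zle_def)
  qed
qed

section \<open>Levels along a sorted sequence, and packing\<close>

text \<open>By \<open>zle_trans_level\<close> every further point contributes the level of the last
  gap to a maximum. The levels between neighbours thus determine all others, so one array of gaps
  replaces the coordinates.\<close>

lemma level_chain:
  assumes "\<And>i k. i < k \<Longrightarrow> k < n \<Longrightarrow> zle D g rk (A i) (A k)"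
    and "\<And>i. Suc i < n \<Longrightarrow> h i = level D g rk (A i) (A (Suc i))"
    and "a \<le> b" "b < n"
  shows "level D g rk (A a) (A b) = wmax h a b"
  using assms(3,4)
proof (induction b)
  case (Suc b)
  have hb: "wmax h b (Suc b) = h b"
    using assms(2)[of b] Suc.prems by (intro wmax_eqI) (auto simp: less_Suc_eq_le)
  show ?case
  proof (cases "a = Suc b")
    case False
    then have "a \<le> b" "b < n" using Suc.prems by auto
    then have IH: "level D g rk (A a) (A b) = wmax h a b" by (rule Suc.IH)
    have "level D g rk (A a) (A (Suc b)) = max (wmax h a b) (h b)"
    proof (cases "a = b")
      case True
      then show ?thesis using assms(2)[of b] Suc.prems by simp
    next
      case False
      then have "zle D g rk (A a) (A b)" "zle D g rk (A b) (A (Suc b))"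
        using \<open>a \<le> b\<close> Suc.prems by (auto intro!: assms(1))
      then show ?thesis using zle_trans_level IH assms(2)[of b] Suc.prems by metis
    qed
    then show ?thesis using wmax_split[of a b "Suc b" h] \<open>a \<le> b\<close> hb by simp
  qed simp
qed simp

text \<open>The number of heavy gaps to the left of a coordinate replaces the index of its grid
  cell. Points at mutual level at least \<open>r\<close> differ in one of these indices, and for
  points within \<open>W\<close> of \<open>c\<close> every index takes at most
  \<open>2 * t + 1\<close> values.\<close>

lemma level_packing:
  assumes fair: "fair x g 0 N" and mono: "\<And>i k. i \<le> k \<Longrightarrow> k \<le> N \<Longrightarrow> x i \<le> x k"
    and S: "finite S" "\<And>p q. p \<in> S \<Longrightarrow> q \<in> S \<Longrightarrow> p \<noteq> q \<Longrightarrow> r \<le> level D g rk p q"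
    and near: "\<And>p j. p \<in> S \<Longrightarrow> j < D \<Longrightarrow> rk p j \<le> N \<and> \<bar>x (rk p j) - x (rk c j)\<bar> \<le> W"
    and c: "\<And>j. j < D \<Longrightarrow> rk c j \<le> N" and r: "0 < r" and W: "0 \<le> W"
  shows "real (card S) \<le> (4 * W / r + 3) ^ D"
proof -
  define cnt where "cnt i = card {m. m < i \<and> r \<le> g m}" for i
  have cnt_split: "cnt k = cnt i + card {m. i \<le> m \<and> m < k \<and> r \<le> g m}" if "i \<le> k" for i k
  proof -
    have "{m. m < k \<and> r \<le> g m} = {m. m < i \<and> r \<le> g m} \<union> {m. i \<le> m \<and> m < k \<and> r \<le> g m}"
      using that by auto
    also have "card \<dots> = cnt i + card {m. i \<le> m \<and> m < k \<and> r \<le> g m}"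
      unfolding cnt_def by (intro card_Un_disjoint) auto
    finally show ?thesis by (simp add: cnt_def)
  qed
  \<comment> \<open>Bounds the number of heavy gaps in a window of width \<open>W\<close>, by
    \<open>fair_packing\<close>; since the count is an integer, rounding down loses nothing.\<close>
  define t where "t = nat \<lfloor>2 * W / r + 1\<rfloor>"
  have t: "real t \<le> 2 * W / r + 1" using W r by (simp add: t_def)
  have cnt_diff: "cnt k \<le> cnt i + t" if "i \<le> k" "k \<le> N" "\<bar>x k - x i\<bar> \<le> W" for i k
  proof -
    have "real (card {m. i \<le> m \<and> m < k \<and> r \<le> g m}) \<le> 2 * (x k - x i) / r + 1"
      using fair_packing[OF fair] mono that r by blast
    also have "\<dots> \<le> 2 * W / r + 1" using that r by (intro add_mono divide_right_mono) auto
    finally have "card {m. i \<le> m \<and> m < k \<and> r \<le> g m} \<le> t"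
      unfolding t_def by (rule le_nat_floor)
    then show ?thesis using cnt_split[OF that(1)] by simp
  qed
  have cnt_mono: "cnt i \<le> cnt k" if "i \<le> k" for i k
    using cnt_split[OF that] by simp
  have in_window: "cnt (rk p j) \<in> {cnt (rk c j) - t..cnt (rk c j) + t}" if pj: "p \<in> S" "j < D" for p j
  proof (cases "rk p j \<le> rk c j")
    case True
    have "cnt (rk c j) \<le> cnt (rk p j) + t"
      using cnt_diff[OF True c[OF pj(2)]] near[OF pj] by (simp add: abs_minus_commute)
    then show ?thesis using cnt_mono[OF True] by simp
  next
    case False
    then have le: "rk c j \<le> rk p j" by simp
    have "cnt (rk p j) \<le> cnt (rk c j) + t" using cnt_diff[OF le] near[OF pj] by simp
    then show ?thesis using cnt_mono[OF le] by simp
  qed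
  \<comment> \<open>The vector of cell indices. The restriction places it in a finite product, whose
    cardinality is then computed.\<close>
  define \<phi> where "\<phi> p = restrict (\<lambda>j. cnt (rk p j)) {..<D}" for p
  have "inj_on \<phi> S"
  proof (rule inj_onI, rule ccontr)
    fix p q assume pq: "p \<in> S" "q \<in> S" "\<phi> p = \<phi> q" "p \<noteq> q"
    then obtain j where j: "j < D" "r \<le> coord_level g rk p q j"
      using S(2)[of p q] le_level_iff[OF r] by blast
    then obtain m where m: "min (rk p j) (rk q j) \<le> m" "m < max (rk p j) (rk q j)" "r \<le> g m"
      using r by (auto simp: coord_level_def le_wmax_iff)
    have "card {m. min (rk p j) (rk q j) \<le> m \<and> m < max (rk p j) (rk q j) \<and> r \<le> g m} \<noteq> 0"
      using m by auto
    then have "cnt (min (rk p j) (rk q j)) \<noteq> cnt (max (rk p j) (rk q j))"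
      using cnt_split[of "min (rk p j) (rk q j)" "max (rk p j) (rk q j)"] by simp
    moreover have "cnt (rk p j) = cnt (rk q j)"
      using fun_cong[OF pq(3), of j] j by (simp add: \<phi>_def)
    ultimately show False by (simp add: min_def max_def split: if_splits)
  qed
  moreover have "\<phi> ` S \<subseteq> PiE {..<D} (\<lambda>j. {cnt (rk c j) - t..cnt (rk c j) + t})"
    unfolding \<phi>_def using in_window by (intro image_subsetI) (simp only: restrict_PiE_iff lessThan_iff, blast)
  ultimately have "card S \<le> card (PiE {..<D} (\<lambda>j. {cnt (rk c j) - t..cnt (rk c j) + t}))"
    by (intro card_inj_on_le finite_PiE) auto
  also have "\<dots> = (\<Prod>j<D. card {cnt (rk c j) - t..cnt (rk c j) + t})"
    by (simp add: card_PiE)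
  also have "\<dots> \<le> (\<Prod>j<D. 2 * t + 1)" by (intro prod_mono) auto
  also have "\<dots> = (2 * t + 1) ^ D" by simp
  finally have "real (card S) \<le> real ((2 * t + 1) ^ D)" by (simp only: of_nat_le_iff)
  also have "\<dots> = (2 * real t + 1) ^ D" by (simp add: add.commute)
  also have "\<dots> \<le> (4 * W / r + 3) ^ D" using t by (intro power_mono) auto
  finally show ?thesis .
qed

section \<open>Well-separated pairs of intervals\<close>

text \<open>Choosing the leftmost of several maxima makes recursive splitting deterministic; the
  intervals obtained are the nodes of the Cartesian tree of \<open>h\<close>.\<close>

definition amax :: "(nat \<Rightarrow> real) \<Rightarrow> nat \<Rightarrow> nat \<Rightarrow> nat" where
  "amax h a b = (LEAST m. a \<le> m \<and> m < b \<and> (\<forall>i. a \<le> i \<and> i < b \<longrightarrow> h i \<le> h m))"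

lemma amax_eqI:
  assumes "a \<le> m" "m < b" "\<And>i. a \<le> i \<Longrightarrow> i < b \<Longrightarrow> h i \<le> h m" "\<And>i. a \<le> i \<Longrightarrow> i < m \<Longrightarrow> h i < h m"
  shows "amax h a b = m"
  unfolding amax_def using assms by (intro Least_equality) (auto simp: not_le[symmetric])

lemma amax_props:
  assumes "a < b"
  shows amax_ge: "a \<le> amax h a b" and amax_less: "amax h a b < b"
    and amax_max: "a \<le> i \<Longrightarrow> i < b \<Longrightarrow> h i \<le> h (amax h a b)"
    and amax_first: "a \<le> i \<Longrightarrow> i < amax h a b \<Longrightarrow> h i < h (amax h a b)"
proof -
  let ?P = "\<lambda>m. a \<le> m \<and> m < b \<and> (\<forall>i. a \<le> i \<and> i < b \<longrightarrow> h i \<le> h m)"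
  have "Max (h ` {a..<b}) \<in> h ` {a..<b}" using assms by (intro Max_in) auto
  then obtain m where m: "m \<in> {a..<b}" "h m = Max (h ` {a..<b})" by auto
  moreover have "h i \<le> h m" if "i \<in> {a..<b}" for i unfolding m(2) using that by (intro Max_ge) auto
  ultimately have "\<exists>m\<in>{a..<b}. \<forall>i\<in>{a..<b}. h i \<le> h m" by blast
  then have ex: "\<exists>m. ?P m" by auto
  have P: "?P (amax h a b)" unfolding amax_def by (rule LeastI_ex[OF ex])
  then show "a \<le> amax h a b" "amax h a b < b" "a \<le> i \<Longrightarrow> i < b \<Longrightarrow> h i \<le> h (amax h a b)" by auto
  show "h i < h (amax h a b)" if "a \<le> i" "i < amax h a b"
  proof (rule ccontr)
    assume "\<not> h i < h (amax h a b)"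
    then have "?P i" using P that by (auto intro: order_trans)
    then have "amax h a b \<le> i" unfolding amax_def by (rule Least_le)
    then show False using that by simp
  qed
qed

lemma wmax_amax: "a < b \<Longrightarrow> 0 \<le> h (amax h a b) \<Longrightarrow> wmax h a b = h (amax h a b)"
  by (intro wmax_eqI amax_props)

type_synonym interval_pair = "nat \<times> nat \<times> nat \<times> nat"

text \<open>Positions \<open>0..<n\<close> in Z-order are separated by gaps of weight \<open>h\<close>. The pair \<open>(a, b, c, d)\<close>
  stands for the intervals \<open>{a..b}\<close> and \<open>{c..d}\<close>, represented by their first points;
  they are either equal or the first one lies to the left of the second.\<close>

locale pair_tree =
  fixes n :: nat and h :: "nat \<Rightarrow> real" and dst :: "nat \<Rightarrow> nat \<Rightarrow> real" and \<delta> :: real and B :: nat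
  assumes h_pos: "Suc i < n \<Longrightarrow> 0 < h i"
    and dst_nonneg: "0 \<le> dst i k" and dst_commute: "dst i k = dst k i"
    and \<delta>_pos: "0 < \<delta>" and n_pos: "0 < n"
    and packing: "\<And>S a r. 0 < r \<Longrightarrow> S \<subseteq> {..<n} \<Longrightarrow> a < n \<Longrightarrow> (\<And>c. c \<in> S \<Longrightarrow> \<delta> * dst a c < r) \<Longrightarrow>
      (\<And>c c'. c \<in> S \<Longrightarrow> c' \<in> S \<Longrightarrow> c < c' \<Longrightarrow> r \<le> wmax h c c') \<Longrightarrow> card S \<le> B"
begin

abbreviation peak :: "nat \<Rightarrow> nat \<Rightarrow> nat" where "peak \<equiv> amax h"

definition halves :: "nat \<Rightarrow> nat \<Rightarrow> (nat \<times> nat) list" where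
  "halves a b = (if a < b then [(a, peak a b), (Suc (peak a b), b)] else [])"

section \<open>The recursion on pairs of intervals\<close>

text \<open>Separation is tested with the two weights and a single distance, that of the first
  points. The guards \<open>a < b\<close> and \<open>c < d\<close> make the intervals shrink for
  arbitrary arguments, on which the termination of \<open>calls\<close> rests; for a valid pair of
  different intervals that is not separated, the weight test already implies them.\<close>

fun children :: "interval_pair \<Rightarrow> interval_pair list" where
  "children (a, b, c, d) =
     (if a = c \<and> b = d then
        (if a < b then [(a, peak a b, a, peak a b), (Suc (peak a b), b, Suc (peak a b), b),
           (a, peak a b, Suc (peak a b), b)] else [])
      else if max (wmax h a b) (wmax h c d) \<le> \<delta> * dst a c then []
      else if wmax h a b < wmax h c d then
        (if c < d then [(a, b, c, peak c d), (a, b, Suc (peak c d), d)] else [])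
      else
        (if a < b then [(a, peak a b, c, d), (Suc (peak a b), b, c, d)] else []))"

fun extent :: "interval_pair \<Rightarrow> nat" where "extent (a, b, c, d) = (b - a) + (d - c)"

lemma extent_children: "q' \<in> set (children q) \<Longrightarrow> extent q' < extent q"
proof -
  assume q': "q' \<in> set (children q)"
  obtain a b c d where q: "q = (a, b, c, d)" by (metis prod_cases4)
  have "a < b \<Longrightarrow> a \<le> peak a b \<and> peak a b < b" "c < d \<Longrightarrow> c \<le> peak c d \<and> peak c d < d"
    using amax_props(1,2) by auto
  then show ?thesis using q' unfolding q by (auto split: if_splits)
qed

text \<open>The size of the recursion tree, which becomes the number of iterations of the loop over
  the stack of pairs.\<close>

function calls :: "interval_pair \<Rightarrow> nat" where
  "calls q = 1 + sum_list (map calls (children q))"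
  by pat_completeness auto
termination by (relation "Wellfounded.measure extent") (auto dest: extent_children)

declare calls.simps [simp del]

text \<open>Ties between equal weights are broken in favour of the left gap, so that \<open>peak a b\<close> is the
  greatest gap inside \<open>{a..b}\<close>.\<close>

definition lower :: "nat \<Rightarrow> nat \<Rightarrow> bool" where
  "lower i k \<longleftrightarrow> h i < h k \<or> h i = h k \<and> k < i"

lemma lower_asym: "lower i k \<Longrightarrow> \<not> lower k i"
  by (auto simp: lower_def)

lemma lower_le: "lower i k \<Longrightarrow> h i \<le> h k"
  by (auto simp: lower_def)

lemma lower_peak: "a \<le> i \<Longrightarrow> i < b \<Longrightarrow> i \<noteq> peak a b \<Longrightarrow> lower i (peak a b)"
  using amax_max[of a b i h] amax_first[of a b i h] unfolding lower_def
  by (metis le_less_trans linorder_neqE_nat order_le_imp_less_or_eq)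

section \<open>Nodes of the Cartesian tree and valid pairs\<close>

text \<open>Every inner gap is lower than the gaps at both ends, as holds for nodes of the Cartesian
  tree. Writing \<open>Suc e = a\<close> avoids the truncated subtraction at \<open>a = 0\<close>,
  and \<open>Suc e < n\<close> discards the absent gap behind the last position.\<close>

definition node :: "nat \<Rightarrow> nat \<Rightarrow> bool" where
  "node a b \<longleftrightarrow> (\<forall>i e. a \<le> i \<longrightarrow> i < b \<longrightarrow> Suc e = a \<or> e = b \<longrightarrow> Suc e < n \<longrightarrow> lower i e)"

text \<open>The two intervals are mixed on purpose: the inner gaps of either one are lower than the
  end gaps of both. Splitting the heavier interval preserves this, and it keeps the partners of a
  charged split apart.\<close>

fun valid :: "interval_pair \<Rightarrow> bool" where
  "valid (a, b, c, d) \<longleftrightarrow> a \<le> b \<and> c \<le> d \<and> d < n \<and> (a = c \<and> b = d \<or> b < c) \<and>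
     (\<forall>i e. a \<le> i \<and> i < b \<or> c \<le> i \<and> i < d \<longrightarrow>
        Suc e = a \<or> e = b \<or> Suc e = c \<or> e = d \<longrightarrow> Suc e < n \<longrightarrow> lower i e)"

lemma valid_node: "valid (a, b, c, d) \<Longrightarrow> node a b \<and> node c d"
  by (auto simp: node_def)

lemma wmax_peak: "a < b \<Longrightarrow> b < n \<Longrightarrow> wmax h a b = h (peak a b)"
  using amax_props(2)[of a b h] h_pos[of "peak a b"] by (intro wmax_amax) auto

lemma wmax_pos_less: "a \<le> b \<Longrightarrow> 0 < wmax h a b \<Longrightarrow> a < b"
  by (metis le_neq_implies_less order_less_irrefl wmax_same)

text \<open>The tie rules agree: on equal weights the left interval is split, and
  \<open>lower\<close> ranks the gap further left higher.\<close>

lemma lower_left_peak: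
  assumes "a < b" "b < c" "d < n" "\<not> wmax h a b < wmax h c d" "c \<le> i" "i < d"
  shows "lower i (peak a b)"
proof -
  have "h i \<le> wmax h c d" using assms by (intro wmax_ge)
  also have "\<dots> \<le> h (peak a b)" using assms wmax_peak[of a b] by simp
  finally show ?thesis using amax_less[of a b h] assms by (auto simp: lower_def)
qed

lemma lower_right_peak:
  assumes "c < d" "d < n" "wmax h a b < wmax h c d" "a \<le> i" "i < b"
  shows "lower i (peak c d)"
proof -
  have "h i \<le> wmax h a b" using assms by (intro wmax_ge)
  also have "\<dots> < h (peak c d)" using assms wmax_peak[of c d] by simp
  finally show ?thesis by (simp add: lower_def)
qed

text \<open>The only new end gap is the peak at which the split takes place, and it is the greatest
  of all gaps inside either interval.\<close>

lemma valid_children: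
  assumes q: "valid q" and q': "q' \<in> set (children q)"
  shows "valid q'"
proof -
  obtain a b c d where abcd: "q = (a, b, c, d)" by (metis prod_cases4)
  have v: "a \<le> b" "c \<le> d" "d < n" "a = c \<and> b = d \<or> b < c" using q abcd by auto
  have low: "lower i e" if "a \<le> i \<and> i < b \<or> c \<le> i \<and> i < d"
    "Suc e = a \<or> e = b \<or> Suc e = c \<or> e = d" "Suc e < n" for i e
    using q that unfolding abcd valid.simps by blast
  consider (diag) "a = c" "b = d" "a < b" "q' \<in> {(a, peak a b, a, peak a b), (Suc (peak a b), b, Suc (peak a b), b),
           (a, peak a b, Suc (peak a b), b)}"
    | (right) "b < c" "wmax h a b < wmax h c d" "c < d" "q' \<in> {(a, b, c, peak c d), (a, b, Suc (peak c d), d)}"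
    | (left) "b < c" "\<not> wmax h a b < wmax h c d" "a < b" "q' \<in> {(a, peak a b, c, d), (Suc (peak a b), b, c, d)}"
    using q' v unfolding abcd by (auto split: if_splits)
  then show ?thesis
  proof cases
    case diag
    define m where "m = peak a b"
    have m: "a \<le> m" "m < b" "\<And>i. a \<le> i \<Longrightarrow> i < b \<Longrightarrow> i \<noteq> m \<Longrightarrow> lower i m"
      using amax_props(1,2)[of a b h] lower_peak diag unfolding m_def by auto
    have "lower i e" if "a \<le> i \<and> i < m \<or> Suc m \<le> i \<and> i < b" "Suc e = a \<or> e = m \<or> e = b" "Suc e < n" for i e
      using that low[of i e] m diag by (cases "e = m") auto
    then show ?thesis using diag(4) m v diag(1,2) unfolding m_def[symmetric] by auto
  next
    case right
    define m where "m = peak c d"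
    have m: "c \<le> m" "m < d" "\<And>i. c \<le> i \<Longrightarrow> i < d \<Longrightarrow> i \<noteq> m \<Longrightarrow> lower i m"
      "\<And>i. a \<le> i \<Longrightarrow> i < b \<Longrightarrow> lower i m"
      using amax_props(1,2)[of c d h] lower_peak lower_right_peak[of c d a b] right v unfolding m_def by auto
    have "lower i e" if "a \<le> i \<and> i < b \<or> c \<le> i \<and> i < m \<or> Suc m \<le> i \<and> i < d"
      "Suc e = a \<or> e = b \<or> Suc e = c \<or> e = m \<or> e = d" "Suc e < n" for i e
      using that low[of i e] m by (cases "e = m") auto
    then show ?thesis using right(4) m v right(1) unfolding m_def[symmetric] by auto
  next
    case left
    define m where "m = peak a b"
    have m: "a \<le> m" "m < b" "\<And>i. a \<le> i \<Longrightarrow> i < b \<Longrightarrow> i \<noteq> m \<Longrightarrow> lower i m"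
      "\<And>i. c \<le> i \<Longrightarrow> i < d \<Longrightarrow> lower i m"
      using amax_props(1,2)[of a b h] lower_peak lower_left_peak[of a b c d] left v unfolding m_def by auto
    have "lower i e" if "a \<le> i \<and> i < m \<or> Suc m \<le> i \<and> i < b \<or> c \<le> i \<and> i < d"
      "Suc e = a \<or> e = m \<or> e = b \<or> Suc e = c \<or> e = d" "Suc e < n" for i e
      using that low[of i e] m by (cases "e = m") auto
    then show ?thesis using left(4) m v left(1) unfolding m_def[symmetric] by auto
  qed
qed

section \<open>Counting the nodes of the recursion\<close>

text \<open>Descendants have nonempty subrectangles and siblings have disjoint ones. Hence no pair
  is reached through two different siblings, and the inner nodes may be counted as a set.\<close>

fun rect :: "interval_pair \<Rightarrow> (nat \<times> nat) set" where
  "rect (a, b, c, d) = {a..b} \<times> {c..d}"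

lemma rect_children: "valid q \<Longrightarrow> q' \<in> set (children q) \<Longrightarrow> rect q' \<subseteq> rect q"
proof -
  assume q: "valid q" and q': "q' \<in> set (children q)"
  obtain a b c d where abcd: "q = (a, b, c, d)" by (metis prod_cases4)
  have "a < b \<Longrightarrow> a \<le> peak a b \<and> peak a b < b" "c < d \<Longrightarrow> c \<le> peak c d \<and> peak c d < d"
    using amax_props(1,2) by auto
  then show ?thesis using q q' unfolding abcd by (auto split: if_splits)
qed

lemma rect_nonempty: "valid q \<Longrightarrow> rect q \<noteq> {}"
  by (cases q) auto

lemma rect_children_disjoint:
  "sorted_wrt (\<lambda>q q'. rect q \<inter> rect q' = {}) (children q)"
  by (cases q) (auto split: if_splits)

definition child_rel :: "(interval_pair \<times> interval_pair) set" where
  "child_rel = {(q, q'). q' \<in> set (children q)}"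

text \<open>The inner nodes of the recursion tree below \<open>q\<close>.\<close>

definition splits :: "interval_pair \<Rightarrow> interval_pair set" where
  "splits q = {q'. (q, q') \<in> child_rel\<^sup>* \<and> children q' \<noteq> []}"

lemma descendant:
  assumes "(q, q') \<in> child_rel\<^sup>*" "valid q"
  shows "valid q' \<and> rect q' \<subseteq> rect q \<and> extent q' \<le> extent q"
  using assms
proof (induction rule: rtrancl_induct)
  case (step y z)
  then have "valid y" "z \<in> set (children y)" by (auto simp: child_rel_def)
  then have "valid z" "rect z \<subseteq> rect y" "extent z < extent y"
    using step.IH step.prems valid_children rect_children extent_children by blast+
  then show ?case using step by auto
qed auto

lemma finite_splits: "valid q \<Longrightarrow> finite (splits q)"
proof (rule finite_subset)
  assume "valid q"
  show "splits q \<subseteq> {..<n} \<times> {..<n} \<times> {..<n} \<times> {..<n}"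
  proof
    fix q' assume "q' \<in> splits q"
    then have "valid q'" using \<open>valid q\<close> descendant unfolding splits_def by blast
    then show "q' \<in> {..<n} \<times> {..<n} \<times> {..<n} \<times> {..<n}" by (cases q') auto
  qed
qed simp

lemma splits_unfold:
  "children q \<noteq> [] \<Longrightarrow> splits q = insert q (\<Union>q'\<in>set (children q). splits q')"
  unfolding splits_def child_rel_def
  by (auto elim: converse_rtranclE intro: converse_rtrancl_into_rtrancl)

lemma card_UN_sorted_wrt:
  assumes "sorted_wrt (\<lambda>x y. F x \<inter> F y = {}) xs" "\<And>x. x \<in> set xs \<Longrightarrow> finite (F x)"
  shows "card (\<Union>x\<in>set xs. F x) = sum_list (map (\<lambda>x. card (F x)) xs)"
  using assms
proof (induction xs)
  case (Cons y ys)
  have "card (F y \<union> (\<Union>x\<in>set ys. F x)) = card (F y) + card (\<Union>x\<in>set ys. F x)"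
    using Cons.prems by (intro card_Un_disjoint) auto
  then show ?case using Cons by simp
qed simp

text \<open>Every node except the root is one of at most three children of an inner node.\<close>

lemma calls_le: "valid q \<Longrightarrow> calls q \<le> 1 + 3 * card (splits q)"
proof (induction q rule: calls.induct)
  case (1 q)
  show ?case
  proof (cases "children q = []")
    case False
    let ?cs = "children q"
    have v: "valid q'" if "q' \<in> set ?cs" for q' using valid_children 1(2) that by blast
    have disj: "splits p \<inter> splits q' = {}"
      if "p \<in> set ?cs" "q' \<in> set ?cs" "rect p \<inter> rect q' = {}" for p q'
    proof (rule ccontr)
      assume "splits p \<inter> splits q' \<noteq> {}"
      then obtain z where "(p, z) \<in> child_rel\<^sup>*" "(q', z) \<in> child_rel\<^sup>*" by (auto simp: splits_def)
      then have "rect z \<subseteq> rect p" "rect z \<subseteq> rect q'" "rect z \<noteq> {}"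
        using descendant rect_nonempty v that by blast+
      then show False using that(3) by blast
    qed
    have "sorted_wrt (\<lambda>p q'. splits p \<inter> splits q' = {}) ?cs"
      by (rule sorted_wrt_mono_rel[OF _ rect_children_disjoint]) (rule disj)
    then have card: "card (\<Union>q'\<in>set ?cs. splits q') = sum_list (map (\<lambda>q'. card (splits q')) ?cs)"
      using v finite_splits by (intro card_UN_sorted_wrt) auto
    \<comment> \<open>The extent decreases strictly along the recursion, so a node is not its own
      proper descendant.\<close>
    have "q \<notin> (\<Union>q'\<in>set ?cs. splits q')"
    proof
      assume "q \<in> (\<Union>q'\<in>set ?cs. splits q')"
      then obtain q' where q': "q' \<in> set ?cs" "(q', q) \<in> child_rel\<^sup>*" unfolding splits_def by blast
      then show False using descendant[OF q'(2) v[OF q'(1)]] extent_children[OF q'(1)] by linarith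
    qed
    then have spl: "card (splits q) = 1 + sum_list (map (\<lambda>q'. card (splits q')) ?cs)"
      using splits_unfold[OF False] v finite_splits card by simp
    have "calls q \<le> 1 + sum_list (map (\<lambda>q'. 1 + 3 * card (splits q')) ?cs)"
      using 1 v by (subst calls.simps) (auto intro: sum_list_mono)
    also have "\<dots> = 1 + length ?cs + 3 * sum_list (map (\<lambda>q'. card (splits q')) ?cs)"
      by (simp only: sum_list_addf sum_list_const_mult sum_list_triv) simp
    also have "length ?cs \<le> 3" by (cases q) auto
    finally show ?thesis using spl by simp
  qed (simp add: calls.simps)
qed

section \<open>Charging splits to gaps\<close>

text \<open>If one of the intervals began or ended later than the other, one of its end gaps would
  lie inside the other interval. It would then be lower than the common peak as an inner gap and
  higher as an end gap.\<close>

lemma node_unique: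
  assumes "node a b" "node a' b'" "peak a b = peak a' b'" "a < b" "a' < b'" "b < n" "b' < n"
  shows "a = a' \<and> b = b'"
proof -
  have *: "\<not> a < a'" "\<not> b < b'"
    if "node a b" "node a' b'" "peak a b = peak a' b'" "a < b" "a' < b'" "b < n" "b' < n" for a b a' b'
  proof -
    let ?m = "peak a b"
    have m: "a \<le> ?m" "?m < b" "a' \<le> ?m" "?m < b'"
      using amax_props(1,2)[of a b h] amax_props(1,2)[of a' b' h] that by auto
    show "\<not> a < a'"
    proof
      assume "a < a'"
      then have "lower (a' - 1) ?m" using m that by (intro lower_peak) auto
      moreover have "lower ?m (a' - 1)"
        using that(2) m \<open>a < a'\<close> that(7) unfolding node_def by auto
      ultimately show False using lower_asym by blast
    qed
    show "\<not> b < b'"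
    proof
      assume "b < b'"
      then have "lower b (peak a' b')" using m that by (intro lower_peak) auto
      moreover have "lower ?m b"
        using that(1) m \<open>b < b'\<close> that(7) unfolding node_def by auto
      ultimately show False using lower_asym that(3) by auto
    qed
  qed
  show ?thesis using *[OF assms] *[OF assms(2,1) assms(3)[symmetric] assms(5,4,7,6)] by auto
qed

text \<open>Splitting \<open>{a..b}\<close> in a pair with \<open>{c..d}\<close>, on either side, is charged to the gap \<open>peak a b\<close>
  and the position \<open>c\<close>.\<close>

definition charged_splits :: "interval_pair set" where
  "charged_splits = {(a, b, c, d). a < b \<and> b < n \<and> c \<le> d \<and> d < n \<and> node a b \<and>
     \<delta> * dst a c < h (peak a b) \<and> (\<forall>i. c \<le> i \<longrightarrow> i < d \<longrightarrow> lower i (peak a b)) \<and>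
     (\<forall>e. Suc e = c \<or> e = d \<longrightarrow> Suc e < n \<longrightarrow> lower (peak a b) e)}"

definition diagonal_splits :: "interval_pair set" where
  "diagonal_splits = {(a, b, c, d). valid (a, b, c, d) \<and> a = c \<and> b = d \<and> a < b}"

text \<open>The peak determines the interval, so every gap is charged at most once.\<close>

lemma card_diagonal_splits: "card diagonal_splits \<le> n"
proof -
  have "inj_on (\<lambda>(a, b, c, d). peak a b) diagonal_splits"
  proof (rule inj_onI)
    fix q q'
    assume "q \<in> diagonal_splits" "q' \<in> diagonal_splits"
      "(case q of (a, b, c, d) \<Rightarrow> peak a b) = (case q' of (a, b, c, d) \<Rightarrow> peak a b)"
    moreover obtain a b c d a' b' c' d' where q: "q = (a, b, c, d)" "q' = (a', b', c', d')"
      by (metis prod_cases4)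
    ultimately have *: "(a, b, c, d) \<in> diagonal_splits" "(a', b', c', d') \<in> diagonal_splits" "peak a b = peak a' b'"
      by simp_all
    have "node a b" "node a' b'" using * valid_node by (auto simp: diagonal_splits_def simp del: valid.simps)
    then have "a = a' \<and> b = b'" using * by (intro node_unique) (auto simp: diagonal_splits_def)
    then show "q = q'" unfolding q using * by (auto simp: diagonal_splits_def)
  qed
  moreover have "(\<lambda>(a, b, c, d). peak a b) ` diagonal_splits \<subseteq> {..<n}"
  proof
    fix m assume "m \<in> (\<lambda>(a, b, c, d). peak a b) ` diagonal_splits"
    then obtain a b c d where *: "(a, b, c, d) \<in> diagonal_splits" "m = peak a b" by auto
    then have "a < b" "b < n" by (auto simp: diagonal_splits_def)
    then show "m \<in> {..<n}" using amax_less[of a b h] *(2) by simp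
  qed
  ultimately have "card diagonal_splits \<le> card {..<n}" by (intro card_inj_on_le) auto
  then show ?thesis by simp
qed

lemma card_charged:
  assumes inj: "inj_on (\<lambda>q. (M q, p q)) X" and M: "\<And>q. q \<in> X \<Longrightarrow> M q < n"
    and B: "\<And>m. card (p ` {q \<in> X. M q = m}) \<le> B" and fin: "finite X"
  shows "card X \<le> n * B"
proof -
  have "card X = card ((\<lambda>q. (M q, p q)) ` X)" using inj by (simp add: card_image)
  also have "\<dots> \<le> card (SIGMA m:{..<n}. p ` {q \<in> X. M q = m})"
    using fin M by (intro card_mono) auto
  also have "\<dots> = (\<Sum>m<n. card (p ` {q \<in> X. M q = m}))" using fin by (intro card_SigmaI) auto
  also have "\<dots> \<le> (\<Sum>m<n. B)" using B by (intro sum_mono)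
  finally show ?thesis by simp
qed

lemma valid_lower:
  "valid (a, b, c, d) \<Longrightarrow> a \<le> i \<and> i < b \<or> c \<le> i \<and> i < d \<Longrightarrow>
   Suc e = a \<or> e = b \<or> Suc e = c \<or> e = d \<Longrightarrow> Suc e < n \<Longrightarrow> lower i e"
  unfolding valid.simps by blast

lemma validD: "valid (a, b, c, d) \<Longrightarrow> a \<le> b \<and> c \<le> d \<and> d < n"
  by simp

text \<open>A gap determines the interval that is split there, and the position \<open>c\<close>
  then determines the partner interval. All these positions are near \<open>a\<close> relative to
  the weight of the gap and separated by gaps at least as heavy, so packing leaves at most
  \<open>B\<close> of them.\<close>

lemma card_charged_splits: "card charged_splits \<le> n * B"
proof (rule card_charged[where M = "\<lambda>(a, b, c, d). peak a b" and p = "\<lambda>(a, b, c, d). c"])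
  have D: "a < b" "b < n" "c \<le> d" "d < n" "node a b" "\<delta> * dst a c < h (peak a b)"
    and inner: "\<And>i. c \<le> i \<Longrightarrow> i < d \<Longrightarrow> lower i (peak a b)"
    and boundary: "\<And>e. Suc e = c \<or> e = d \<Longrightarrow> Suc e < n \<Longrightarrow> lower (peak a b) e"
    if "(a, b, c, d) \<in> charged_splits" for a b c d
    using that unfolding charged_splits_def by blast+
  have same: "a = a' \<and> b = b'"
    if "(a, b, c, d) \<in> charged_splits" "(a', b', c', d') \<in> charged_splits" "peak a b = peak a' b'" for a b c d a' b' c' d'
    using D[OF that(1)] D[OF that(2)] that(3) by (intro node_unique) simp_all
  show "inj_on (\<lambda>q. (case q of (a, b, c, d) \<Rightarrow> peak a b, case q of (a, b, c, d) \<Rightarrow> c)) charged_splits"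
  proof (rule inj_onI, clarsimp)
    fix a b c d a' b' d'
    assume *: "(a, b, c, d) \<in> charged_splits" "(a', b', c, d') \<in> charged_splits" "peak a b = peak a' b'"
    have [simp]: "a' = a" "b' = b" using same[OF *] by auto
    \<comment> \<open>Otherwise the gap \<open>d\<close> would be an inner gap of the longer
      partner, hence lower than the peak, and an end gap of the shorter one, hence higher.\<close>
    have "\<not> d < d'" if "(a, b, c, d) \<in> charged_splits" "(a, b, c, d') \<in> charged_splits" for d d'
    proof
      assume "d < d'"
      then have "lower d (peak a b)" using inner[OF that(2), of d] D(3)[OF that(1)] by simp
      moreover have "lower (peak a b) d"
        using boundary[OF that(1), of d] D(4)[OF that(2)] \<open>d < d'\<close> by simp
      ultimately show False using lower_asym by blast
    qed
    then show "a = a' \<and> b = b' \<and> d = d'" using * by (metis \<open>a' = a\<close> \<open>b' = b\<close> linorder_neqE_nat)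
  qed
  show "(case q of (a, b, c, d) \<Rightarrow> peak a b) < n" if "q \<in> charged_splits" for q
  proof -
    obtain a b c d where q: "q = (a, b, c, d)" by (metis prod_cases4)
    show ?thesis using D(1,2)[OF that[unfolded q]] amax_less[of a b h] unfolding q by simp
  qed
  show "finite charged_splits"
    by (rule finite_subset[of _ "{..<n} \<times> {..<n} \<times> {..<n} \<times> {..<n}"]) (auto simp: charged_splits_def)
  fix m
  let ?X = "{q \<in> charged_splits. (case q of (a, b, c, d) \<Rightarrow> peak a b) = m}"
  show "card ((\<lambda>(a, b, c, d). c) ` ?X) \<le> B"
  proof (cases "?X = {}")
    case True
    then show ?thesis by (simp only: True) simp
  next
    case False
    then obtain a b c0 d0 where q0: "(a, b, c0, d0) \<in> charged_splits" "peak a b = m" by auto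
    have X: "\<exists>d. (a, b, c, d) \<in> charged_splits" if "c \<in> (\<lambda>(a, b, c, d). c) ` ?X" for c
      using that same[OF _ q0(1)] q0(2) by fastforce
    \<comment> \<open>Packing at the scale of the charged gap: no split takes place once
      \<open>\<delta> * dst a c\<close> reaches its weight.\<close>
    show ?thesis
    proof (rule packing[where a = a and r = "h m"])
      show "0 < h m" using D(1,2)[OF q0(1)] amax_less[of a b h] q0(2) by (intro h_pos) simp
      show "(\<lambda>(a, b, c, d). c) ` ?X \<subseteq> {..<n}"
      proof
        fix c assume "c \<in> (\<lambda>(a, b, c, d). c) ` ?X"
        then obtain d where "(a, b, c, d) \<in> charged_splits" using X by blast
        then show "c \<in> {..<n}" using D(3,4)[of a b c d] by simp
      qed
      show "a < n" using D(1,2)[OF q0(1)] by simp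
      show "\<delta> * dst a c < h m" if "c \<in> (\<lambda>(a, b, c, d). c) ` ?X" for c
        using X[OF that] D(6) q0(2) by blast
      fix c c' assume c: "c \<in> (\<lambda>(a, b, c, d). c) ` ?X" "c' \<in> (\<lambda>(a, b, c, d). c) ` ?X" "c < c'"
      obtain d' where q': "(a, b, c', d') \<in> charged_splits" using X[OF c(2)] by blast
      \<comment> \<open>The gap just before \<open>c'\<close> is an end gap of the second partner
        and lies between the two positions.\<close>
      have "lower m (c' - 1)"
        using boundary[OF q', of "c' - 1"] D(3,4)[OF q'] q0(2) c(3) by simp
      then have "h m \<le> h (c' - 1)" by (rule lower_le)
      also have "\<dots> \<le> wmax h c c'" using c(3) by (intro wmax_ge) auto
      finally show "h m \<le> wmax h c c'" .
    qed
  qed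
qed

lemma left_split_charged:
  assumes q: "valid (a, b, c, d)" and lt: "b < c" "a < b"
    and big: "\<delta> * dst a c < wmax h a b" "\<not> wmax h a b < wmax h c d"
  shows "(a, b, c, d) \<in> charged_splits"
proof -
  have v: "c \<le> d" "d < n" "node a b" using validD[OF q] valid_node[OF q] by auto
  have m: "a \<le> peak a b" "peak a b < b" using lt(2) amax_props(1,2) by auto
  have "lower i (peak a b)" if "c \<le> i" "i < d" for i
    using lower_left_peak[OF lt(2,1) v(2) big(2) that] .
  moreover have "lower (peak a b) e" if "Suc e = c \<or> e = d" "Suc e < n" for e
    using valid_lower[OF q, of "peak a b" e] m that by blast
  ultimately show ?thesis
    using v lt big(1) wmax_peak[of a b] by (simp add: charged_splits_def)
qed

text \<open>The intervals exchange roles: the charge goes to a gap in \<open>{c..d}\<close> and to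
  the position \<open>a\<close>, so that one counting argument serves both sides.\<close>

lemma right_split_charged:
  assumes q: "valid (a, b, c, d)" and lt: "b < c" "c < d"
    and big: "\<delta> * dst a c < wmax h c d" "wmax h a b < wmax h c d"
  shows "(c, d, a, b) \<in> charged_splits"
proof -
  have v: "a \<le> b" "d < n" "node c d" using validD[OF q] valid_node[OF q] by auto
  have m: "c \<le> peak c d" "peak c d < d" using lt(2) amax_props(1,2) by auto
  have "lower i (peak c d)" if "a \<le> i" "i < b" for i
    using lower_right_peak[OF lt(2) v(2) big(2) that] .
  moreover have "lower (peak c d) e" if "Suc e = a \<or> e = b" "Suc e < n" for e
    using valid_lower[OF q, of "peak c d" e] m that by blast
  ultimately show ?thesis
    using v lt big(1) wmax_peak[of c d] dst_commute[of a c] by (simp add: charged_splits_def)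
qed

lemma valid_root: "valid (0, n - 1, 0, n - 1)"
  using n_pos by auto

text \<open>There are at most \<open>n\<close> splits on the diagonal and at most
  \<open>n * B\<close> charged splits on either side.\<close>

lemma calls_root: "calls (0, n - 1, 0, n - 1) \<le> 1 + 3 * (n + 2 * (n * B))"
proof -
  let ?r = "(0, n - 1, 0, n - 1) :: interval_pair"
  let ?swap = "\<lambda>(a, b, c, d). (c, d, a, b) :: interval_pair"
  have finite: "finite charged_splits" "finite diagonal_splits"
    by (rule finite_subset[of _ "{..<n} \<times> {..<n} \<times> {..<n} \<times> {..<n}"];
        auto simp: charged_splits_def diagonal_splits_def)+
  have "splits ?r \<subseteq> diagonal_splits \<union> (charged_splits \<union> ?swap ` charged_splits)"
  proof
    fix q assume "q \<in> splits ?r"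
    then have v: "valid q" and ne: "children q \<noteq> []"
      using descendant[OF _ valid_root] unfolding splits_def by blast+
    obtain a b c d where q: "q = (a, b, c, d)" by (metis prod_cases4)
    have "a \<le> b" "a = c \<and> b = d \<or> b < c" using v unfolding q by auto
    then consider "a = c" "b = d" "a < b" | "b < c" "a \<noteq> c" using ne unfolding q by (cases "a < b") auto
    then show "q \<in> diagonal_splits \<union> (charged_splits \<union> ?swap ` charged_splits)"
    proof cases
      case 1
      then have "q \<in> diagonal_splits" using v unfolding q diagonal_splits_def by blast
      then show ?thesis ..
    next
      case 2
      have big: "\<delta> * dst a c < max (wmax h a b) (wmax h c d)"
        "if wmax h a b < wmax h c d then c < d else a < b"
        using ne 2(2) unfolding q by (auto split: if_splits)
      show ?thesis
      proof (cases "wmax h a b < wmax h c d")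
        case True
        then have "(c, d, a, b) \<in> charged_splits"
          using right_split_charged[of a b c d] v big 2(1) unfolding q by (simp del: valid.simps)
        then have "q \<in> ?swap ` charged_splits" unfolding q by force
        then show ?thesis by blast
      next
        case False
        then have "q \<in> charged_splits"
          using left_split_charged[of a b c d] v big 2(1) unfolding q by (simp del: valid.simps)
        then show ?thesis by blast
      qed
    qed
  qed
  then have "card (splits ?r) \<le> card (diagonal_splits \<union> (charged_splits \<union> ?swap ` charged_splits))"
    using finite by (intro card_mono) auto
  also have "\<dots> \<le> card diagonal_splits + (card charged_splits + card (?swap ` charged_splits))"
    by (rule order_trans[OF card_Un_le add_left_mono[OF card_Un_le]])
  also have "\<dots> \<le> n + (n * B + n * B)"
    using card_diagonal_splits card_charged_splits card_image_le[OF finite(1), of ?swap] by linarith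
  finally show ?thesis using calls_le[OF valid_root] by simp
qed

section \<open>Coverage of all pairs of positions\<close>

fun cover :: "interval_pair \<Rightarrow> (nat \<times> nat) set" where
  "cover (a, b, c, d) = {(i, k). a \<le> i \<and> i \<le> b \<and> c \<le> k \<and> k \<le> d \<and> i < k}"

text \<open>For equal intervals a single mixed child is enough: if \<open>i < k\<close> are
  separated by the peak, then \<open>i\<close> is on its left and \<open>k\<close> on its
  right.\<close>

lemma cover_children:
  assumes "valid q" "children q \<noteq> []"
  shows "cover q \<subseteq> (\<Union>q'\<in>set (children q). cover q')"
proof
  fix z assume z: "z \<in> cover q"
  obtain a b c d where q: "q = (a, b, c, d)" by (metis prod_cases4)
  obtain i k where ik: "z = (i, k)" "a \<le> i" "i \<le> b" "c \<le> k" "k \<le> d" "i < k" using z q by auto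
  have bd: "a = c \<Longrightarrow> b = d" using assms(1) unfolding q valid.simps by auto
  have "\<exists>q'\<in>set (children q). (i, k) \<in> cover q'"
  proof (cases "a = c")
    case True
    then have "a < b" using assms(2) bd[OF True] unfolding q by (simp split: if_splits)
    then have cs: "set (children q) = {(a, peak a b, a, peak a b), (Suc (peak a b), b, Suc (peak a b), b),
           (a, peak a b, Suc (peak a b), b)}" unfolding q using True bd[OF True] by simp
    show ?thesis unfolding cs using ik bd[OF True] True
      by (cases "k \<le> peak a b"; cases "i \<le> peak a b") simp_all
  next
    case False
    then have "set (children q) = {(a, b, c, peak c d), (a, b, Suc (peak c d), d)} \<or>
      set (children q) = {(a, peak a b, c, d), (Suc (peak a b), b, c, d)}"
      using assms(2) unfolding q by (auto split: if_splits)
    then show ?thesis using ik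
      by (elim disjE; cases "k \<le> peak c d"; cases "i \<le> peak a b") simp_all
  qed
  then show "z \<in> (\<Union>q'\<in>set (children q). cover q')" using ik(1) by blast
qed

text \<open>If the test failed, the greater weight would be positive, its interval would contain a
  gap, and a split would follow.\<close>

lemma children_empty:
  assumes "valid (a, b, c, d)" "children (a, b, c, d) = []" "a \<noteq> c"
  shows "max (wmax h a b) (wmax h c d) \<le> \<delta> * dst a c"
proof (rule ccontr)
  assume not: "\<not> max (wmax h a b) (wmax h c d) \<le> \<delta> * dst a c"
  have "0 \<le> \<delta> * dst a c" using \<delta>_pos dst_nonneg by simp
  then have "0 < max (wmax h a b) (wmax h c d)" using not by linarith
  moreover have "a \<le> b" "c \<le> d" using assms(1) by auto
  ultimately have "(if wmax h a b < wmax h c d then c < d else a < b)"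
    using wmax_pos_less by (auto simp: max_def split: if_splits)
  then show False using assms(2,3) not by (auto split: if_splits)
qed

end

section \<open>Range maximum queries\<close>

definition log_tables :: com where
  "log_tables =
     (''m'' :=\<^sub>i IConst 1 ;; ''l'' :=\<^sub>i IConst 0 ;;
      IAssign ''pw'' (IConst 0) (IConst 1) ;; IAssign ''lg'' (IConst 1) (IConst 0)) ;;
     While (ILess (iscalar ''m'') (iscalar ''M''))
       (''m'' :=\<^sub>i IAdd (iscalar ''m'') (IConst 1) ;;
        Cond (ILess (iscalar ''m'') (IAdd (IGet ''pw'' (iscalar ''l'')) (IGet ''pw'' (iscalar ''l''))))
          Skip
          (''l'' :=\<^sub>i IAdd (iscalar ''l'') (IConst 1) ;;
           IAssign ''pw'' (iscalar ''l'')
             (IAdd (IGet ''pw'' (ISub (iscalar ''l'') (IConst 1))) (IGet ''pw'' (ISub (iscalar ''l'') (IConst 1))))) ;;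
        IAssign ''lg'' (iscalar ''m'') (iscalar ''l''))"

definition has_log_tables :: "store \<Rightarrow> nat \<Rightarrow> bool" where
  "has_log_tables s M \<longleftrightarrow> (\<forall>i. 1 \<le> i \<longrightarrow> i \<le> M \<longrightarrow> icell s ''lg'' i = floor_log i) \<and>
     (\<forall>l\<le>floor_log M. icell s ''pw'' l = 2 ^ l)"

lemma power_le_floor_log: "2 ^ l \<le> m \<Longrightarrow> l \<le> floor_log m"
  using floor_log_le_iff[of "2 ^ l" m] by simp

lemma floor_log_Suc_eq:
  assumes "1 \<le> m"
  shows "floor_log (Suc m) = (if Suc m < 2 ^ floor_log m + 2 ^ floor_log m then floor_log m else Suc (floor_log m))"
proof -
  have "2 ^ floor_log m \<le> m" "m < 2 * 2 ^ floor_log m"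
    using assms by (auto intro: floor_log_exp2_le floor_log_exp2_gt)
  then show ?thesis by (auto intro!: floor_log_eqI)
qed

lemma runs_log_tables:
  assumes M: "icell s ''M'' 0 = M" "1 \<le> M"
  shows "runs log_tables s (100 * M) (\<lambda>s'. has_log_tables s' M)"
  unfolding log_tables_def
proof (rule runs_seq_wp[where Y = "70 * M"], unfold wp.simps,
    rule runs_while[where T = 60 and \<mu> = "\<lambda>s'. M - icell s' ''m'' 0" and
     I = "\<lambda>s'. 1 \<le> icell s' ''m'' 0 \<and> icell s' ''m'' 0 \<le> M \<and> icell s' ''l'' 0 = floor_log (icell s' ''m'' 0) \<and>
      has_log_tables s' (icell s' ''m'' 0)"], goal_cases init step exit time cost)
  case init
  show ?case using M by (auto simp: has_log_tables_def)
next
  case (step s')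
  let ?m = "icell s' ''m'' 0" and ?l = "icell s' ''l'' 0"
  have *: "icell s' ''M'' 0 = M" using frame_icell[OF step(3), of "''M''"] M by simp
  have pw: "icell s' ''pw'' ?l = 2 ^ ?l"
    using step(1) floor_log_exp2_le[of ?m] by (auto simp: has_log_tables_def)
  have lg: "floor_log (Suc ?m) = (if Suc ?m < 2 ^ ?l + 2 ^ ?l then ?l else Suc ?l)"
    using floor_log_Suc_eq[of ?m] step(1) by simp
  show ?case
    by (rule runs_wp)
      (use step(1,2) * pw lg in \<open>auto simp: has_log_tables_def le_Suc_eq split: if_splits\<close>)
next
  case (exit s')
  have *: "icell s' ''M'' 0 = M" using frame_icell[OF exit(3), of "''M''"] M by simp
  then show ?case using exit(1,2) by auto
next
  case time
  show ?case using M by simp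
qed (use M in simp)

section \<open>Construction of the sparse table\<close>

text \<open>The windows may overlap, as they do in a query. On equal weights the left candidate
  wins, so the result is again the leftmost maximum.\<close>

lemma amax_join:
  assumes "a \<le> k'" "k' \<le> k" "k \<le> b" "a < k" "k' < b"
  shows "amax h a b = (if h (amax h a k) < h (amax h k' b) then amax h k' b else amax h a k)"
proof -
  let ?L = "amax h a k" and ?R = "amax h k' b"
  have L: "a \<le> ?L" "?L < k" "\<And>i. a \<le> i \<Longrightarrow> i < k \<Longrightarrow> h i \<le> h ?L" "\<And>i. a \<le> i \<Longrightarrow> i < ?L \<Longrightarrow> h i < h ?L"
    using amax_props[OF assms(4)] by blast+
  have R: "k' \<le> ?R" "?R < b" "\<And>i. k' \<le> i \<Longrightarrow> i < b \<Longrightarrow> h i \<le> h ?R" "\<And>i. k' \<le> i \<Longrightarrow> i < ?R \<Longrightarrow> h i < h ?R"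
    using amax_props[OF assms(5)] by blast+
  show ?thesis
  proof (cases "h ?L < h ?R")
    case True
    have "amax h a b = ?R"
    proof (rule amax_eqI)
      show "h i \<le> h ?R" if "a \<le> i" "i < b" for i
        using L(3)[of i] R(3)[of i] that True assms by (cases "i < k") auto
      show "h i < h ?R" if "a \<le> i" "i < ?R" for i
        using L(3)[of i] R(4)[of i] that True assms by (cases "i < k") auto
    qed (use R assms in auto)
    then show ?thesis using True by simp
  next
    case False
    have "amax h a b = ?L"
    proof (rule amax_eqI)
      show "h i \<le> h ?L" if "a \<le> i" "i < b" for i
        using L(3)[of i] R(3)[of i] that False assms by (cases "i < k") auto
    qed (use L assms in auto)
    then show ?thesis using False by simp
  qed
qed

lemma amax_singleton [simp]: "amax h a (Suc a) = a"
  using amax_props(1,2)[of a "Suc a" h] by auto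

definition sparse_cell :: com where
  "sparse_cell =
     ''y'' :=\<^sub>i IGet ''T'' (IAdd (IGet ''row'' (iscalar ''l'')) (iscalar ''i'')) ;;
     ''z'' :=\<^sub>i IGet ''T'' (IAdd (IGet ''row'' (iscalar ''l''))
                        (IAdd (iscalar ''i'') (IGet ''pw'' (iscalar ''l'')))) ;;
     Cond (RLess (RGet ''g'' (iscalar ''y'')) (RGet ''g'' (iscalar ''z'')))
       (IAssign ''T'' (IAdd (IGet ''row'' (IAdd (iscalar ''l'') (IConst 1))) (iscalar ''i'')) (iscalar ''z''))
       (IAssign ''T'' (IAdd (IGet ''row'' (IAdd (iscalar ''l'') (IConst 1))) (iscalar ''i'')) (iscalar ''y'')) ;;
     ''i'' :=\<^sub>i IAdd (iscalar ''i'') (IConst 1)"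

text \<open>Row \<open>l\<close> starts at address \<open>l * N\<close>. The starting addresses are
  accumulated in the array \<open>row\<close>, since addresses cannot be multiplied.\<close>

definition sparse_row :: com where
  "sparse_row =
     (IAssign ''row'' (IAdd (iscalar ''l'') (IConst 1)) (IAdd (IGet ''row'' (iscalar ''l'')) (iscalar ''N'')) ;;
      ''i'' :=\<^sub>i IConst 0) ;;
     While (BNot (ILess (iscalar ''N'') (IAdd (iscalar ''i'')
         (IAdd (IGet ''pw'' (iscalar ''l'')) (IGet ''pw'' (iscalar ''l''))))))
       sparse_cell ;;
     ''l'' :=\<^sub>i IAdd (iscalar ''l'') (IConst 1)"

definition sparse_table :: com where
  "sparse_table =
     (''i'' :=\<^sub>i IConst 0 ;; ''l'' :=\<^sub>i IConst 0 ;; IAssign ''row'' (IConst 0) (IConst 0)) ;;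
     While (ILess (iscalar ''i'') (iscalar ''N''))
       (IAssign ''T'' (iscalar ''i'') (iscalar ''i'') ;; ''i'' :=\<^sub>i IAdd (iscalar ''i'') (IConst 1)) ;;
     While (BNot (ILess (iscalar ''N'') (IAdd (IGet ''pw'' (iscalar ''l'')) (IGet ''pw'' (iscalar ''l'')))))
       sparse_row"

text \<open>Row \<open>l\<close> holds the leftmost maxima of the windows of length \<open>2 ^ l\<close> in \<open>{0..<N}\<close>.\<close>

definition has_sparse_row :: "store \<Rightarrow> nat \<Rightarrow> nat \<Rightarrow> nat \<Rightarrow> bool" where
  "has_sparse_row s N l k \<longleftrightarrow> icell s ''row'' l = l * N \<and>
     (\<forall>i<k. i + 2 ^ l \<le> N \<longrightarrow> icell s ''T'' (l * N + i) = amax (rcell s ''g'') i (i + 2 ^ l))"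

definition has_sparse_table :: "store \<Rightarrow> nat \<Rightarrow> bool" where
  "has_sparse_table s N \<longleftrightarrow> (\<forall>l. 2 ^ l \<le> N \<longrightarrow> has_sparse_row s N l N)"

lemma has_sparse_table_cong:
  "icell s' ''row'' = icell s ''row'' \<Longrightarrow> icell s' ''T'' = icell s ''T'' \<Longrightarrow>
   rcell s' ''g'' = rcell s ''g'' \<Longrightarrow> has_sparse_table s' N = has_sparse_table s N"
  by (simp add: has_sparse_table_def has_sparse_row_def)

lemma has_log_tables_pw: "has_log_tables s M \<Longrightarrow> 2 ^ l \<le> M \<Longrightarrow> icell s ''pw'' l = 2 ^ l"
  using power_le_floor_log by (auto simp: has_log_tables_def)

lemma runs_sparse_row:
  assumes tabs: "has_log_tables s M" "N \<le> M" and N: "icell s ''N'' 0 = N"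
    and l: "icell s ''l'' 0 = l" "2 ^ Suc l \<le> N" and rows: "\<And>l'. l' \<le> l \<Longrightarrow> has_sparse_row s N l' N"
  shows "runs sparse_row s (220 * N) (\<lambda>s'. icell s' ''l'' 0 = Suc l \<and> (\<forall>l'\<le>Suc l. has_sparse_row s' N l' N))"
proof -
  have pw: "icell s ''pw'' l = 2 ^ l"
    using has_log_tables_pw[OF tabs(1), of l] l(2) tabs(2) by simp
  have N0: "0 < N" using l(2) by (metis gr0I le_zero_eq power_not_zero zero_neq_numeral)
  let ?I = "\<lambda>s'. icell s' ''i'' 0 \<le> N \<and> (\<forall>l'\<le>l. has_sparse_row s' N l' N) \<and> has_sparse_row s' N (Suc l) (icell s' ''i'' 0)"
  show ?thesis unfolding sparse_row_def
  proof (rule runs_seq_wp[where Y = "200 * N"], unfold wp.simps,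
      rule runs_seq[where X = "180 * N" and Y = 10 and R = "\<lambda>s'. icell s' ''l'' 0 = l \<and> (\<forall>l'\<le>Suc l. has_sparse_row s' N l' N)"],
      rule runs_while[where T = 70 and \<mu> = "\<lambda>s'. N - icell s' ''i'' 0" and I = ?I],
      goal_cases init step exit time last cost1 cost2)
    case init
    have "has_sparse_row (iupd ''row'' (Suc l) (l * N + N) s) N l' N" if "l' \<le> l" for l'
      using rows[OF that] that by (auto simp: has_sparse_row_def)
    then show ?case using N l rows[of l] by (auto simp: has_sparse_row_def)
  next
    case (step s')
    let ?i = "icell s' ''i'' 0"
    have fr: "icell s' ''N'' 0 = N" "icell s' ''l'' 0 = l" "icell s' ''pw'' l = 2 ^ l"
      using frame_icell[OF step(3), of "''N''"] frame_icell[OF step(3), of "''l''"]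
        frame_icell[OF step(3), of "''pw''"] N l pw by (simp_all add: sparse_cell_def)
    have i: "?i + (2 ^ l + 2 ^ l) \<le> N" using step(2) fr by simp
    let ?g = "rcell s' ''g''"
    have R: "has_sparse_row s' N l N" "has_sparse_row s' N (Suc l) ?i" using step(1) by auto
    then have row: "icell s' ''row'' l = l * N" "icell s' ''row'' (Suc l) = N + l * N"
      by (auto simp: has_sparse_row_def)
    have R1: "icell s' ''T'' (l * N + k) = amax ?g k (k + 2 ^ l)" if "k < N" "k + 2 ^ l \<le> N" for k
      using R(1) that by (simp add: has_sparse_row_def)
    have "(0::nat) < 2 ^ l" by simp
    then have iN: "?i < N" "?i + 2 ^ l < N" using i by linarith+
    then have y: "icell s' ''T'' (l * N + ?i) = amax ?g ?i (?i + 2 ^ l)"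
      and z: "icell s' ''T'' (l * N + (?i + 2 ^ l)) = amax ?g (?i + 2 ^ l) (?i + (2 ^ l + 2 ^ l))"
      using R1[of ?i] R1[of "?i + 2 ^ l"] i by (simp_all add: add.assoc)
    let ?v = "amax ?g ?i (?i + 2 ^ Suc l)"
    have v: "?v = (if ?g (amax ?g ?i (?i + 2 ^ l)) < ?g (amax ?g (?i + 2 ^ l) (?i + (2 ^ l + 2 ^ l)))
        then amax ?g (?i + 2 ^ l) (?i + (2 ^ l + 2 ^ l)) else amax ?g ?i (?i + 2 ^ l))"
      using amax_join[of ?i "?i + 2 ^ l" "?i + 2 ^ l" "?i + 2 ^ Suc l" ?g] by (simp add: mult_2)
    \<comment> \<open>The new cell lies behind all cells of the earlier rows, which are therefore
      preserved.\<close>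
    have low: "l' * N + k \<noteq> N + l * N + ?i" if "l' \<le> l" "k < N" for l' k
    proof -
      have "l' * N + k < Suc l' * N" "Suc l' * N \<le> Suc l * N" using that by (auto intro: mult_le_mono1)
      then show ?thesis by (simp only: mult_Suc)
    qed
    show ?case
      by (rule runs_wp)
        (use i iN(1) y z v row fr R step(1) low in
          \<open>auto simp: sparse_cell_def has_sparse_row_def less_Suc_eq algebra_simps\<close>)
  next
    case (exit s')
    have fr: "icell s' ''N'' 0 = N" "icell s' ''l'' 0 = l" "icell s' ''pw'' l = 2 ^ l"
      using frame_icell[OF exit(3), of "''N''"] frame_icell[OF exit(3), of "''l''"]
        frame_icell[OF exit(3), of "''pw''"] N l pw by (simp_all add: sparse_cell_def)
    then show ?case using exit(1,2) by (auto simp: has_sparse_row_def le_Suc_eq)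
  next
    case time
    show ?case using N0 by simp
  next
    case (last s')
    then show ?case by (intro runs_wp) (auto simp: has_sparse_row_def)
  qed (use N0 in simp_all)
qed

lemma runs_sparse_table:
  assumes tabs: "has_log_tables s M" "N \<le> M" and N: "icell s ''N'' 0 = N" "0 < N"
  shows "runs sparse_table s (350 * N * (floor_log N + 1)) (\<lambda>s'. has_sparse_table s' N)"
proof -
  define L where "L = N * (floor_log N + 1)"
  have L: "N \<le> L" "0 < L" using N(2) by (auto simp: L_def)
  have "runs sparse_table s (350 * L) (\<lambda>s'. has_sparse_table s' N)"
    unfolding sparse_table_def
  proof (rule runs_seq_wp[where Y = "310 * L"], unfold wp.simps,
      rule runs_seq[where X = "60 * N" and Y = "240 * L" and
        R = "\<lambda>s'. icell s' ''l'' 0 = 0 \<and> icell s' ''row'' 0 = 0 \<and> (\<forall>i<N. icell s' ''T'' i = i)"],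
      rule runs_while[where T = 20 and \<mu> = "\<lambda>s'. N - icell s' ''i'' 0" and
        I = "\<lambda>s'. icell s' ''i'' 0 \<le> N \<and> icell s' ''l'' 0 = 0 \<and> icell s' ''row'' 0 = 0 \<and>
          (\<forall>i<icell s' ''i'' 0. icell s' ''T'' i = i)"], goal_cases init step exit time rows cost1 cost2)
    case (step s')
    have "icell s' ''N'' 0 = N" using frame_icell[OF step(3), of "''N''"] N by simp
    then show ?case using step by (intro runs_wp) auto
  next
    case (exit s')
    have "icell s' ''N'' 0 = N" using frame_icell[OF exit(3), of "''N''"] N by simp
    then show ?case using exit by auto
  next
    case (rows s')
    have fr: "icell s' ''N'' 0 = N" "has_log_tables s' M"
      using frame_icell[OF rows(2), of "''N''"] frame_icell[OF rows(2), of "''lg''"]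
        frame_icell[OF rows(2), of "''pw''"] N tabs(1)
      by (simp_all add: has_log_tables_def)
    show ?case
    proof (rule runs_while[where T = "220 * N" and \<mu> = "\<lambda>s'. floor_log N - icell s' ''l'' 0" and
          I = "\<lambda>s'. 2 ^ icell s' ''l'' 0 \<le> N \<and> (\<forall>l'\<le>icell s' ''l'' 0. has_sparse_row s' N l' N)"],
        goal_cases init step exit time)
      case init
      then show ?case using rows N(2) by (simp add: has_sparse_row_def)
    next
      case (step s'')
      let ?l = "icell s'' ''l'' 0"
      have fr': "icell s'' ''N'' 0 = N" "has_log_tables s'' M"
        using frame_icell[OF step(3), of "''N''"] frame_icell[OF step(3), of "''lg''"]
          frame_icell[OF step(3), of "''pw''"] fr
        by (simp_all add: has_log_tables_def sparse_row_def sparse_cell_def)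
      have pw: "icell s'' ''pw'' ?l = 2 ^ ?l"
        using has_log_tables_pw[OF fr'(2), of ?l] step(1) tabs(2) by simp
      have l: "2 ^ Suc ?l \<le> N" using step(2) pw fr'(1) by simp
      show ?case
        by (rule runs_conseq[OF runs_sparse_row[OF fr'(2) tabs(2) fr'(1) refl l]])
          (use step(1) power_le_floor_log[OF l] l in auto)
    next
      case (exit s'')
      let ?l = "icell s'' ''l'' 0"
      have fr': "icell s'' ''N'' 0 = N" "has_log_tables s'' M"
        using frame_icell[OF exit(3), of "''N''"] frame_icell[OF exit(3), of "''lg''"]
          frame_icell[OF exit(3), of "''pw''"] fr
        by (simp_all add: has_log_tables_def sparse_row_def sparse_cell_def)
      have pw: "icell s'' ''pw'' ?l = 2 ^ ?l"
        using has_log_tables_pw[OF fr'(2), of ?l] exit(1) tabs(2) by simp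
      have l: "N < 2 ^ Suc ?l" using exit(2) pw fr'(1) by simp
      have "l' \<le> ?l" if "2 ^ l' \<le> N" for l'
      proof -
        have "(2::nat) ^ l' < 2 ^ Suc ?l" using that l by linarith
        then have "l' < Suc ?l" by (rule power_less_imp_less_exp[rotated]) simp
        then show ?thesis by simp
      qed
      then show ?case using exit(1) by (auto simp: has_sparse_table_def)
    next
      case time
      have "(floor_log N + 1) * (220 * N + 16) \<le> (floor_log N + 1) * (236 * N)"
        using N(2) by (intro mult_le_mono2) simp
      then show ?case using rows by (simp add: L_def algebra_simps)
    qed
  qed (use L N in auto)
  then show ?thesis by (simp add: L_def mult.assoc)
qed

section \<open>Queries in constant time\<close>

definition range_max :: com where
  "range_max =
     ''u'' :=\<^sub>i IGet ''lg'' (ISub (iscalar ''hi'') (iscalar ''lo'')) ;;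
     ''r'' :=\<^sub>i IGet ''T'' (IAdd (IGet ''row'' (iscalar ''u'')) (iscalar ''lo'')) ;;
     ''v'' :=\<^sub>i IGet ''T'' (IAdd (IGet ''row'' (iscalar ''u''))
                        (ISub (iscalar ''hi'') (IGet ''pw'' (iscalar ''u'')))) ;;
     Cond (RLess (RGet ''g'' (iscalar ''r'')) (RGet ''g'' (iscalar ''v'')))
       (''r'' :=\<^sub>i iscalar ''v'') Skip"

lemma iwrites_range_max [simp]: "iwrites range_max = {''u'', ''r'', ''v''}"
  and rwrites_range_max [simp]: "rwrites range_max = {}"
  and ccost_range_max [simp]: "ccost range_max \<le> 50"
  by (auto simp: range_max_def)

text \<open>The two windows of length \<open>2 ^ floor_log (b - a)\<close>, one starting at
  \<open>a\<close> and one ending at \<open>b\<close>, cover everything, because twice their length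
  exceeds \<open>b - a\<close>.\<close>

lemma wp_range_max:
  assumes tabs: "has_log_tables s M" "N \<le> M" "has_sparse_table s N"
    and lohi: "icell s ''lo'' 0 = a" "icell s ''hi'' 0 = b" "a < b" "b \<le> N"
  shows "wp range_max (\<lambda>s'. icell s' ''r'' 0 = amax (rcell s ''g'') a b) s"
proof -
  let ?l = "floor_log (b - a)" and ?g = "rcell s ''g''"
  have p: "(2::nat) ^ ?l \<le> b - a" "b - a < 2 * 2 ^ ?l"
    using lohi(3) by (auto intro: floor_log_exp2_le floor_log_exp2_gt)
  have lg: "icell s ''lg'' (b - a) = ?l" using tabs lohi by (auto simp: has_log_tables_def)
  have pw: "icell s ''pw'' ?l = 2 ^ ?l"
    using has_log_tables_pw[OF tabs(1), of ?l] p(1) lohi(4) tabs(2) by simp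
  have "2 ^ ?l \<le> N" using p lohi by linarith
  then have row: "has_sparse_row s N ?l N" using tabs(3) by (simp add: has_sparse_table_def)
  have q: "a + 2 ^ ?l \<le> b" "b < a + 2 * 2 ^ ?l" "(0::nat) < 2 ^ ?l" using p lohi(3) by auto
  define w where "w = (2::nat) ^ ?l"
  have q': "a + w \<le> b" "b < a + 2 * w" "0 < w" using q by (auto simp: w_def)
  have R: "icell s ''row'' ?l = ?l * N"
    "\<And>i. i < N \<Longrightarrow> i + w \<le> N \<Longrightarrow> icell s ''T'' (?l * N + i) = amax ?g i (i + w)"
    using row by (auto simp: has_sparse_row_def w_def)
  have T: "icell s ''T'' (?l * N + a) = amax ?g a (a + w)" "icell s ''T'' (?l * N + (b - w)) = amax ?g (b - w) b"
    using R(2)[of a] R(2)[of "b - w"] q' lohi by auto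
  have J: "amax ?g a b = (if ?g (amax ?g a (a + w)) < ?g (amax ?g (b - w) b)
      then amax ?g (b - w) b else amax ?g a (a + w))"
    using q' by (intro amax_join) auto
  show ?thesis using lg pw R(1) T J lohi by (simp add: range_max_def w_def[symmetric])
qed

section \<open>Merge sort\<close>

definition block_sorted :: "('a \<Rightarrow> 'a \<Rightarrow> bool) \<Rightarrow> nat \<Rightarrow> (nat \<Rightarrow> 'a) \<Rightarrow> nat \<Rightarrow> bool" where
  "block_sorted le w f n \<longleftrightarrow> (\<forall>p q. p < q \<longrightarrow> q < n \<longrightarrow> p div w = q div w \<longrightarrow> le (f p) (f q))"

text \<open>The halves \<open>{lo..<d}\<close> and \<open>{d..<e}\<close> of one double block are
  read at \<open>i\<close> and \<open>j\<close> and written at \<open>k\<close>; the equation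
  \<open>k + d = i + j\<close> says that every item read has been written. Recording only images is
  enough: the array permutes \<open>{..<N}\<close>, and a surjection of a finite set onto itself is
  injective.\<close>

definition merging :: "('a \<Rightarrow> 'a \<Rightarrow> bool) \<Rightarrow> (nat \<Rightarrow> 'a) \<Rightarrow> nat \<Rightarrow> nat \<Rightarrow> nat \<Rightarrow> nat \<Rightarrow> nat \<Rightarrow> nat \<Rightarrow> nat \<Rightarrow> nat \<Rightarrow> (nat \<Rightarrow> 'a) \<Rightarrow> bool" where
  "merging le f N w lo i d j e k f' \<longleftrightarrow>
     2 * w dvd lo \<and> lo < N \<and> d = min (lo + w) N \<and> e = min (lo + 2 * w) N \<and>
     lo \<le> i \<and> i \<le> d \<and> d \<le> j \<and> j \<le> e \<and> k + d = i + j \<and>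
     f' ` {..<k} = f ` ({..<i} \<union> {d..<j}) \<and> block_sorted le (2 * w) f' k \<and>
     (\<forall>p q. lo \<le> p \<longrightarrow> p < k \<longrightarrow> i \<le> q \<and> q < d \<or> j \<le> q \<and> q < e \<longrightarrow> le (f' p) (f q))"

lemma div_block: "w dvd lo \<Longrightarrow> lo \<le> p \<Longrightarrow> p < lo + w \<Longrightarrow> p div w = lo div (w::nat)"
  by (auto elim!: dvdE simp: div_nat_eqI)

lemma merging_start:
  assumes "2 * w dvd k" "k < N" "f' ` {..<k} = f ` {..<k}" "block_sorted le (2 * w) f' k"
  shows "merging le f N w k k (min (k + w) N) (min (k + w) N) (min (k + 2 * w) N) k f'"
  using assms by (auto simp: merging_def)

lemma merging_finish:
  assumes "merging le f N w lo i d j e e f'"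
  shows "(2 * w dvd e \<or> e = N) \<and> e \<le> N \<and> f' ` {..<e} = f ` {..<e} \<and> block_sorted le (2 * w) f' e"
proof -
  have "i = d" "j = e" "d \<le> e" using assms by (auto simp: merging_def)
  moreover from this have "{..<i} \<union> {d..<j} = {..<e}" by auto
  moreover have "2 * w dvd e \<or> e = N" using assms by (auto simp: merging_def min_def)
  ultimately show ?thesis using assms by (auto simp: merging_def)
qed

text \<open>The copied item precedes the rest of its own half by sortedness and the rest of the
  other half by transitivity through its head.\<close>

lemma
  assumes tot: "\<And>p q. le p q \<or> le q p" and trans: "\<And>p q r. le p q \<Longrightarrow> le q r \<Longrightarrow> le p r"
    and f: "block_sorted le w f N" and m: "merging le f N w lo i d j e k f'" and w: "0 < w" and k: "k < e"
  shows merging_left: "i < d \<Longrightarrow> (j < e \<Longrightarrow> le (f i) (f j)) \<Longrightarrow> merging le f N w lo (Suc i) d j e (Suc k) (f'(k := f i))"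
    and merging_right: "j < e \<Longrightarrow> (i < d \<Longrightarrow> le (f j) (f i)) \<Longrightarrow> merging le f N w lo i d (Suc j) e (Suc k) (f'(k := f j))"
proof -
  have M: "2 * w dvd lo" "lo < N" "d = min (lo + w) N" "e = min (lo + 2 * w) N"
     "lo \<le> i" "i \<le> d" "d \<le> j" "j \<le> e" "k + d = i + j"
     "f' ` {..<k} = f ` ({..<i} \<union> {d..<j})" "block_sorted le (2 * w) f' k"
    and rest: "\<And>p q. lo \<le> p \<Longrightarrow> p < k \<Longrightarrow> i \<le> q \<and> q < d \<or> j \<le> q \<and> q < e \<Longrightarrow> le (f' p) (f q)"
    using m unfolding merging_def by blast+
  have refl: "le p p" for p using tot[of p p] by simp
  have wlo: "w dvd lo" "w dvd lo + w" using M(1) by (auto intro: dvd_mult_right)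
  have left: "le (f p) (f q)" if "lo \<le> p" "p \<le> q" "q < d" for p q
    using f that div_block[OF wlo(1), of p] div_block[OF wlo(1), of q] M refl
    unfolding block_sorted_def by (cases "p = q") auto
  have right: "le (f p) (f q)" if "d \<le> p" "p \<le> q" "q < e" for p q
  proof -
    have "d = lo + w" using that M by (auto simp: min_def split: if_splits)
    then show ?thesis
      using f that div_block[OF wlo(2), of p] div_block[OF wlo(2), of q] M refl
      unfolding block_sorted_def by (cases "p = q") auto
  qed
  have lo_k: "lo \<le> k" using M by linarith
  \<comment> \<open>Positions in the double block of \<open>k\<close> are not before its start
    \<open>lo\<close>, so only the current block matters for the new item.\<close>
  have same_block: "lo \<le> p" if "p div (2 * w) = k div (2 * w)" for p
  proof -
    have "k div (2 * w) = lo div (2 * w)" using M(1,4) lo_k k by (intro div_block) auto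
    then have "lo = 2 * w * (p div (2 * w))" using M(1) that by simp
    also have "\<dots> \<le> p" by simp
    finally show ?thesis .
  qed
  have sorted: "block_sorted le (2 * w) (f'(k := f r)) (Suc k)" if "i \<le> r \<and> r < d \<or> j \<le> r \<and> r < e" for r
    unfolding block_sorted_def
  proof (intro allI impI)
    fix p q assume pq: "p < q" "q < Suc k" "p div (2 * w) = q div (2 * w)"
    show "le ((f'(k := f r)) p) ((f'(k := f r)) q)"
    proof (cases "q = k")
      case True
      then show ?thesis using rest[of p r] same_block[of p] pq that by auto
    next
      case False
      then show ?thesis using M(11) pq unfolding block_sorted_def by auto
    qed
  qed
  have img: "(f'(k := f r)) ` {..<Suc k} = insert (f r) (f' ` {..<k})" for r
    by (auto simp: lessThan_Suc)
  show "merging le f N w lo (Suc i) d j e (Suc k) (f'(k := f i))"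
    if "i < d" "j < e \<Longrightarrow> le (f i) (f j)"
    unfolding merging_def
  proof (intro conjI allI impI)
    show "(f'(k := f i)) ` {..<Suc k} = f ` ({..<Suc i} \<union> {d..<j})"
      unfolding img M(10) by (auto simp: lessThan_Suc)
    show "block_sorted le (2 * w) (f'(k := f i)) (Suc k)" using that by (intro sorted) auto
    fix p q assume p: "lo \<le> p" "p < Suc k" "Suc i \<le> q \<and> q < d \<or> j \<le> q \<and> q < e"
    show "le ((f'(k := f i)) p) (f q)"
    proof (cases "p = k")
      case True
      have "le (f i) (f q)"
      proof (cases "j \<le> q \<and> q < e")
        case True
        then show ?thesis using that(2) right[of j q] M(7) by (auto intro: trans[of "f i" "f j"])
      next
        case False
        then show ?thesis using left[of i q] p M(5) by auto
      qed
      then show ?thesis using True by simp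
    next
      case False
      then show ?thesis using rest[of p q] p by auto
    qed
  qed (use M that in auto)
  show "merging le f N w lo i d (Suc j) e (Suc k) (f'(k := f j))"
    if "j < e" "i < d \<Longrightarrow> le (f j) (f i)"
    unfolding merging_def
  proof (intro conjI allI impI)
    have "{..<i} \<union> {d..<Suc j} = insert j ({..<i} \<union> {d..<j})" using M(7) by auto
    then show "(f'(k := f j)) ` {..<Suc k} = f ` ({..<i} \<union> {d..<Suc j})"
      unfolding img M(10) by auto
    show "block_sorted le (2 * w) (f'(k := f j)) (Suc k)" using that by (intro sorted) auto
    fix p q assume p: "lo \<le> p" "p < Suc k" "i \<le> q \<and> q < d \<or> Suc j \<le> q \<and> q < e"
    show "le ((f'(k := f j)) p) (f q)"
    proof (cases "p = k")
      case True
      have "le (f j) (f q)"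
      proof (cases "i \<le> q \<and> q < d")
        case True
        then show ?thesis using that(2) left[of i q] M(5) by (auto intro: trans[of "f j" "f i"])
      next
        case False
        then show ?thesis using right[of j q] p M(7) by auto
      qed
      then show ?thesis using True by simp
    next
      case False
      then show ?thesis using rest[of p q] p by auto
    qed
  qed (use M that in auto)
qed

text \<open>The parameter \<open>cmp\<close> compares the items in the cells \<open>x\<close> and \<open>y\<close> and stores the
  truth value in \<open>c\<close>.\<close>

definition merge_step :: "com \<Rightarrow> com" where
  "merge_step cmp =
     Cond (ILess (iscalar ''k'') (iscalar ''e'')) Skip
       (''i'' :=\<^sub>i iscalar ''k'' ;;
        ''d'' :=\<^sub>i ISub (IAdd (iscalar ''k'') (iscalar ''w''))
                     (ISub (IAdd (iscalar ''k'') (iscalar ''w'')) (iscalar ''N'')) ;;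
        ''j'' :=\<^sub>i iscalar ''d'' ;;
        ''e'' :=\<^sub>i ISub (IAdd (iscalar ''d'') (iscalar ''w''))
                     (ISub (IAdd (iscalar ''d'') (iscalar ''w'')) (iscalar ''N''))) ;;
     Cond (ILess (iscalar ''j'') (iscalar ''e''))
       (Cond (ILess (iscalar ''i'') (iscalar ''d''))
         (''x'' :=\<^sub>i IGet ''A'' (iscalar ''i'') ;; ''y'' :=\<^sub>i IGet ''A'' (iscalar ''j'') ;; cmp)
         (''c'' :=\<^sub>i IConst 0))
       (''c'' :=\<^sub>i IConst 1) ;;
     Cond (ILess (IConst 0) (iscalar ''c''))
       (IAssign ''B'' (iscalar ''k'') (IGet ''A'' (iscalar ''i'')) ;; ''i'' :=\<^sub>i IAdd (iscalar ''i'') (IConst 1))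
       (IAssign ''B'' (iscalar ''k'') (IGet ''A'' (iscalar ''j'')) ;; ''j'' :=\<^sub>i IAdd (iscalar ''j'') (IConst 1)) ;;
     ''k'' :=\<^sub>i IAdd (iscalar ''k'') (IConst 1)"

definition merge_pass :: "com \<Rightarrow> com" where
  "merge_pass cmp =
     (''k'' :=\<^sub>i IConst 0 ;; ''e'' :=\<^sub>i IConst 0) ;;
     While (ILess (iscalar ''k'') (iscalar ''N'')) (merge_step cmp) ;;
     ''k'' :=\<^sub>i IConst 0 ;;
     While (ILess (iscalar ''k'') (iscalar ''N''))
       (IAssign ''A'' (iscalar ''k'') (IGet ''B'' (iscalar ''k'')) ;; ''k'' :=\<^sub>i IAdd (iscalar ''k'') (IConst 1)) ;;
     ''w'' :=\<^sub>i IAdd (iscalar ''w'') (iscalar ''w'')"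

definition merge_sort :: "com \<Rightarrow> com" where
  "merge_sort cmp =
     ''w'' :=\<^sub>i IConst 1 ;;
     While (ILess (iscalar ''w'') (iscalar ''N'')) (merge_pass cmp)"

section \<open>Correctness and time of merge sort\<close>

text \<open>The arrays that a comparison must preserve. Its arguments \<open>x\<close>,
  \<open>y\<close> and its answer \<open>c\<close> are left out.\<close>

definition sort_scratch :: "string set" where
  "sort_scratch = {''A'', ''B'', ''N'', ''w'', ''k'', ''e'', ''i'', ''j'', ''d''}"

lemma iwrites_merge_sort: "iwrites (merge_sort cmp) = {''A'', ''B'', ''w'', ''k'', ''e'', ''i'', ''j'', ''d'', ''x'', ''y'', ''c''} \<union> iwrites cmp"
  and rwrites_merge_sort: "rwrites (merge_sort cmp) = rwrites cmp"
  and iwrites_merge_pass: "iwrites (merge_pass cmp) = {''A'', ''B'', ''w'', ''k'', ''e'', ''i'', ''j'', ''d'', ''x'', ''y'', ''c''} \<union> iwrites cmp"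
  and rwrites_merge_pass: "rwrites (merge_pass cmp) = rwrites cmp"
  and iwrites_merge_step: "iwrites (merge_step cmp) = {''B'', ''k'', ''e'', ''i'', ''j'', ''d'', ''x'', ''y'', ''c''} \<union> iwrites cmp"
  and rwrites_merge_step: "rwrites (merge_step cmp) = rwrites cmp"
  by (auto simp: merge_sort_def merge_pass_def merge_step_def)

lemma frame_iupdI:
  assumes "frame c (iupd a i m s) s'" "a \<in> iwrites c'" "iwrites c \<subseteq> iwrites c'" "rwrites c \<subseteq> rwrites c'"
  shows "frame c' s s'"
  unfolding frame_def
proof (intro conjI allI impI)
  fix b assume "b \<notin> iwrites c'"
  then have "b \<notin> iwrites c" "b \<noteq> a" using assms by auto
  then show "icell s' b = icell s b" using frame_icell[OF assms(1)] by simp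
next
  fix b assume "b \<notin> rwrites c'"
  then have "b \<notin> rwrites c" using assms by auto
  then show "rcell s' b = rcell s b" using frame_rcell[OF assms(1)] by simp
qed

text \<open>A pass is one loop that handles one item per iteration, so that no nested loops need to
  be summed up. The first disjunct describes the moment between two double blocks, when the next
  iteration opens a new block; the second one describes the inside of a block.\<close>

definition merge_inv :: "(nat \<Rightarrow> nat \<Rightarrow> bool) \<Rightarrow> (nat \<Rightarrow> nat) \<Rightarrow> nat \<Rightarrow> nat \<Rightarrow> store \<Rightarrow> bool" where
  "merge_inv le f N w s \<longleftrightarrow>
     (let k = icell s ''k'' 0; e = icell s ''e'' 0; f' = icell s ''B'' in
      k = e \<and> (2 * w dvd e \<or> e = N) \<and> e \<le> N \<and> f' ` {..<e} = f ` {..<e} \<and> block_sorted le (2 * w) f' e \<or>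
      k < e \<and> (\<exists>lo. merging le f N w lo (icell s ''i'' 0) (icell s ''d'' 0) (icell s ''j'' 0) e k f'))"

lemma merge_invI:
  assumes "merging le f N w lo (icell s ''i'' 0) (icell s ''d'' 0) (icell s ''j'' 0) (icell s ''e'' 0) (icell s ''k'' 0) (icell s ''B'')"
    and "icell s ''k'' 0 \<le> icell s ''e'' 0"
  shows "merge_inv le f N w s"
  using assms merging_finish[of le f N w lo] by (cases "icell s ''k'' 0 = icell s ''e'' 0") (auto simp: merge_inv_def Let_def)

lemma wp_merge_step:
  assumes tot: "\<And>p q. le p q \<or> le q p" and trans: "\<And>p q r. le p q \<Longrightarrow> le q r \<Longrightarrow> le p r"
    and f: "block_sorted le w f N" "\<And>i. i < N \<Longrightarrow> f i < N" and w: "0 < w"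
    and inv: "merge_inv le f N w s" and k: "icell s ''k'' 0 < N"
    and s: "icell s ''A'' = f" "icell s ''w'' 0 = w" "icell s ''N'' 0 = N"
    and cmp: "\<And>s'. frame (merge_step cmp) s s' \<Longrightarrow> icell s' ''x'' 0 < N \<Longrightarrow> icell s' ''y'' 0 < N \<Longrightarrow>
      wp cmp (\<lambda>t. (icell t ''c'' 0 \<noteq> 0) = le (icell s' ''x'' 0) (icell s' ''y'' 0)) s'"
    and disj: "iwrites cmp \<inter> sort_scratch = {}"
  shows "wp (merge_step cmp) (\<lambda>s'. merge_inv le f N w s' \<and> icell s' ''k'' 0 = Suc (icell s ''k'' 0)) s"
proof -
  let ?k = "icell s ''k'' 0"
  define R where "R s1 lo \<longleftrightarrow> icell s1 ''A'' = f \<and> icell s1 ''w'' 0 = w \<and> icell s1 ''N'' 0 = N \<and>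
      icell s1 ''k'' 0 = ?k \<and> ?k < icell s1 ''e'' 0 \<and>
      merging le f N w lo (icell s1 ''i'' 0) (icell s1 ''d'' 0) (icell s1 ''j'' 0) (icell s1 ''e'' 0) ?k (icell s1 ''B'')"
    for s1 :: store and lo
  have cmp_scratch: "a \<notin> iwrites cmp" if "a \<in> sort_scratch" for a
    using disj that by auto
  show ?thesis unfolding merge_step_def wp.simps(4)
  proof (rule wp_conseq[where R = "\<lambda>s1. \<exists>lo. R s1 lo"], goal_cases start compare)
    case start
    show ?case
    proof (cases "?k < icell s ''e'' 0")
      case True
      then show ?thesis using inv s by (auto simp: merge_inv_def R_def Let_def)
    next
      case False
      define d' where "d' = min (?k + w) N"
      define e' where "e' = min (?k + 2 * w) N"
      have m: "merging le f N w ?k ?k d' d' e' ?k (icell s ''B'')"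
        unfolding d'_def e'_def using inv False k
        by (intro merging_start) (auto simp: merge_inv_def Let_def)
      \<comment> \<open>With truncated subtraction, \<open>u - (u - N)\<close> is the minimum of
        \<open>u\<close> and \<open>N\<close>.\<close>
      have e: "d' + w - (d' + w - N) = e'" "?k + w - (?k + w - N) = d'" "?k < e'"
        using k w by (auto simp: d'_def e'_def)
      then show ?thesis using False s m by (auto simp: R_def)
    qed
  next
    case (compare s1)
    then obtain lo where lo: "R s1 lo" by blast
    let ?i = "icell s1 ''i'' 0" and ?j = "icell s1 ''j'' 0" and ?d = "icell s1 ''d'' 0" and ?e = "icell s1 ''e'' 0"
    have m: "merging le f N w lo ?i ?d ?j ?e ?k (icell s1 ''B'')" and A: "icell s1 ''A'' = f" and ke: "?k < ?e"
      using lo by (auto simp: R_def)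
    have bounds: "?i \<le> ?d" "?d \<le> N" "?j \<le> ?e" "?e \<le> N" "?k + ?d = ?i + ?j"
      using m by (auto simp: merging_def)
    define D where "D s2 \<longleftrightarrow> (if icell s2 ''c'' 0 \<noteq> 0 then ?i < ?d \<and> (?j < ?e \<longrightarrow> le (f ?i) (f ?j))
        else ?j < ?e \<and> (?i < ?d \<longrightarrow> le (f ?j) (f ?i)))" for s2 :: store
    show ?case
    proof (rule wp_conseq[where R = D], goal_cases decide move)
      case decide
      show ?case
      proof (cases "?j < ?e \<and> ?i < ?d")
        case True
        let ?s2 = "iupd ''y'' 0 (f ?j) (iupd ''x'' 0 (f ?i) s1)"
        have "frame (merge_step cmp) s ?s2"
          using compare(2) by (auto simp: frame_def iwrites_merge_step rwrites_merge_step)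
        then have "wp cmp (\<lambda>t. (icell t ''c'' 0 \<noteq> 0) = le (f ?i) (f ?j)) ?s2"
          using cmp[of ?s2] f(2) True bounds by simp
        then have "wp cmp D ?s2"
          by (rule wp_mono) (use True tot in \<open>auto simp: D_def\<close>)
        then show ?thesis using True A by simp
      next
        case False
        then show ?thesis using bounds ke by (auto simp: D_def)
      qed
    next
      case (move s2)
      have same: "icell s2 a = icell s1 a" if "a \<in> sort_scratch" for a
      proof (rule frame_icell[OF move(2)])
        show "a \<notin> iwrites (Cond (ILess (iscalar ''j'') (iscalar ''e''))
       (Cond (ILess (iscalar ''i'') (iscalar ''d''))
         (''x'' :=\<^sub>i IGet ''A'' (iscalar ''i'') ;; ''y'' :=\<^sub>i IGet ''A'' (iscalar ''j'') ;; cmp)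
         (''c'' :=\<^sub>i IConst 0))
       (''c'' :=\<^sub>i IConst 1))"
          using cmp_scratch[OF that] that by (auto simp: sort_scratch_def)
      qed
      have S: "icell s2 ''A'' = f" "icell s2 ''i'' 0 = ?i" "icell s2 ''j'' 0 = ?j" "icell s2 ''d'' 0 = ?d"
        "icell s2 ''e'' 0 = ?e" "icell s2 ''k'' 0 = ?k" "icell s2 ''B'' = icell s1 ''B''"
        using same lo by (auto simp: sort_scratch_def R_def)
      show ?case
      proof (cases "icell s2 ''c'' 0 \<noteq> 0")
        case True
        then have "merging le f N w lo (Suc ?i) ?d ?j ?e (Suc ?k) ((icell s1 ''B'')(?k := f ?i))"
          using move(1) by (intro merging_left tot f(1) m w ke) (auto simp: D_def intro: trans)
        then show ?thesis using True S ke by (auto intro!: merge_invI[where lo = lo])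
      next
        case False
        then have "merging le f N w lo ?i ?d (Suc ?j) ?e (Suc ?k) ((icell s1 ''B'')(?k := f ?j))"
          using move(1) by (intro merging_right tot f(1) m w ke) (auto simp: D_def intro: trans)
        then show ?thesis using False S ke by (auto intro!: merge_invI[where lo = lo])
      qed
    qed
  qed
qed

text \<open>The comparison has to be correct in every store that the pass can reach, described by
  \<open>frame\<close>. It may thus rely on arrays that neither sorting nor the comparison itself
  writes.\<close>

lemma runs_merge_pass:
  assumes tot: "\<And>p q. le p q \<or> le q p" and trans: "\<And>p q r. le p q \<Longrightarrow> le q r \<Longrightarrow> le p r"
    and f: "block_sorted le w (icell s ''A'') N" "icell s ''A'' ` {..<N} = {..<N}" and w: "0 < w"
    and s: "icell s ''w'' 0 = w" "icell s ''N'' 0 = N" "0 < N"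
    and cmp: "\<And>s'. frame (merge_pass cmp) s s' \<Longrightarrow> icell s' ''x'' 0 < N \<Longrightarrow> icell s' ''y'' 0 < N \<Longrightarrow>
      wp cmp (\<lambda>t. (icell t ''c'' 0 \<noteq> 0) = le (icell s' ''x'' 0) (icell s' ''y'' 0)) s'"
    and disj: "iwrites cmp \<inter> sort_scratch = {}"
  shows "runs (merge_pass cmp) s (N * (2 * ccost cmp + 400))
    (\<lambda>s'. icell s' ''w'' 0 = 2 * w \<and> icell s' ''A'' ` {..<N} = {..<N} \<and> block_sorted le (2 * w) (icell s' ''A'') N)"
proof -
  let ?f = "icell s ''A''"
  define K where "K = ccost cmp"
  have cost: "ccost (merge_step cmp) \<le> K + 100" by (auto simp: merge_step_def K_def)
  have scr: "a \<notin> iwrites cmp" if "a \<in> sort_scratch" for a using disj that by auto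
  show ?thesis unfolding merge_pass_def K_def[symmetric]
  proof (rule runs_seq_wp[where Y = "N * (2 * K + 390)"], unfold wp.simps,
      rule runs_seq[where X = "2 * N * (K + 110)" and Y = "N * 100" and
        R = "\<lambda>s1. icell s1 ''B'' ` {..<N} = {..<N} \<and> block_sorted le (2 * w) (icell s1 ''B'') N"],
      rule runs_while[where T = "K + 100" and \<mu> = "\<lambda>s1. N - icell s1 ''k'' 0" and I = "merge_inv le ?f N w"],
      goal_cases init step exit time copy cost1 cost2)
    case init
    show ?case by (simp add: merge_inv_def block_sorted_def)
  next
    case (step s1)
    have fr: "icell s1 a = icell (iupd ''e'' 0 0 (iupd ''k'' 0 0 s)) a" if "a \<in> {''A'', ''w'', ''N''}" for a
      using frame_icell[OF step(3), of a] scr[of a] that by (auto simp: iwrites_merge_step sort_scratch_def)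
    have S: "icell s1 ''A'' = ?f" "icell s1 ''w'' 0 = w" "icell s1 ''N'' 0 = N" using fr s by auto
    have "wp (merge_step cmp) (\<lambda>s'. merge_inv le ?f N w s' \<and> icell s' ''k'' 0 = Suc (icell s1 ''k'' 0)) s1"
    proof (rule wp_merge_step[OF tot _ f(1) _ w step(1) _ S _ disj])
      fix s' assume "frame (merge_step cmp) s1 s'"
      moreover have "frame (merge_step cmp) (iupd ''e'' 0 0 (iupd ''k'' 0 0 s)) s1" using step(3) by simp
      ultimately have "frame (merge_step cmp) (iupd ''e'' 0 0 (iupd ''k'' 0 0 s)) s'" by (rule frame_trans[rotated])
      then have "frame (merge_pass cmp) (iupd ''k'' 0 0 s) s'"
        by (rule frame_iupdI) (auto simp: iwrites_merge_step rwrites_merge_step iwrites_merge_pass rwrites_merge_pass)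
      then have "frame (merge_pass cmp) s s'"
        by (rule frame_iupdI) (auto simp: iwrites_merge_pass)
      then show "icell s' ''x'' 0 < N \<Longrightarrow> icell s' ''y'' 0 < N \<Longrightarrow>
          wp cmp (\<lambda>t. (icell t ''c'' 0 \<noteq> 0) = le (icell s' ''x'' 0) (icell s' ''y'' 0)) s'"
        by (rule cmp)
    qed (use trans f(2) step(2) S in auto)
    then show ?case
      by (rule runs_wp[OF wp_mono cost]) (use step(2) S in auto)
  next
    case (exit s1)
    have "icell s1 ''N'' 0 = N"
      using frame_icell[OF exit(3), of "''N''"] scr[of "''N''"] s by (auto simp: iwrites_merge_step sort_scratch_def)
    then have "N \<le> icell s1 ''k'' 0" using exit(2) by simp
    then have "icell s1 ''k'' 0 = icell s1 ''e'' 0 \<and> icell s1 ''e'' 0 = N"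
      using exit(1) by (auto simp: merge_inv_def Let_def merging_def)
    then show ?case using exit(1) f(2) by (auto simp: merge_inv_def Let_def)
  next
    case time
    have "(N + 1) * (K + 106) \<le> (2 * N) * (K + 106)" using s(3) by (intro mult_le_mono1) simp
    then show ?case by (simp add: algebra_simps)
  next
    case (copy s1)
    have N: "icell s1 ''N'' 0 = N"
      using frame_icell[OF copy(2), of "''N''"] scr[of "''N''"] s by (auto simp: iwrites_merge_step sort_scratch_def)
    have W: "icell s1 ''w'' 0 = w"
      using frame_icell[OF copy(2), of "''w''"] scr[of "''w''"] s by (auto simp: iwrites_merge_step sort_scratch_def)
    show ?case
    proof (rule runs_seq_wp[where Y = "N * 90"], unfold wp.simps,
        rule runs_seq[where X = "60 * N" and Y = 10 and
          R = "\<lambda>s2. icell s2 ''w'' 0 = w \<and> (\<forall>i<N. icell s2 ''A'' i = icell s1 ''B'' i)"],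
        rule runs_while[where T = "20" and \<mu> = "\<lambda>s1. N - icell s1 ''k'' 0" and
          I = "\<lambda>s2. icell s2 ''k'' 0 \<le> N \<and> (\<forall>i<icell s2 ''k'' 0. icell s2 ''A'' i = icell s1 ''B'' i)"],
        goal_cases init step exit time last cost1 cost2)
      case (step s2)
      have fr: "icell s2 ''N'' 0 = N" "icell s2 ''B'' = icell s1 ''B''"
        using frame_icell[OF step(3), of "''N''"] frame_icell[OF step(3), of "''B''"] N by auto
      then show ?case using step(1,2) by (intro runs_wp) auto
    next
      case (exit s2)
      have fr: "icell s2 ''N'' 0 = N" "icell s2 ''w'' 0 = w"
        using frame_icell[OF exit(3), of "''N''"] frame_icell[OF exit(3), of "''w''"] N W by auto
      then show ?case using exit(1,2) by auto
    next
      case (last s2)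
      have "icell s2 ''A'' ` {..<N} = {..<N}" "block_sorted le (2 * w) (icell s2 ''A'') N"
        using last(1) copy(1) by (auto simp: block_sorted_def image_def)
      then show ?case using last(1) by (intro runs_wp) auto
    qed (use s(3) in auto)
  qed (use s(3) in \<open>auto simp: algebra_simps\<close>)
qed

text \<open>The width doubles with every pass, and at width at least \<open>N\<close> there is only
  one block; this gives the logarithmic number of passes.\<close>

lemma runs_merge_sort:
  assumes tot: "\<And>p q. le p q \<or> le q p" and trans: "\<And>p q r. le p q \<Longrightarrow> le q r \<Longrightarrow> le p r"
    and f: "icell s ''A'' ` {..<N} = {..<N}" and s: "icell s ''N'' 0 = N" "0 < N"
    and cmp: "\<And>s'. frame (merge_sort cmp) s s' \<Longrightarrow> icell s' ''x'' 0 < N \<Longrightarrow> icell s' ''y'' 0 < N \<Longrightarrow>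
      wp cmp (\<lambda>t. (icell t ''c'' 0 \<noteq> 0) = le (icell s' ''x'' 0) (icell s' ''y'' 0)) s'"
    and disj: "iwrites cmp \<inter> sort_scratch = {}"
  shows "runs (merge_sort cmp) s ((2 * ccost cmp + 420) * (N * (floor_log N + 2)))
    (\<lambda>s'. icell s' ''A'' ` {..<N} = {..<N} \<and>
       (\<forall>p q. p < q \<longrightarrow> q < N \<longrightarrow> le (icell s' ''A'' p) (icell s' ''A'' q)))"
proof -
  define K where "K = 2 * ccost cmp + 400"
  have scr: "a \<notin> iwrites cmp" if "a \<in> sort_scratch" for a using disj that by auto
  show ?thesis unfolding merge_sort_def
  proof (rule runs_seq_wp[where Y = "(N * K + 6) * (floor_log N + 2)"], unfold wp.simps,
      rule runs_while[where T = "N * K" and \<mu> = "\<lambda>s1. floor_log N + 1 - floor_log (icell s1 ''w'' 0)" and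
       I = "\<lambda>s1. 0 < icell s1 ''w'' 0 \<and> icell s1 ''A'' ` {..<N} = {..<N} \<and>
          block_sorted le (icell s1 ''w'' 0) (icell s1 ''A'') N"], goal_cases init step exit time cost)
    case init
    show ?case using f by (auto simp: block_sorted_def)
  next
    case (step s1)
    have N: "icell s1 ''N'' 0 = N"
      using frame_icell[OF step(3), of "''N''"] scr[of "''N''"] s by (auto simp: iwrites_merge_pass sort_scratch_def)
    let ?w = "icell s1 ''w'' 0"
    have "runs (merge_pass cmp) s1 (N * K) (\<lambda>s'. icell s' ''w'' 0 = 2 * ?w \<and> icell s' ''A'' ` {..<N} = {..<N} \<and>
        block_sorted le (2 * ?w) (icell s' ''A'') N)"
      unfolding K_def
    proof (rule runs_merge_pass[OF tot _ _ _ _ refl N s(2) _ disj])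
      fix s' assume "frame (merge_pass cmp) s1 s'"
      moreover have "frame (merge_pass cmp) (iupd ''w'' 0 1 s) s1" using step(3) by simp
      ultimately have "frame (merge_pass cmp) (iupd ''w'' 0 1 s) s'" by (rule frame_trans[rotated])
      then have "frame (merge_sort cmp) s s'"
        by (rule frame_iupdI) (auto simp: iwrites_merge_sort rwrites_merge_sort iwrites_merge_pass rwrites_merge_pass)
      then show "icell s' ''x'' 0 < N \<Longrightarrow> icell s' ''y'' 0 < N \<Longrightarrow>
          wp cmp (\<lambda>t. (icell t ''c'' 0 \<noteq> 0) = le (icell s' ''x'' 0) (icell s' ''y'' 0)) s'"
        by (rule cmp)
    qed (use trans step(1) in auto)
    moreover have "floor_log ?w \<le> floor_log N" using step(2) N by (intro floor_log_le_iff) simp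
    ultimately show ?case using step(1) by (elim runs_conseq) auto
  next
    case (exit s1)
    have N: "icell s1 ''N'' 0 = N"
      using frame_icell[OF exit(3), of "''N''"] scr[of "''N''"] s by (auto simp: iwrites_merge_pass sort_scratch_def)
    then have "p div icell s1 ''w'' 0 = 0" if "p < N" for p using exit(2) that by simp
    then show ?case using exit(1) by (auto simp: block_sorted_def)
  next
    case time
    show ?case by (simp add: algebra_simps)
  next
    case cost
    have "20 * (floor_log N + 2) \<le> (20 * N) * (floor_log N + 2)"
      using s(2) by (intro mult_le_mono1) simp
    moreover have "6 * (floor_log N + 2) + 3 \<le> 20 * (floor_log N + 2)" by simp
    ultimately have "6 * (floor_log N + 2) + 3 \<le> 20 * N * (floor_log N + 2)" by (rule order_trans[rotated])
    then have "(N * K + 6) * (floor_log N + 2) + 3 \<le> (N * K + 20 * N) * (floor_log N + 2)"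
      by (simp only: add_mult_distrib add.assoc add_le_cancel_left)
    also have "\<dots> = (2 * ccost cmp + 420) * (N * (floor_log N + 2))" by (simp add: K_def algebra_simps)
    finally show ?case by simp
  qed
qed

section \<open>Computing a fair split\<close>

text \<open>The stack \<open>S\<close> holds the right ends of the pending intervals, which are consecutive and start
  at \<open>a\<close>.\<close>

definition split_inv :: "(nat \<Rightarrow> real) \<Rightarrow> nat \<Rightarrow> (nat \<Rightarrow> nat) \<Rightarrow> nat \<Rightarrow> nat \<Rightarrow> (nat \<Rightarrow> real) \<Rightarrow> bool" where
  "split_inv x N S t a g \<longleftrightarrow>
     (0 < t \<longrightarrow> a \<le> S (t - 1)) \<and> (\<forall>k l. k < l \<longrightarrow> l < t \<longrightarrow> S l < S k) \<and> (\<forall>k<t. S k + k < N) \<and>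
     (\<forall>g'. (\<forall>i. i < a \<or> (\<exists>k<t. i = S k) \<longrightarrow> g' i = g i) \<longrightarrow> (0 < t \<longrightarrow> fair x g' a (S (t - 1))) \<longrightarrow>
        (\<forall>k. Suc k < t \<longrightarrow> fair x g' (Suc (S (Suc k))) (S k)) \<longrightarrow> fair x g' 0 (N - 1))"

section \<open>The stack of pending intervals\<close>

lemma split_inv_init: "0 < N \<Longrightarrow> S 0 = N - 1 \<Longrightarrow> split_inv x N S 1 0 g"
  by (auto simp: split_inv_def)

lemma split_inv_final: "split_inv x N S 0 a g \<Longrightarrow> fair x g 0 (N - 1)"
  unfolding split_inv_def by (metis less_nat_zero_code)

text \<open>The last conjunct of \<open>split_inv\<close> works as a continuation: weights that keep
  the values fixed so far and are fair on the pending intervals are fair on the whole. Pushing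
  \<open>m\<close> replaces the top interval \<open>{a..b}\<close> by \<open>{a..m}\<close> and
  \<open>{m + 1..b}\<close>; the weight of \<open>m\<close> becomes fixed because \<open>m\<close>
  is now on the stack.\<close>

lemma split_inv_push:
  assumes inv: "split_inv x N S t a g" and t: "0 < t" "S (t - 1) = b"
    and m: "a \<le> m" "m < b" "x m \<le> (x a + x b) / 2" "(x a + x b) / 2 < x (Suc m) \<or> x a = x b"
  shows "split_inv x N (S(t := m)) (Suc t) a (g(m := x b - x a))"
proof -
  have I: "\<And>k l. k < l \<Longrightarrow> l < t \<Longrightarrow> S l < S k" "\<And>k. k < t \<Longrightarrow> S k + k < N"
    using inv unfolding split_inv_def by blast+
  have Sb: "b \<le> S k" if "k < t" for k
  proof (cases "k = t - 1")
    case False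
    then have "k < t - 1" using that by linarith
    then show ?thesis using I(1)[of k "t - 1"] t by simp
  qed (use t in simp)
  show ?thesis unfolding split_inv_def
  proof (intro conjI allI impI)
    show "a \<le> (S(t := m)) (Suc t - 1)" using m by simp
    show "(S(t := m)) l < (S(t := m)) k" if "k < l" "l < Suc t" for k l
      using that I(1)[of k l] Sb[of k] m by (cases "l = t") auto
    show "(S(t := m)) k + k < N" if "k < Suc t" for k
      using that I(2)[of k] I(2)[of "t - 1"] t m by (cases "k = t") auto
    fix g' assume eq: "\<forall>i. i < a \<or> (\<exists>k<Suc t. i = (S(t := m)) k) \<longrightarrow> g' i = (g(m := x b - x a)) i"
      and top: "0 < Suc t \<longrightarrow> fair x g' a ((S(t := m)) (Suc t - 1))"
      and rest: "\<forall>k. Suc k < Suc t \<longrightarrow> fair x g' (Suc ((S(t := m)) (Suc k))) ((S(t := m)) k)"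
    have old: "g' i = g i" if "i < a \<or> (\<exists>k<t. i = S k)" for i
    proof -
      have "i \<noteq> m" using that m(1,2) Sb by (metis leD)
      moreover have "i < a \<or> (\<exists>k<Suc t. i = (S(t := m)) k)" using that by (auto intro: less_SucI)
      ultimately show ?thesis using eq by auto
    qed
    have gm: "g' m = x b - x a" using eq by auto
    have "fair x g' (Suc ((S(t := m)) (Suc (t - 1)))) ((S(t := m)) (t - 1))"
      using rest[rule_format, of "t - 1"] t(1) by simp
    then have right: "fair x g' (Suc m) b" using t by (simp split: if_splits)
    have "fair x g' a m" using top by simp
    then have "fair x g' a b" using right by (rule fair.node[where x = x and g = g' and a = a and m = m and b = b, OF m(1,2) gm m(3,4)])
    moreover have "fair x g' (Suc (S (Suc k))) (S k)" if "Suc k < t" for k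
    proof -
      have "fair x g' (Suc ((S(t := m)) (Suc k))) ((S(t := m)) k)"
        using rest[rule_format, of k] that by (simp only: less_SucI)
      then show ?thesis using that by simp
    qed
    ultimately show "fair x g' 0 (N - 1)" using inv old t unfolding split_inv_def by blast
  qed
qed

text \<open>The top interval has shrunk to the single position \<open>a\<close>, a leaf, so the next
  pending interval starts at \<open>a + 1\<close>.\<close>

lemma split_inv_pop:
  assumes inv: "split_inv x N S t a g" and t: "0 < t" "S (t - 1) \<le> a"
  shows "split_inv x N S (t - 1) (Suc a) g"
proof -
  have I: "\<And>k l. k < l \<Longrightarrow> l < t \<Longrightarrow> S l < S k" "\<And>k. k < t \<Longrightarrow> S k + k < N" "a \<le> S (t - 1)"
    using inv t unfolding split_inv_def by blast+
  have Sa: "S (t - 1) = a" using t I by simp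
  show ?thesis unfolding split_inv_def
  proof (intro conjI allI impI)
    show "Suc a \<le> S (t - 1 - 1)" if "0 < t - 1"
    proof -
      have "t - 1 - 1 < t - 1" "t - 1 < t" using that by linarith+
      then show ?thesis using I(1)[of "t - 1 - 1" "t - 1"] Sa by linarith
    qed
    show "S l < S k" if "k < l" "l < t - 1" for k l using that I(1) by simp
    show "S k + k < N" if "k < t - 1" for k using that I(2) by simp
    fix g' assume eq: "\<forall>i. i < Suc a \<or> (\<exists>k<t - 1. i = S k) \<longrightarrow> g' i = g i"
      and top: "0 < t - 1 \<longrightarrow> fair x g' (Suc a) (S (t - 1 - 1))"
      and rest: "\<forall>k. Suc k < t - 1 \<longrightarrow> fair x g' (Suc (S (Suc k))) (S k)"
    have "g' i = g i" if "i < a \<or> (\<exists>k<t. i = S k)" for i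
    proof -
      have "i < Suc a \<or> (\<exists>k<t - 1. i = S k)"
        using that Sa by (metis One_nat_def Suc_pred less_SucE less_SucI lessI t(1))
      then show ?thesis using eq by blast
    qed
    moreover have "fair x g' a (S (t - 1))" unfolding Sa by (rule fair.leaf)
    moreover have "fair x g' (Suc (S (Suc k))) (S k)" if k: "Suc k < t" for k
    proof (cases "Suc k = t - 1")
      case True
      then have "t - 1 - 1 = k" by simp
      then show ?thesis using top Sa True by auto
    next
      case False
      then show ?thesis using rest k by simp
    qed
    ultimately show "fair x g' 0 (N - 1)" using inv t unfolding split_inv_def by blast
  qed
qed

abbreviation sorted_value :: "string \<Rightarrow> string \<Rightarrow> rexp" where
  "sorted_value X i \<equiv> RGet X (IGet ''A'' (iscalar i))"

section \<open>Bisection at the midpoint value\<close>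

text \<open>Addresses cannot be halved, so the probe \<open>q\<close> is placed at a distance from
  \<open>lo\<close> that is the greatest power of two not exceeding \<open>hi - lo - 1\<close>. This
  is found in the tables.\<close>

definition bisect :: "string \<Rightarrow> com" where
  "bisect X =
     (''mid'' :=\<^sub>r RDiv (RAdd (sorted_value X ''a'') (sorted_value X ''b'')) (RConst 2) ;;
      ''lo'' :=\<^sub>i iscalar ''a'' ;; ''hi'' :=\<^sub>i iscalar ''b'') ;;
     While (ILess (IAdd (iscalar ''lo'') (IConst 1)) (iscalar ''hi''))
       (''q'' :=\<^sub>i IAdd (iscalar ''lo'')
          (IGet ''pw'' (IGet ''lg'' (ISub (ISub (iscalar ''hi'') (iscalar ''lo'')) (IConst 1)))) ;;
        Cond (RLess (rscalar ''mid'') (sorted_value X ''q''))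
          (''hi'' :=\<^sub>i iscalar ''q'') (''lo'' :=\<^sub>i iscalar ''q''))"

lemma runs_bisect:
  assumes tabs: "has_log_tables s M" "N \<le> M" and ab: "icell s ''a'' 0 = a" "icell s ''b'' 0 = b" "a < b" "b < N"
    and x: "\<And>i. x i = rcell s X (icell s ''A'' i)" "x a \<le> x b" and X: "X \<noteq> ''mid''"
  shows "runs (bisect X) s (100 * (floor_log N + 2))
    (\<lambda>s'. a \<le> icell s' ''lo'' 0 \<and> icell s' ''lo'' 0 < b \<and> x (icell s' ''lo'' 0) \<le> (x a + x b) / 2 \<and>
      ((x a + x b) / 2 < x (Suc (icell s' ''lo'' 0)) \<or> x a = x b))"
  unfolding bisect_def
proof (rule runs_seq_wp[where Y = "60 * (floor_log N + 2)"], unfold wp.simps,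
    rule runs_while[where T = 40 and
      \<mu> = "\<lambda>s'. if Suc (icell s' ''lo'' 0) < icell s' ''hi'' 0 then Suc (floor_log (icell s' ''hi'' 0 - icell s' ''lo'' 0 - 1)) else 0" and
      I = "\<lambda>s'. a \<le> icell s' ''lo'' 0 \<and> icell s' ''lo'' 0 < icell s' ''hi'' 0 \<and> icell s' ''hi'' 0 \<le> b \<and>
        x (icell s' ''lo'' 0) \<le> (x a + x b) / 2 \<and> ((x a + x b) / 2 < x (icell s' ''hi'' 0) \<or> x a = x b) \<and>
        rcell s' ''mid'' 0 = (x a + x b) / 2"],
    goal_cases init step exit time cost)
  case init
  show ?case using ab x X by auto
next
  case (step s')
  let ?lo = "icell s' ''lo'' 0" and ?hi = "icell s' ''hi'' 0"
  have lt: "Suc ?lo < ?hi" using step(2) by simp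
  have fr: "icell s' ''lg'' = icell s ''lg''" "icell s' ''pw'' = icell s ''pw''" "icell s' ''A'' = icell s ''A''"
    "rcell s' X = rcell s X"
    using frame_icell[OF step(3), of "''lg''"] frame_icell[OF step(3), of "''pw''"]
      frame_icell[OF step(3), of "''A''"] frame_rcell[OF step(3), of X] X by auto
  have bnd: "?hi - Suc ?lo \<le> M" using step(1) ab tabs(2) by linarith
  define l where "l = floor_log (?hi - Suc ?lo)"
  define w where "w = (2::nat) ^ l"
  have lg: "icell s ''lg'' (?hi - Suc ?lo) = l"
    using tabs(1) lt bnd unfolding has_log_tables_def l_def by simp
  have w: "w \<le> ?hi - Suc ?lo" "?hi - Suc ?lo < 2 * w" "0 < w"
    using lt unfolding w_def l_def by (auto intro: floor_log_exp2_le floor_log_exp2_gt)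
  have pw: "icell s ''pw'' l = w"
    unfolding w_def by (rule has_log_tables_pw[OF tabs(1)]) (use w(1) bnd in \<open>unfold w_def, linarith\<close>)
  \<comment> \<open>After either update fewer than \<open>w\<close> positions remain strictly
    between \<open>lo\<close> and \<open>hi\<close>, so the logarithm in the variant drops.\<close>
  have dec: "floor_log m < l" if "0 < m" "m < w" for m
  proof (rule ccontr)
    assume "\<not> floor_log m < l"
    then have "w \<le> 2 ^ floor_log m" unfolding w_def by (intro power_increasing) auto
    also have "\<dots> \<le> m" using that(1) by (rule floor_log_exp2_le)
    finally show False using that(2) by simp
  qed
  have q: "?lo < ?lo + w" "?lo + w < ?hi" using w lt by linarith+
  have dec1: "floor_log (w - Suc 0) < l" if "Suc ?lo < ?lo + w"
    using dec[of "w - Suc 0"] that by simp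
  have dec2: "floor_log (?hi - Suc (?lo + w)) < l" if "Suc (?lo + w) < ?hi"
    using dec[of "?hi - Suc (?lo + w)"] that w(2) by linarith
  show ?case
    by (rule runs_wp)
      (use step(1) lt lg pw q dec1 dec2 x(1) l_def[symmetric] in \<open>auto simp: fr\<close>)
next
  case (exit s')
  then have "icell s' ''hi'' 0 = Suc (icell s' ''lo'' 0)" by auto
  then show ?case using exit(1) ab by auto
next
  case time
  have "floor_log (b - a - 1) \<le> floor_log N" using ab by (intro floor_log_le_iff) simp
  then show ?case using ab by (auto simp: algebra_simps)
qed simp

definition fair_split :: "string \<Rightarrow> com" where
  "fair_split X =
     (''a'' :=\<^sub>i IConst 0 ;; ''t'' :=\<^sub>i IConst 1 ;; IAssign ''S'' (IConst 0) (ISub (iscalar ''N'') (IConst 1))) ;;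
     While (ILess (IConst 0) (iscalar ''t''))
       (''b'' :=\<^sub>i IGet ''S'' (ISub (iscalar ''t'') (IConst 1)) ;;
        Cond (ILess (iscalar ''a'') (iscalar ''b''))
          (bisect X ;;
           RAssign ''g'' (iscalar ''lo'') (RSub (sorted_value X ''b'') (sorted_value X ''a'')) ;;
           IAssign ''S'' (iscalar ''t'') (iscalar ''lo'') ;;
           ''t'' :=\<^sub>i IAdd (iscalar ''t'') (IConst 1))
          (''a'' :=\<^sub>i IAdd (iscalar ''a'') (IConst 1) ;; ''t'' :=\<^sub>i ISub (iscalar ''t'') (IConst 1)))"

text \<open>Each gap is bisected once, so the logarithmic cost of a bisection suffices however
  unbalanced the splits are. In the variant \<open>2 * (N - a) - t\<close>, a push raises
  \<open>t\<close>, while a pop raises \<open>a\<close> and lowers \<open>t\<close>; both decrease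
  it by one because \<open>t\<close> is at most \<open>N - a\<close>.\<close>

lemma runs_fair_split:
  assumes tabs: "has_log_tables s M" "N \<le> M" and N: "icell s ''N'' 0 = N" "0 < N"
    and x: "\<And>i. x i = rcell s X (icell s ''A'' i)" and mono: "\<And>i k. i \<le> k \<Longrightarrow> k < N \<Longrightarrow> x i \<le> x k"
    and X: "X \<noteq> ''mid''" "X \<noteq> ''g''"
  shows "runs (fair_split X) s (500 * (N * (floor_log N + 2))) (\<lambda>s'. fair x (rcell s' ''g'') 0 (N - 1))"
  unfolding fair_split_def
proof (rule runs_seq_wp[where Y = "480 * (N * (floor_log N + 2))"], unfold wp.simps,
    rule runs_while[where T = "150 * (floor_log N + 2)" and
      \<mu> = "\<lambda>s'. 2 * (N - icell s' ''a'' 0) - icell s' ''t'' 0" and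
      I = "\<lambda>s'. split_inv x N (icell s' ''S'') (icell s' ''t'' 0) (icell s' ''a'' 0) (rcell s' ''g'')"],
    goal_cases init step exit time cost)
  case init
  show ?case using N split_inv_init[of N] by simp
next
  case (step s')
  let ?a = "icell s' ''a'' 0" and ?t = "icell s' ''t'' 0"
  let ?b = "icell s' ''S'' (?t - 1)"
  have fr: "icell s' ''lg'' = icell s ''lg''" "icell s' ''pw'' = icell s ''pw''" "icell s' ''A'' = icell s ''A''"
    "icell s' ''N'' = icell s ''N''" "rcell s' X = rcell s X"
    using frame_icell[OF step(3), of "''lg''"] frame_icell[OF step(3), of "''pw''"]
      frame_icell[OF step(3), of "''A''"] frame_icell[OF step(3), of "''N''"]
      frame_rcell[OF step(3), of X] X by (auto simp: bisect_def)
  have t: "0 < ?t" using step(2) by simp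
  have "\<And>k. k < ?t \<Longrightarrow> icell s' ''S'' k + k < N" using step(1) unfolding split_inv_def by blast
  then have inv: "?a \<le> ?b" "?b + (?t - 1) < N"
    using step(1) t unfolding split_inv_def by (blast, meson diff_less zero_less_one)
  have bN: "?b < N" using inv(2) by simp
  have ta: "?t \<le> N - ?a" using inv t by linarith
  show ?case
  proof (rule runs_seq_wp[where Y = "140 * (floor_log N + 2)"], unfold wp.simps,
      rule runs_cond[where T = "130 * (floor_log N + 2)"], goal_cases split pop cost1 cost2)
    case split
    then have ab: "?a < ?b" by simp
    show ?case
    proof (rule runs_seq[OF runs_bisect[where N = N and M = M and a = ?a and b = ?b and x = x], where Y = "25"],
        goal_cases tables _ _ _ _ _ _ _ _ split _)
      case tables
      show ?case using tabs(1) fr by (simp add: has_log_tables_def)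
    next
      case (split s'')
      have fr': "icell s'' ''a'' 0 = ?a" "icell s'' ''t'' 0 = ?t" "icell s'' ''b'' 0 = ?b"
        "icell s'' ''A'' = icell s ''A''" "icell s'' ''S'' = icell s' ''S''" "rcell s'' X = rcell s X"
        "rcell s'' ''g'' = rcell s' ''g''"
        using frame_icell[OF split(2), of "''a''"] frame_icell[OF split(2), of "''t''"]
          frame_icell[OF split(2), of "''b''"] frame_icell[OF split(2), of "''A''"]
          frame_icell[OF split(2), of "''S''"] frame_rcell[OF split(2), of X] frame_rcell[OF split(2), of "''g''"]
          X fr by (auto simp: bisect_def)
      have "split_inv x N ((icell s' ''S'')(?t := icell s'' ''lo'' 0)) (Suc ?t) ?a
          ((rcell s' ''g'')(icell s'' ''lo'' 0 := x ?b - x ?a))"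
        using split(1) by (intro split_inv_push[OF step(1) t refl]) auto
      then show ?case
        by (intro runs_wp) (use fr' x X ta inv ab in auto)
    qed (use tabs ab bN x mono X fr in auto)
  next
    case pop
    then have "?b \<le> ?a" by simp
    moreover have "2 * (N - Suc ?a) - (?t - Suc 0) < 2 * (N - ?a) - ?t" using ta t by linarith
    ultimately show ?case
      by (intro runs_wp) (use split_inv_pop[OF step(1) t] in auto)
  qed auto
next
  case (exit s')
  then show ?case using split_inv_final by simp
next
  case time
  have "(2 * N - 1 + 1) * (150 * (floor_log N + 2) + 1 + 4) \<le> 2 * N * (160 * (floor_log N + 2))"
    using N(2) by (intro mult_mono) auto
  then show ?case by (simp add: algebra_simps)
next
  case cost
  show ?case using N(2) by (simp add: algebra_simps)
qed

section \<open>Distances and Z-order comparison\<close>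

definition array_dist :: "(nat \<Rightarrow> real) \<Rightarrow> nat \<Rightarrow> nat \<Rightarrow> nat \<Rightarrow> real" where
  "array_dist X D p q = L2_set (\<lambda>j. X (D * p + j) - X (D * q + j)) {..<D}"

primrec sq_dist_exp :: "string \<Rightarrow> iexp \<Rightarrow> iexp \<Rightarrow> nat \<Rightarrow> rexp" where
  "sq_dist_exp X p q 0 = RConst 0"
| "sq_dist_exp X p q (Suc j) =
     RAdd (sq_dist_exp X p q j)
       (RMul (RSub (RGet X (IAdd p (IConst j))) (RGet X (IAdd q (IConst j))))
             (RSub (RGet X (IAdd p (IConst j))) (RGet X (IAdd q (IConst j)))))"

definition dist_exp :: "string \<Rightarrow> nat \<Rightarrow> iexp \<Rightarrow> iexp \<Rightarrow> rexp" where
  "dist_exp X D p q = RSqrt (sq_dist_exp X (imult D p) (imult D q) D)"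

lemma rval_dist_exp [simp]: "rval (dist_exp X D p q) s = array_dist (rcell s X) D (ival p s) (ival q s)"
proof -
  have "rval (sq_dist_exp X p q j) s = (\<Sum>i<j. (rcell s X (ival p s + i) - rcell s X (ival q s + i))\<^sup>2)" for p q j
    by (induction j) (simp_all add: power2_eq_square)
  then show ?thesis by (simp add: dist_exp_def array_dist_def L2_set_def)
qed

section \<open>Comparison of two points in Z-order\<close>

definition zcompare_coord :: "nat \<Rightarrow> nat \<Rightarrow> com" where
  "zcompare_coord D j =
     (''rx'' :=\<^sub>i IGet ''R'' (IAdd (imult D (iscalar ''x'')) (IConst j)) ;;
      ''ry'' :=\<^sub>i IGet ''R'' (IAdd (imult D (iscalar ''y'')) (IConst j))) ;;
     Cond (ILess (iscalar ''rx'') (iscalar ''ry''))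
       (''lo'' :=\<^sub>i iscalar ''rx'' ;; ''hi'' :=\<^sub>i iscalar ''ry'' ;; ''o'' :=\<^sub>i IConst 1)
       (''lo'' :=\<^sub>i iscalar ''ry'' ;; ''hi'' :=\<^sub>i iscalar ''rx'' ;;
        Cond (ILess (iscalar ''ry'') (iscalar ''rx'')) (''o'' :=\<^sub>i IConst 0) (''o'' :=\<^sub>i IConst 1)) ;;
     Cond (ILess (iscalar ''lo'') (iscalar ''hi''))
       (range_max ;; ''val'' :=\<^sub>r RGet ''g'' (iscalar ''r''))
       (''val'' :=\<^sub>r RConst 0) ;;
     Cond (RLess (rscalar ''best'') (rscalar ''val''))
       (''best'' :=\<^sub>r rscalar ''val'' ;; ''c'' :=\<^sub>i iscalar ''o'')
       Skip"

text \<open>The loop over the coordinates is unrolled, so \<open>wp\<close> applies to it. The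
  initial value -1 is below every weight and lets coordinate 0 win; later coordinates must be
  strictly heavier, which selects the first maximum. The final value of \<open>best\<close> is the
  level, as a by-product.\<close>

primrec zcompare_coords :: "nat \<Rightarrow> nat \<Rightarrow> com" where
  "zcompare_coords D 0 = (''best'' :=\<^sub>r RConst (-1) ;; ''c'' :=\<^sub>i IConst 1)"
| "zcompare_coords D (Suc j) = (zcompare_coords D j ;; zcompare_coord D j)"

abbreviation zcompare :: "nat \<Rightarrow> com" where "zcompare D \<equiv> zcompare_coords D D"

lemma iwrites_zcompare_coords: "iwrites (zcompare_coords D j) \<subseteq> {''rx'', ''ry'', ''lo'', ''hi'', ''o'', ''u'', ''r'', ''v'', ''c''}"
  and rwrites_zcompare_coords: "rwrites (zcompare_coords D j) \<subseteq> {''best'', ''val''}"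
  by (induction j) (auto simp: zcompare_coord_def)

lemma wp_range_max_wmax:
  assumes tabs: "has_log_tables s M" "N \<le> M" "has_sparse_table s N"
    and lohi: "icell s ''lo'' 0 = a" "icell s ''hi'' 0 = b" "a < b" "b \<le> N"
    and g: "\<And>i. i < N \<Longrightarrow> 0 \<le> rcell s ''g'' i"
  shows "wp range_max (\<lambda>s'. icell s' ''r'' 0 = amax (rcell s ''g'') a b \<and>
    rcell s ''g'' (icell s' ''r'' 0) = wmax (rcell s ''g'') a b) s"
  by (rule wp_mono[OF wp_range_max[OF tabs lohi]])
    (use g[of "amax (rcell s ''g'') a b"] amax_props(2)[of a b "rcell s ''g''"] wmax_amax[of a b "rcell s ''g''"] lohi in auto)

definition zresult :: "(nat \<Rightarrow> real) \<Rightarrow> (nat \<Rightarrow> nat \<Rightarrow> nat) \<Rightarrow> nat \<Rightarrow> nat \<Rightarrow> nat \<Rightarrow> store \<Rightarrow> bool" where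
  "zresult g rk p q j s \<longleftrightarrow>
     j = 0 \<and> rcell s ''best'' 0 = - 1 \<or>
     (\<exists>i. first_max j (coord_level g rk p q) i \<and> rcell s ''best'' 0 = coord_level g rk p q i \<and>
        (icell s ''c'' 0 \<noteq> 0 \<longleftrightarrow> rk p i \<le> rk q i))"

lemma zresult_step:
  assumes "zresult g rk p q j s"
    and "coord_level g rk p q j \<le> rcell s ''best'' 0 \<Longrightarrow> rcell s' ''best'' 0 = rcell s ''best'' 0 \<and> icell s' ''c'' 0 = icell s ''c'' 0"
    and "rcell s ''best'' 0 < coord_level g rk p q j \<Longrightarrow> rcell s' ''best'' 0 = coord_level g rk p q j \<and>
      (icell s' ''c'' 0 \<noteq> 0 \<longleftrightarrow> rk p j \<le> rk q j)"
  shows "zresult g rk p q (Suc j) s'"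
proof (cases "rcell s ''best'' 0 < coord_level g rk p q j")
  case True
  have "coord_level g rk p q i < coord_level g rk p q j" if "i < j" for i
    using assms(1) True that unfolding zresult_def first_max_def by (auto intro: le_less_trans)
  then have "first_max (Suc j) (coord_level g rk p q) j"
    by (auto simp: first_max_def less_Suc_eq intro: less_imp_le)
  then show ?thesis using assms(3)[OF True] by (auto simp: zresult_def)
next
  case False
  then obtain i where i: "first_max j (coord_level g rk p q) i" "rcell s ''best'' 0 = coord_level g rk p q i"
    "icell s ''c'' 0 \<noteq> 0 \<longleftrightarrow> rk p i \<le> rk q i"
    using assms(1) coord_level_nonneg[of g rk p q j] by (auto simp: zresult_def not_less simp del: coord_level_nonneg)
  then have "first_max (Suc j) (coord_level g rk p q) i"
    using False by (auto simp: first_max_def less_Suc_eq)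
  then show ?thesis using assms(2) i False by (auto simp: zresult_def)
qed

lemma wp_zcompare_coords:
  assumes tabs: "has_log_tables s M" "N \<le> M" "has_sparse_table s N"
    and g: "\<And>i. i < N \<Longrightarrow> 0 \<le> rcell s ''g'' i"
    and xy: "icell s ''x'' 0 = p" "icell s ''y'' 0 = q"
    and rk: "\<And>p j. rk p j = icell s ''R'' (D * p + j)"
    and bound: "\<And>j. j < J \<Longrightarrow> rk p j \<le> N \<and> rk q j \<le> N"
  shows "wp (zcompare_coords D J) (zresult (rcell s ''g'') rk p q J) s"
  using bound
proof (induction J)
  case 0
  then show ?case by (simp add: zresult_def)
next
  case (Suc j)
  let ?g = "rcell s ''g''"
  have IH: "wp (zcompare_coords D j) (zresult ?g rk p q j) s" using Suc by simp
  show ?case unfolding zcompare_coords.simps wp.simps(4)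
  proof (rule wp_conseq[OF IH])
    fix s1 assume res: "zresult ?g rk p q j s1" and fr: "frame (zcompare_coords D j) s s1"
    have I: "icell s1 a = icell s a" if "a \<in> {''R'', ''x'', ''y'', ''lg'', ''pw'', ''row'', ''T''}" for a
      by (rule frame_icell[OF fr]) (use that iwrites_zcompare_coords[of D j] in auto)
    have G: "rcell s1 ''g'' = ?g"
      by (rule frame_rcell[OF fr]) (use rwrites_zcompare_coords[of D j] in auto)
    define a where "a = min (rk p j) (rk q j)"
    define b where "b = max (rk p j) (rk q j)"
    have ab: "b \<le> N" "coord_level ?g rk p q j = wmax ?g a b"
      using Suc.prems[of j] by (auto simp: a_def b_def coord_level_def min_def max_def wmax_commute)
    show "wp (zcompare_coord D j) (zresult ?g rk p q (Suc j)) s1"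
      unfolding zcompare_coord_def
    proof (rule wp_seq[where R = "\<lambda>s2. icell s2 = (icell s1)(''rx'' := (icell s1 ''rx'')(0 := rk p j),
          ''ry'' := (icell s1 ''ry'')(0 := rk q j)) \<and> rcell s2 = rcell s1"], goal_cases load order)
      case load
      show ?case using I xy rk by simp
    next
      case (order s2)
      show ?case
      proof (rule wp_seq[where R = "\<lambda>s3. icell s3 ''lo'' 0 = a \<and> icell s3 ''hi'' 0 = b \<and>
          (icell s3 ''o'' 0 \<noteq> 0 \<longleftrightarrow> rk p j \<le> rk q j) \<and> rcell s3 = rcell s1 \<and>
          (\<forall>d\<in>{''c'', ''lg'', ''pw'', ''row'', ''T''}. icell s3 d = icell s1 d)"], goal_cases order' query)
        case order'
        show ?case using order by (auto simp: a_def b_def)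
      next
        case (query s3)
        have tabs3: "has_log_tables s3 M" "has_sparse_table s3 N"
          using query I G tabs by (simp_all add: has_log_tables_def has_sparse_table_def has_sparse_row_def)
        show ?case
        proof (rule wp_seq[where R = "\<lambda>s4. rcell s4 ''val'' 0 = wmax ?g a b \<and> icell s4 ''o'' = icell s3 ''o'' \<and>
            icell s4 ''c'' = icell s3 ''c'' \<and> rcell s4 ''best'' = rcell s3 ''best''"], goal_cases query' update)
          case query'
          show ?case
          proof (cases "a < b")
            case True
            have "wp range_max (\<lambda>s'. rcell s3 ''g'' (icell s' ''r'' 0) = wmax (rcell s3 ''g'') a b) s3"
              by (rule wp_mono[OF wp_range_max_wmax[OF tabs3(1) tabs(2) tabs3(2) _ _ True ab(1)]])
                (use query g G in auto)
            then have "wp range_max (wp (''val'' :=\<^sub>r RGet ''g'' (iscalar ''r''))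
              (\<lambda>s4. rcell s4 ''val'' 0 = wmax ?g a b \<and> icell s4 ''o'' = icell s3 ''o'' \<and>
              icell s4 ''c'' = icell s3 ''c'' \<and> rcell s4 ''best'' = rcell s3 ''best'')) s3"
            proof (rule wp_conseq)
              fix s' assume *: "rcell s3 ''g'' (icell s' ''r'' 0) = wmax (rcell s3 ''g'') a b" "frame range_max s3 s'"
              have "icell s' ''o'' = icell s3 ''o''" "icell s' ''c'' = icell s3 ''c''" "rcell s' = rcell s3"
                using *(2) by (auto simp: frame_def)
              then show "wp (''val'' :=\<^sub>r RGet ''g'' (iscalar ''r''))
                (\<lambda>s4. rcell s4 ''val'' 0 = wmax ?g a b \<and> icell s4 ''o'' = icell s3 ''o'' \<and>
                icell s4 ''c'' = icell s3 ''c'' \<and> rcell s4 ''best'' = rcell s3 ''best'') s'"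
                using * query G by simp
            qed
            then show ?thesis using query True by simp
          next
            case False
            then have "a = b" by (auto simp: a_def b_def)
            then show ?thesis using query False by simp
          qed
        next
          case (update s4)
          show ?case using zresult_step[OF res] update query ab by auto
        qed
      qed
    qed
  qed
qed

lemma wp_zcompare:
  assumes "has_log_tables s M" "N \<le> M" "has_sparse_table s N"
    and "\<And>i. i < N \<Longrightarrow> 0 \<le> rcell s ''g'' i"
    and "icell s ''x'' 0 = p" "icell s ''y'' 0 = q"
    and "\<And>p j. rk p j = icell s ''R'' (D * p + j)"
    and "\<And>j. j < D \<Longrightarrow> rk p j \<le> N \<and> rk q j \<le> N" and D: "0 < D"
  shows "wp (zcompare D) (\<lambda>s'. (icell s' ''c'' 0 \<noteq> 0) = zle D (rcell s ''g'') rk p q \<and>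
    rcell s' ''best'' 0 = level D (rcell s ''g'') rk p q) s"
proof (rule wp_mono[OF wp_zcompare_coords[OF assms(1-8)]])
  fix s' assume "zresult (rcell s ''g'') rk p q D s'"
  then obtain i where "first_max D (coord_level (rcell s ''g'') rk p q) i"
    "rcell s' ''best'' 0 = coord_level (rcell s ''g'') rk p q i" "icell s' ''c'' 0 \<noteq> 0 \<longleftrightarrow> rk p i \<le> rk q i"
    using D by (auto simp: zresult_def)
  then show "(icell s' ''c'' 0 \<noteq> 0) = zle D (rcell s ''g'') rk p q \<and>
    rcell s' ''best'' 0 = level D (rcell s ''g'') rk p q"
    using first_max_unique level_eq_first_max unfolding zle_def by metis
qed auto

section \<open>Enumerating the well-separated pairs\<close>

definition push_pair :: "iexp \<Rightarrow> iexp \<Rightarrow> iexp \<Rightarrow> iexp \<Rightarrow> com" where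
  "push_pair a b c d =
     IAssign ''SA'' (iscalar ''t'') a ;; IAssign ''SB'' (iscalar ''t'') b ;;
     IAssign ''SC'' (iscalar ''t'') c ;; IAssign ''SD'' (iscalar ''t'') d ;;
     ''t'' :=\<^sub>i IAdd (iscalar ''t'') (IConst 1)"

definition interval_top :: "string \<Rightarrow> string \<Rightarrow> string \<Rightarrow> string \<Rightarrow> com" where
  "interval_top a b r l =
     Cond (ILess (iscalar a) (iscalar b))
       ((''lo'' :=\<^sub>i iscalar a ;; ''hi'' :=\<^sub>i iscalar b) ;; range_max ;;
        r :=\<^sub>i iscalar ''r'' ;; l :=\<^sub>r RGet ''g'' (iscalar ''r''))
       (l :=\<^sub>r RConst 0)"

definition record_ratio :: "string \<Rightarrow> nat \<Rightarrow> string \<Rightarrow> nat \<Rightarrow> com" where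
  "record_ratio X D Y E =
     ''ratio'' :=\<^sub>r RDiv (dist_exp Y E (IGet ''A'' (iscalar ''a'')) (IGet ''A'' (iscalar ''c'')))
        (dist_exp X D (IGet ''A'' (iscalar ''a'')) (IGet ''A'' (iscalar ''c''))) ;;
     Cond (RLess (rscalar ''L'') (rscalar ''ratio'')) (''L'' :=\<^sub>r rscalar ''ratio'') Skip"

text \<open>The cases and the order of the pushes follow \<open>children\<close>. For valid pairs
  \<open>a < c\<close> fails only on the diagonal, and a weight above \<open>sep\<close> guarantees
  that the interval to be split has a gap.\<close>

definition pair_step :: "string \<Rightarrow> nat \<Rightarrow> string \<Rightarrow> nat \<Rightarrow> com" where
  "pair_step X D Y E =
     (''t'' :=\<^sub>i ISub (iscalar ''t'') (IConst 1) ;;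
      ''a'' :=\<^sub>i IGet ''SA'' (iscalar ''t'') ;; ''b'' :=\<^sub>i IGet ''SB'' (iscalar ''t'') ;;
      ''c'' :=\<^sub>i IGet ''SC'' (iscalar ''t'') ;; ''d'' :=\<^sub>i IGet ''SD'' (iscalar ''t'')) ;;
     interval_top ''a'' ''b'' ''m1'' ''h1'' ;;
     interval_top ''c'' ''d'' ''m2'' ''h2'' ;;
     ''sep'' :=\<^sub>r RMul (rscalar ''delta'')
        (dist_exp X D (IGet ''A'' (iscalar ''a'')) (IGet ''A'' (iscalar ''c''))) ;;
     Cond (ILess (iscalar ''a'') (iscalar ''c''))
       (Cond (RLess (rscalar ''h1'') (rscalar ''h2''))
         (Cond (RLess (rscalar ''sep'') (rscalar ''h2''))
           (push_pair (iscalar ''a'') (iscalar ''b'') (iscalar ''c'') (iscalar ''m2'') ;;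
            push_pair (iscalar ''a'') (iscalar ''b'') (IAdd (iscalar ''m2'') (IConst 1)) (iscalar ''d''))
           (record_ratio X D Y E))
         (Cond (RLess (rscalar ''sep'') (rscalar ''h1''))
           (push_pair (iscalar ''a'') (iscalar ''m1'') (iscalar ''c'') (iscalar ''d'') ;;
            push_pair (IAdd (iscalar ''m1'') (IConst 1)) (iscalar ''b'') (iscalar ''c'') (iscalar ''d''))
           (record_ratio X D Y E)))
       (Cond (ILess (iscalar ''a'') (iscalar ''b''))
         (push_pair (iscalar ''a'') (iscalar ''m1'') (iscalar ''a'') (iscalar ''m1'') ;;
          push_pair (IAdd (iscalar ''m1'') (IConst 1)) (iscalar ''b'') (IAdd (iscalar ''m1'') (IConst 1)) (iscalar ''b'') ;;
          push_pair (iscalar ''a'') (iscalar ''m1'') (IAdd (iscalar ''m1'') (IConst 1)) (iscalar ''b''))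
         Skip)"

definition pair_loop :: "string \<Rightarrow> nat \<Rightarrow> string \<Rightarrow> nat \<Rightarrow> com" where
  "pair_loop X D Y E =
     (''t'' :=\<^sub>i IConst 0 ;; ''L'' :=\<^sub>r RConst 0 ;;
      push_pair (IConst 0) (ISub (iscalar ''n'') (IConst 1)) (IConst 0) (ISub (iscalar ''n'') (IConst 1))) ;;
     While (ILess (IConst 0) (iscalar ''t'')) (pair_step X D Y E)"

definition stack_pair :: "store \<Rightarrow> nat \<Rightarrow> interval_pair" where
  "stack_pair s i = (icell s ''SA'' i, icell s ''SB'' i, icell s ''SC'' i, icell s ''SD'' i)"

definition pair_stack :: "store \<Rightarrow> interval_pair list" where
  "pair_stack s = map (stack_pair s) [0..<icell s ''t'' 0]"

lemma pair_stack_cong: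
  "(\<And>a. a \<in> {''SA'', ''SB'', ''SC'', ''SD'', ''t''} \<Longrightarrow> icell s' a = icell s a) \<Longrightarrow> pair_stack s' = pair_stack s"
  by (simp add: pair_stack_def stack_pair_def)

text \<open>The four expressions are evaluated one after the other while the stack arrays change, so
  their values must not depend on these arrays.\<close>

lemma wp_push_pair:
  assumes "\<And>s'. (\<And>x. x \<notin> {''SA'', ''SB'', ''SC'', ''SD''} \<Longrightarrow> icell s' x = icell s x) \<Longrightarrow>
    ival a s' = a' \<and> ival b s' = b' \<and> ival c s' = c' \<and> ival d s' = d'"
  shows "wp (push_pair a b c d) (\<lambda>s'. pair_stack s' = pair_stack s @ [(a', b', c', d')] \<and>
    (\<forall>x. x \<notin> {''SA'', ''SB'', ''SC'', ''SD'', ''t''} \<longrightarrow> icell s' x = icell s x) \<and> rcell s' = rcell s) s"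
proof -
  let ?t = "icell s ''t'' 0"
  let ?s1 = "iupd ''SA'' ?t a' s"
  let ?s2 = "iupd ''SB'' ?t b' ?s1"
  let ?s3 = "iupd ''SC'' ?t c' ?s2"
  have v: "ival a s = a'" "ival b ?s1 = b'" "ival c ?s2 = c'" "ival d ?s3 = d'"
    using assms by auto
  show ?thesis unfolding push_pair_def
    by (auto simp: v pair_stack_def stack_pair_def)
qed

lemma wp_interval_top:
  assumes tabs: "has_log_tables s M" "N \<le> M" "has_sparse_table s N"
    and ab: "icell s a 0 = a'" "icell s b 0 = b'" "b' \<le> N"
    and g: "\<And>i. i < N \<Longrightarrow> 0 \<le> rcell s ''g'' i"
    and names: "a \<notin> {''lo'', ''hi''}" "b \<notin> {''lo'', ''hi''}" "l \<noteq> ''g''"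
    and le: "a' \<le> b'"
  shows "wp (interval_top a b r l) (\<lambda>s'. rcell s' l 0 = wmax (rcell s ''g'') a' b' \<and>
    (a' < b' \<longrightarrow> icell s' r 0 = amax (rcell s ''g'') a' b')) s"
proof (cases "a' < b'")
  case True
  let ?s = "iupd ''hi'' 0 b' (iupd ''lo'' 0 a' s)"
  have tabs': "has_log_tables ?s M" "has_sparse_table ?s N"
    using tabs by (simp_all add: has_log_tables_def has_sparse_table_def has_sparse_row_def)
  have "wp range_max (\<lambda>s'. icell s' ''r'' 0 = amax (rcell ?s ''g'') a' b' \<and>
    rcell ?s ''g'' (icell s' ''r'' 0) = wmax (rcell ?s ''g'') a' b') ?s"
    by (rule wp_range_max_wmax[OF tabs'(1) tabs(2) tabs'(2) _ _ True ab(3)]) (use g in auto)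
  then have "wp range_max (wp (r :=\<^sub>i iscalar ''r'' ;; l :=\<^sub>r RGet ''g'' (iscalar ''r''))
    (\<lambda>s'. rcell s' l 0 = wmax (rcell s ''g'') a' b' \<and> icell s' r 0 = amax (rcell s ''g'') a' b')) ?s"
  proof (rule wp_conseq)
    fix s' assume *: "icell s' ''r'' 0 = amax (rcell ?s ''g'') a' b' \<and>
      rcell ?s ''g'' (icell s' ''r'' 0) = wmax (rcell ?s ''g'') a' b'" "frame range_max ?s s'"
    have "rcell s' = rcell s" using *(2) by (auto simp: frame_def)
    then show "wp (r :=\<^sub>i iscalar ''r'' ;; l :=\<^sub>r RGet ''g'' (iscalar ''r''))
      (\<lambda>s'. rcell s' l 0 = wmax (rcell s ''g'') a' b' \<and> icell s' r 0 = amax (rcell s ''g'') a' b') s'"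
      using * by auto
  qed
  then show ?thesis using True ab names unfolding interval_top_def by simp
next
  case False
  then have "a' = b'" using le by simp
  then show ?thesis using ab unfolding interval_top_def by simp
qed

lemma wp_record_ratio:
  "wp (record_ratio X D Y E) (\<lambda>s'. icell s' = icell s \<and>
     rcell s' ''L'' 0 = max (rcell s ''L'' 0)
       (array_dist (rcell s Y) E (icell s ''A'' (icell s ''a'' 0)) (icell s ''A'' (icell s ''c'' 0)) /
        array_dist (rcell s X) D (icell s ''A'' (icell s ''a'' 0)) (icell s ''A'' (icell s ''c'' 0)))) s"
  by (auto simp: record_ratio_def max_def)

lemma iwrites_pair_step: "iwrites (pair_step X D Y E) \<subseteq>
    {''t'', ''a'', ''b'', ''c'', ''d'', ''lo'', ''hi'', ''u'', ''r'', ''v'', ''m1'', ''m2'', ''SA'', ''SB'', ''SC'', ''SD''}"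
  and rwrites_pair_step: "rwrites (pair_step X D Y E) \<subseteq> {''h1'', ''h2'', ''sep'', ''ratio'', ''L''}"
  by (auto simp: pair_step_def interval_top_def record_ratio_def push_pair_def)

context pair_tree
begin

definition new_ratio :: "(nat \<Rightarrow> nat \<Rightarrow> real) \<Rightarrow> interval_pair \<Rightarrow> real \<Rightarrow> real" where
  "new_ratio dY q L = (case q of (a, b, c, d) \<Rightarrow>
     if a \<noteq> c \<and> children q = [] then max L (dY a c / dst a c) else L)"

lemma wp_pair_step:
  assumes tabs: "has_log_tables s M" "n - 1 \<le> M" "has_sparse_table s (n - 1)" and h: "rcell s ''g'' = h"
    and dst: "\<And>i k. dst i k = array_dist (rcell s X) D (icell s ''A'' i) (icell s ''A'' k)"
    and dY: "\<And>i k. dY i k = array_dist (rcell s Y) E (icell s ''A'' i) (icell s ''A'' k)"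
    and \<delta>: "rcell s ''delta'' 0 = \<delta>"
    and XY: "X \<notin> {''h1'', ''h2'', ''sep'', ''ratio''}" "Y \<notin> {''h1'', ''h2'', ''sep'', ''ratio''}"
    and st: "pair_stack s = qs @ [q]" and q: "valid q"
  shows "wp (pair_step X D Y E) (\<lambda>s'. pair_stack s' = qs @ children q \<and>
    rcell s' ''L'' 0 = new_ratio dY q (rcell s ''L'' 0)) s"
proof -
  obtain a b c d where abcd: "q = (a, b, c, d)" by (metis prod_cases4)
  have v: "a \<le> b" "c \<le> d" "d < n" "a = c \<and> b = d \<or> b < c" using q unfolding abcd by auto
  have bN: "b \<le> n - 1" "d \<le> n - 1" using v by auto
  have hn: "0 \<le> h i" if "i < n - 1" for i
  proof -
    have "Suc i < n" using that by linarith
    then show ?thesis using h_pos[of i] by simp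
  qed
  let ?t = "icell s ''t'' 0"
  have t: "0 < ?t" using st by (cases ?t) (auto simp: pair_stack_def)
  then obtain t' where t': "?t = Suc t'" by (cases ?t) auto
  have top: "stack_pair s t' = (a, b, c, d)" "map (stack_pair s) [0..<t'] = qs"
    using st abcd t' by (auto simp: pair_stack_def)
  \<comment> \<open>The part of the store that both range queries leave intact.\<close>
  define I where "I s1 \<longleftrightarrow> pair_stack s1 = qs \<and> icell s1 ''a'' 0 = a \<and> icell s1 ''b'' 0 = b \<and>
     icell s1 ''c'' 0 = c \<and> icell s1 ''d'' 0 = d \<and>
     (\<forall>x\<in>{''A'', ''lg'', ''pw'', ''row'', ''T''}. icell s1 x = icell s x) \<and>
     (\<forall>x\<in>{X, Y, ''g'', ''delta'', ''L''}. rcell s1 x = rcell s x)" for s1 :: store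
  have I_frame: "I s2" if I1: "I s1" and fr: "frame p s1 s2"
    and iw: "{''a'', ''b'', ''c'', ''d'', ''SA'', ''SB'', ''SC'', ''SD'', ''t'', ''A'', ''lg'', ''pw'', ''row'', ''T''} \<inter> iwrites p = {}"
    and rw: "{X, Y, ''g'', ''delta'', ''L''} \<inter> rwrites p = {}" for p s1 s2
  proof -
    have 1: "icell s2 x = icell s1 x" if "x \<in> {''a'', ''b'', ''c'', ''d'', ''SA'', ''SB'', ''SC'', ''SD'', ''t'', ''A'', ''lg'', ''pw'', ''row'', ''T''}" for x
      by (rule frame_icell[OF fr disjoint_iff[THEN iffD1, OF iw, rule_format, OF that]])
    have 2: "rcell s2 x = rcell s1 x" if "x \<in> {X, Y, ''g'', ''delta'', ''L''}" for x
      by (rule frame_rcell[OF fr disjoint_iff[THEN iffD1, OF rw, rule_format, OF that]])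
    have "pair_stack s2 = pair_stack s1" by (rule pair_stack_cong) (rule 1, auto)
    moreover have "icell s2 ''a'' = icell s1 ''a''" "icell s2 ''b'' = icell s1 ''b''" "icell s2 ''c'' = icell s1 ''c''"
      "icell s2 ''d'' = icell s1 ''d''" "icell s2 ''A'' = icell s1 ''A''" "icell s2 ''lg'' = icell s1 ''lg''"
      "icell s2 ''pw'' = icell s1 ''pw''" "icell s2 ''row'' = icell s1 ''row''" "icell s2 ''T'' = icell s1 ''T''"
      by (rule 1, simp)+
    moreover have "rcell s2 X = rcell s1 X" "rcell s2 Y = rcell s1 Y" "rcell s2 ''g'' = rcell s1 ''g''"
      "rcell s2 ''delta'' = rcell s1 ''delta''" "rcell s2 ''L'' = rcell s1 ''L''"
      by (rule 2, simp)+
    ultimately show ?thesis using I1 unfolding I_def by simp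
  qed
  have tabsI: "has_log_tables s1 M" "has_sparse_table s1 (n - 1)" "rcell s1 ''g'' = h" if "I s1" for s1
    using that tabs h by (simp_all add: I_def has_log_tables_def has_sparse_table_def has_sparse_row_def)
  let ?h1 = "wmax h a b" and ?h2 = "wmax h c d"
  show ?thesis unfolding pair_step_def
  proof (rule wp_seq[where R = I], goal_cases load tops)
    case load
    show ?case using top t' by (auto simp: I_def pair_stack_def stack_pair_def)
  next
    case (tops s1)
    show ?case
    proof (rule wp_seq[OF wp_interval_top[where a' = a and b' = b and N = "n - 1" and M = M]],
        goal_cases t1 t2 t3 t4 t5 t6 t7 t8 t9 t10 t11 second)
      case (second s2)
      have s2: "I s2" "rcell s2 ''h1'' 0 = ?h1" "a < b \<longrightarrow> icell s2 ''m1'' 0 = peak a b"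
        using I_frame[OF tops(1) second(2)] second(1) tabsI(3)[OF tops(1)] XY
        by (auto simp: interval_top_def)
      show ?case
      proof (rule wp_seq[OF wp_interval_top[where a' = c and b' = d and N = "n - 1" and M = M]],
          goal_cases t1 t2 t3 t4 t5 t6 t7 t8 t9 t10 t11 third)
        case (third s3)
        have s3: "I s3" "rcell s3 ''h2'' 0 = ?h2" "c < d \<longrightarrow> icell s3 ''m2'' 0 = peak c d"
          using I_frame[OF s2(1) third(2)] third(1) tabsI(3)[OF s2(1)] XY
          by (auto simp: interval_top_def)
        have s3': "rcell s3 ''h1'' 0 = ?h1" "a < b \<longrightarrow> icell s3 ''m1'' 0 = peak a b"
          using s2 frame_rcell[OF third(2), of "''h1''"] frame_icell[OF third(2), of "''m1''"]
          by (auto simp: interval_top_def)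
        define z where "z = rupd ''sep'' 0 (\<delta> * dst a c) s3"
        have s4: "pair_stack z = qs" "icell z ''a'' 0 = a" "icell z ''b'' 0 = b"
          "icell z ''c'' 0 = c" "icell z ''d'' 0 = d" "rcell z ''h1'' 0 = ?h1" "rcell z ''h2'' 0 = ?h2"
          "a < b \<longrightarrow> icell z ''m1'' 0 = peak a b" "c < d \<longrightarrow> icell z ''m2'' 0 = peak c d"
          "rcell z ''sep'' 0 = \<delta> * dst a c" "rcell z ''L'' = rcell s ''L''"
          "icell z ''A'' = icell s ''A''" "rcell z X = rcell s X" "rcell z Y = rcell s Y"
          using s3 s3' XY by (auto simp: I_def pair_stack_def stack_pair_def z_def)
        have sep: "wp (''sep'' :=\<^sub>r RMul (rscalar ''delta'')
        (dist_exp X D (IGet ''A'' (iscalar ''a'')) (IGet ''A'' (iscalar ''c'')))) (\<lambda>s4. s4 = z) s3"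
          using s3 \<delta> dst by (simp add: I_def z_def)
        have sepnn: "0 \<le> \<delta> * dst a c" using \<delta>_pos dst_nonneg by simp
        have ratio: "wp (record_ratio X D Y E) (\<lambda>s'. pair_stack s' = qs \<and>
            rcell s' ''L'' 0 = max (rcell s ''L'' 0) (dY a c / dst a c)) z"
          by (rule wp_mono[OF wp_record_ratio])
            (use s4 dst dY in \<open>auto simp: pair_stack_def stack_pair_def\<close>)
        define Q where "Q s' \<longleftrightarrow> pair_stack s' = qs @ children q \<and>
            rcell s' ''L'' 0 = new_ratio dY q (rcell s ''L'' 0)" for s' :: store
        have Q: "Q s'" if "pair_stack s' = qs @ children q" "children q \<noteq> [] \<or> a = c"
            "rcell s' ''L'' = rcell s ''L''" for s' :: store
          using that by (cases "a = c") (simp_all add: Q_def new_ratio_def abcd del: children.simps)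
        show ?case unfolding Q_def[symmetric]
        proof (rule wp_seq[OF sep], goal_cases branch)
          case (branch s4)
          consider (right) "a < c" "?h1 < ?h2" "\<delta> * dst a c < ?h2"
            | (right_leaf) "a < c" "?h1 < ?h2" "?h2 \<le> \<delta> * dst a c"
            | (left) "a < c" "\<not> ?h1 < ?h2" "\<delta> * dst a c < ?h1"
            | (left_leaf) "a < c" "\<not> ?h1 < ?h2" "?h1 \<le> \<delta> * dst a c"
            | (diag) "a = c" "b = d" "a < b" | (trivial) "a = c" "b = d" "a = b"
          proof -
            consider "a < c" | "a = c" "b = d" "a < b" | "a = c" "b = d" "a = b" using v by linarith
            then show thesis
            proof cases
              case 1
              show thesis
              proof (cases "?h1 < ?h2")
                case True
                then show thesis using that(1,2) 1 by (cases "\<delta> * dst a c < ?h2") (simp_all add: not_less)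
              next
                case False
                then show thesis using that(3,4) 1 by (cases "\<delta> * dst a c < ?h1") (simp_all add: not_less)
              qed
            qed (use that(5,6) in blast)+
          qed
          then show ?case
          proof cases
            case right
            have cd: "c < d" using wmax_pos_less[of c d] v right(3) sepnn by linarith
            have ch: "children q = [(a, b, c, peak c d), (a, b, Suc (peak c d), d)]"
              using right cd unfolding abcd by simp
            have "wp (push_pair (iscalar ''a'') (iscalar ''b'') (iscalar ''c'') (iscalar ''m2'') ;;
              push_pair (iscalar ''a'') (iscalar ''b'') (IAdd (iscalar ''m2'') (IConst 1)) (iscalar ''d'')) Q z"
            proof (rule wp_seq[OF wp_push_pair[where a' = a and b' = b and c' = c and d' = "peak c d"]], goal_cases v1 p2)
              case v1
              then show ?case using s4 cd by simp
            next
              case (p2 s5)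
              show ?case
                proof (rule wp_mono[OF wp_push_pair[where a' = a and b' = b and c' = "Suc (peak c d)" and d' = d]], goal_cases vals final)
                  case vals
                  then show ?case using p2 s4 cd by simp
                next
                  case (final s7)
                  show ?case by (rule Q) (use final p2 s4 cd ch in \<open>simp_all del: children.simps\<close>)
                qed
            qed
            then show ?thesis using branch s4 right by simp
          next
            case right_leaf
            have ch: "children q = []" using right_leaf unfolding abcd by auto
            have "wp (record_ratio X D Y E) Q z"
              by (rule wp_mono[OF ratio]) (use right_leaf ch in \<open>auto simp: Q_def new_ratio_def abcd\<close>)
            then show ?thesis using branch s4 right_leaf by simp
          next
            case left
            have ab: "a < b" using wmax_pos_less[of a b] v left(3) sepnn by linarith
            have ch: "children q = [(a, peak a b, c, d), (Suc (peak a b), b, c, d)]"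
              using left ab unfolding abcd by simp
            have "wp (push_pair (iscalar ''a'') (iscalar ''m1'') (iscalar ''c'') (iscalar ''d'') ;;
              push_pair (IAdd (iscalar ''m1'') (IConst 1)) (iscalar ''b'') (iscalar ''c'') (iscalar ''d'')) Q z"
            proof (rule wp_seq[OF wp_push_pair[where a' = a and b' = "peak a b" and c' = c and d' = d]], goal_cases v1 p2)
              case v1
              then show ?case using s4 ab by simp
            next
              case (p2 s5)
              show ?case
                proof (rule wp_mono[OF wp_push_pair[where a' = "Suc (peak a b)" and b' = b and c' = c and d' = d]], goal_cases vals final)
                  case vals
                  then show ?case using p2 s4 ab by simp
                next
                  case (final s7)
                  show ?case by (rule Q) (use final p2 s4 ab ch in \<open>simp_all del: children.simps\<close>)
                qed
            qed
            then show ?thesis using branch s4 left by simp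
          next
            case left_leaf
            have ch: "children q = []" using left_leaf unfolding abcd by auto
            have "wp (record_ratio X D Y E) Q z"
              by (rule wp_mono[OF ratio]) (use left_leaf ch in \<open>auto simp: Q_def new_ratio_def abcd\<close>)
            then show ?thesis using branch s4 left_leaf by simp
          next
            case diag
            have ch: "children q = [(a, peak a b, a, peak a b), (Suc (peak a b), b, Suc (peak a b), b),
                (a, peak a b, Suc (peak a b), b)]"
              using diag unfolding abcd by simp
            have "wp (push_pair (iscalar ''a'') (iscalar ''m1'') (iscalar ''a'') (iscalar ''m1'') ;;
              push_pair (IAdd (iscalar ''m1'') (IConst 1)) (iscalar ''b'') (IAdd (iscalar ''m1'') (IConst 1)) (iscalar ''b'') ;;
              push_pair (iscalar ''a'') (iscalar ''m1'') (IAdd (iscalar ''m1'') (IConst 1)) (iscalar ''b'')) Q z"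
            proof (rule wp_seq[OF wp_push_pair[where a' = a and b' = "peak a b" and c' = a and d' = "peak a b"]], goal_cases v1 p2)
              case v1
              then show ?case using s4 diag by simp
            next
              case (p2 s5)
              show ?case
              proof (rule wp_seq[OF wp_push_pair[where a' = "Suc (peak a b)" and b' = b and c' = "Suc (peak a b)" and d' = b]],
                  goal_cases v2 p3)
                case v2
                then show ?case using p2 s4 diag by simp
              next
                case (p3 s6)
                show ?case
                  proof (rule wp_mono[OF wp_push_pair[where a' = a and b' = "peak a b" and c' = "Suc (peak a b)" and d' = b]], goal_cases vals final)
                    case vals
                    then show ?case using p2 p3 s4 diag by simp
                  next
                    case (final s7)
                    show ?case by (rule Q) (use final p2 p3 s4 diag ch in \<open>simp_all del: children.simps\<close>)
                  qed
              qed
            qed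
            then show ?thesis using branch s4 diag by simp
          next
            case trivial
            have "children q = []" using trivial unfolding abcd by simp
            then have "Q z" using trivial s4 by (simp add: Q_def new_ratio_def abcd)
            then show ?thesis using branch s4 trivial by simp
          qed
        qed
      qed (use tabsI[OF s2(1)] tabs(2) s2(1) bN hn v in \<open>auto simp: I_def\<close>)
    qed (use tabsI[OF tops(1)] tabs(2) tops(1) bN hn v in \<open>auto simp: I_def\<close>)
  qed
qed

section \<open>The invariant of the enumeration\<close>

definition represented :: "(nat \<Rightarrow> nat \<Rightarrow> real) \<Rightarrow> real \<Rightarrow> nat \<Rightarrow> nat \<Rightarrow> bool" where
  "represented dY L i k \<longleftrightarrow> (\<exists>a<n. \<exists>c<n. a \<noteq> c \<and> wmax h a i \<le> \<delta> * dst a c \<and> wmax h c k \<le> \<delta> * dst a c \<and>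
     dY a c \<le> L * dst a c)"

text \<open>The lower half of the estimate: a ratio that occurs, or 0, never exceeds a valid
  Lipschitz constant.\<close>

definition attained :: "(nat \<Rightarrow> nat \<Rightarrow> real) \<Rightarrow> real \<Rightarrow> bool" where
  "attained dY L \<longleftrightarrow> L = 0 \<or> (\<exists>a<n. \<exists>c<n. a \<noteq> c \<and> L = dY a c / dst a c)"

definition pair_inv :: "(nat \<Rightarrow> nat \<Rightarrow> real) \<Rightarrow> interval_pair list \<Rightarrow> real \<Rightarrow> bool" where
  "pair_inv dY st L \<longleftrightarrow> (\<forall>q\<in>set st. valid q) \<and> attained dY L \<and>
     (\<forall>i k. i < k \<longrightarrow> k < n \<longrightarrow> (\<exists>q\<in>set st. (i, k) \<in> cover q) \<or> represented dY L i k)"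

text \<open>An inner node hands its pairs of positions to its children; a leaf represents them by
  \<open>a\<close> and \<open>c\<close>, whose ratio enters \<open>L\<close>. As \<open>L\<close>
  only grows, represented pairs stay represented.\<close>

lemma pair_inv_step:
  assumes inv: "pair_inv dY (qs @ [q]) L" and pos: "\<And>a c. a < n \<Longrightarrow> c < n \<Longrightarrow> a \<noteq> c \<Longrightarrow> 0 < dst a c"
  shows "pair_inv dY (qs @ children q) (new_ratio dY q L)"
proof -
  obtain a b c d where abcd: "q = (a, b, c, d)" by (metis prod_cases4)
  have q: "valid q" using inv by (simp add: pair_inv_def)
  then have v: "a \<le> b" "c \<le> d" "d < n" "a = c \<and> b = d \<or> b < c" unfolding abcd by auto
  let ?L = "new_ratio dY q L"
  have L: "L \<le> ?L" unfolding new_ratio_def abcd by simp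
  have mono: "represented dY ?L i k" if rep: "represented dY L i k" for i k
  proof -
    obtain a c where ac: "a < n" "c < n" "a \<noteq> c" "wmax h a i \<le> \<delta> * dst a c" "wmax h c k \<le> \<delta> * dst a c"
      "dY a c \<le> L * dst a c" using rep unfolding represented_def by blast
    have "L * dst a c \<le> ?L * dst a c" using L dst_nonneg by (intro mult_right_mono)
    then show ?thesis using ac unfolding represented_def by (meson order_trans)
  qed
  have "valid q'" if "q' \<in> set (qs @ children q)" for q'
    using that inv valid_children[OF q] unfolding pair_inv_def set_append by blast
  moreover have "attained dY ?L"
  proof (cases "?L = L")
    case True
    then show ?thesis using inv by (simp add: pair_inv_def)
  next
    case False
    then have "?L = dY a c / dst a c" "a \<noteq> c"
      unfolding new_ratio_def abcd by (auto simp: max_def simp del: children.simps split: if_splits)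
    moreover have "a < n" "c < n" using v by linarith+
    ultimately show ?thesis unfolding attained_def by blast
  qed
  moreover have "(\<exists>q'\<in>set (qs @ children q). (i, k) \<in> cover q') \<or> represented dY ?L i k"
    if ik: "i < k" "k < n" for i k
  proof -
    consider "represented dY L i k" | q' where "q' \<in> set qs" "(i, k) \<in> cover q'" | "(i, k) \<in> cover q"
    proof -
      have "(\<exists>q'\<in>set (qs @ [q]). (i, k) \<in> cover q') \<or> represented dY L i k"
        using inv ik unfolding pair_inv_def by blast
      then show thesis using that unfolding set_append list.set by blast
    qed
    then show ?thesis
    proof cases
      case 1
      then show ?thesis using mono by blast
    next
      case 2
      then show ?thesis by auto
    next
      case 3
      show ?thesis
      proof (cases "children q = []")
        case False
        then show ?thesis using cover_children[OF q False] 3 by auto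
      next
        case True
        have in_q: "a \<le> i" "i \<le> b" "c \<le> k" "k \<le> d" using 3 unfolding abcd by auto
        have ac: "a \<noteq> c"
        proof
          assume "a = c"
          then have "a < b" using in_q ik v by linarith
          then show False using True \<open>a = c\<close> v unfolding abcd by (auto split: if_splits)
        qed
        have sep: "max (wmax h a b) (wmax h c d) \<le> \<delta> * dst a c"
          using children_empty q True ac unfolding abcd by blast
        have "wmax h a i \<le> wmax h a b" "wmax h c k \<le> wmax h c d"
          using wmax_split[of a i b h] wmax_split[of c k d h] in_q by auto
        moreover have lt: "a < n" "c < n" using v ac by auto
        moreover have "dY a c \<le> ?L * dst a c"
        proof -
          have "dY a c / dst a c \<le> ?L" using ac True unfolding new_ratio_def abcd by (simp del: children.simps)
          then show ?thesis using pos[OF lt ac] by (simp add: pos_divide_le_eq)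
        qed
        ultimately show ?thesis unfolding represented_def using ac sep by (metis max.bounded_iff order_trans)
      qed
    qed
  qed
  ultimately show ?thesis unfolding pair_inv_def by blast
qed

text \<open>The variant is the total size of the recursion trees on the stack; replacing a pair by
  its children lowers it by exactly one.\<close>

lemma runs_pair_loop:
  assumes tabs: "has_log_tables s M" "n - 1 \<le> M" "has_sparse_table s (n - 1)" and h: "rcell s ''g'' = h"
    and dst: "\<And>i k. dst i k = array_dist (rcell s X) D (icell s ''A'' i) (icell s ''A'' k)"
    and dY: "\<And>i k. dY i k = array_dist (rcell s Y) E (icell s ''A'' i) (icell s ''A'' k)"
    and \<delta>: "rcell s ''delta'' 0 = \<delta>" and n: "icell s ''n'' 0 = n"
    and XY: "X \<notin> {''h1'', ''h2'', ''sep'', ''ratio'', ''L''}" "Y \<notin> {''h1'', ''h2'', ''sep'', ''ratio'', ''L''}"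
    and pos: "\<And>a c. a < n \<Longrightarrow> c < n \<Longrightarrow> a \<noteq> c \<Longrightarrow> 0 < dst a c"
  shows "runs (pair_loop X D Y E) s ((calls (0, n - 1, 0, n - 1) + 1) * (ccost (pair_step X D Y E) + 50))
    (\<lambda>s'. attained dY (rcell s' ''L'' 0) \<and> (\<forall>i k. i < k \<longrightarrow> k < n \<longrightarrow> represented dY (rcell s' ''L'' 0) i k))"
proof -
  let ?init = "''t'' :=\<^sub>i IConst 0 ;; ''L'' :=\<^sub>r RConst 0 ;;
      push_pair (IConst 0) (ISub (iscalar ''n'') (IConst 1)) (IConst 0) (ISub (iscalar ''n'') (IConst 1))"
  let ?root = "(0, n - 1, 0, n - 1) :: interval_pair"
  let ?K = "ccost (pair_step X D Y E)"
  let ?c = "calls ?root"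
  show ?thesis unfolding pair_loop_def
  proof (rule runs_seq[where X = 45 and Y = "(?c + 1) * (?K + 5)" and
       R = "\<lambda>s1. pair_stack s1 = [?root] \<and> rcell s1 ''L'' 0 = 0"], goal_cases init loop cost)
    case init
    show ?case
      by (rule runs_wp) (use n in \<open>auto simp: push_pair_def pair_stack_def stack_pair_def\<close>)
  next
    case (loop s1)
    have F1: "icell s1 x = icell s x" if "x \<in> {''A'', ''lg'', ''pw'', ''row'', ''T'', ''n''}" for x
      by (rule frame_icell[OF loop(2)]) (use that in \<open>auto simp: push_pair_def\<close>)
    have F2: "rcell s1 x = rcell s x" if "x \<in> {X, Y, ''g'', ''delta''}" for x
      by (rule frame_rcell[OF loop(2)]) (use that XY in \<open>auto simp: push_pair_def\<close>)
    show ?case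
    proof (rule runs_while[where T = ?K and \<mu> = "\<lambda>s'. sum_list (map calls (pair_stack s'))" and
          I = "\<lambda>s'. pair_inv dY (pair_stack s') (rcell s' ''L'' 0)"], goal_cases init step exit time)
      case init
      show ?case using loop(1) valid_root n_pos by (auto simp: pair_inv_def attained_def)
    next
      case (step s2)
      have G1: "icell s2 x = icell s x" if "x \<in> {''A'', ''lg'', ''pw'', ''row'', ''T'', ''n''}" for x
        using frame_icell[OF step(3), of x] iwrites_pair_step[of X D Y E] F1[of x] that by auto
      have G2: "rcell s2 x = rcell s x" if "x \<in> {X, Y, ''g'', ''delta''}" for x
        using frame_rcell[OF step(3), of x] rwrites_pair_step[of X D Y E] F2[of x] that XY by auto
      have eqs: "icell s2 ''A'' = icell s ''A''" "icell s2 ''lg'' = icell s ''lg''" "icell s2 ''pw'' = icell s ''pw''"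
        "icell s2 ''row'' = icell s ''row''" "icell s2 ''T'' = icell s ''T''" "rcell s2 X = rcell s X" "rcell s2 Y = rcell s Y"
        "rcell s2 ''g'' = rcell s ''g''" "rcell s2 ''delta'' = rcell s ''delta''"
        using G1 G2 by simp_all
      have "pair_stack s2 \<noteq> []" using step(2) by (simp add: pair_stack_def)
      then obtain qs q where st: "pair_stack s2 = qs @ [q]" by (metis rev_exhaust)
      have q: "valid q" using step(1) st by (simp add: pair_inv_def)
      have "wp (pair_step X D Y E) (\<lambda>s'. pair_stack s' = qs @ children q \<and>
          rcell s' ''L'' 0 = new_ratio dY q (rcell s2 ''L'' 0)) s2"
      proof (rule wp_pair_step[OF _ tabs(2) _ _ _ _ _ _ _ st q])
        show "has_log_tables s2 M" "has_sparse_table s2 (n - 1)"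
          using tabs eqs by (simp_all add: has_log_tables_def has_sparse_table_def has_sparse_row_def)
      qed (use h dst dY \<delta> XY in \<open>simp_all add: eqs\<close>)
      then show ?case
      proof (rule runs_wp[OF wp_mono order_refl])
        fix s' assume *: "pair_stack s' = qs @ children q \<and> rcell s' ''L'' 0 = new_ratio dY q (rcell s2 ''L'' 0)"
        have "pair_inv dY (qs @ children q) (new_ratio dY q (rcell s2 ''L'' 0))"
          using step(1) unfolding st by (rule pair_inv_step) (rule pos)
        moreover have "calls q = 1 + sum_list (map calls (children q))" by (rule calls.simps)
        ultimately show "pair_inv dY (pair_stack s') (rcell s' ''L'' 0) \<and>
            sum_list (map calls (pair_stack s')) < sum_list (map calls (pair_stack s2))"
          using * st by simp
      qed
    next
      case (exit s2)
      then have "pair_stack s2 = []" by (simp add: pair_stack_def)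
      then show ?case using exit(1) by (auto simp: pair_inv_def)
    next
      case time
      show ?case using loop(1) by (simp add: algebra_simps)
    qed
  next
    case cost
    have "45 + (?c + 1) * (?K + 5) \<le> (?c + 1) * 45 + (?c + 1) * (?K + 5)" by simp
    also have "\<dots> = (?c + 1) * (?K + 50)" by (simp add: algebra_simps)
    finally show ?case .
  qed
qed

end

section \<open>Estimating a Lipschitz constant\<close>

definition iota :: com where
  "iota = ''i'' :=\<^sub>i IConst 0 ;;
     While (ILess (iscalar ''i'') (iscalar ''N''))
       (IAssign ''A'' (iscalar ''i'') (iscalar ''i'') ;; ''i'' :=\<^sub>i IAdd (iscalar ''i'') (IConst 1))"

definition ranks :: com where
  "ranks = ''i'' :=\<^sub>i IConst 0 ;;
     While (ILess (iscalar ''i'') (iscalar ''N''))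
       (IAssign ''R'' (IGet ''A'' (iscalar ''i'')) (iscalar ''i'') ;;
        ''i'' :=\<^sub>i IAdd (iscalar ''i'') (IConst 1))"

definition value_compare :: "string \<Rightarrow> com" where
  "value_compare X =
     Cond (RLess (RGet X (iscalar ''y'')) (RGet X (iscalar ''x''))) (''c'' :=\<^sub>i IConst 0) (''c'' :=\<^sub>i IConst 1)"

definition coordinate_tree :: "string \<Rightarrow> nat \<Rightarrow> com" where
  "coordinate_tree X D =
     ''N'' :=\<^sub>i imult D (iscalar ''n'') ;; iota ;; merge_sort (value_compare X) ;; ranks ;; fair_split X ;;
     ''N'' :=\<^sub>i ISub (iscalar ''N'') (IConst 1) ;; sparse_table"

definition zsort :: "nat \<Rightarrow> com" where
  "zsort D = ''N'' :=\<^sub>i iscalar ''n'' ;; iota ;; merge_sort (zcompare D)"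

definition gap_step :: "nat \<Rightarrow> com" where
  "gap_step D =
     (''x'' :=\<^sub>i IGet ''A'' (iscalar ''i'') ;; ''y'' :=\<^sub>i IGet ''A'' (IAdd (iscalar ''i'') (IConst 1))) ;;
     zcompare D ;;
     RAssign ''h'' (iscalar ''i'') (rscalar ''best'') ;;
     Cond (RLess (RConst 0) (rscalar ''best'')) Skip (''infinite'' :=\<^sub>i IConst 1) ;;
     ''i'' :=\<^sub>i IAdd (iscalar ''i'') (IConst 1)"

text \<open>The levels go to \<open>h\<close> first, because comparisons still query the weights in
  \<open>g\<close>. Afterwards they replace \<open>g\<close> and the table is rebuilt, so that the
  same query code serves the gaps between consecutive points.\<close>

definition gaps :: "nat \<Rightarrow> com" where
  "gaps D =
     ''i'' :=\<^sub>i IConst 0 ;;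
     While (ILess (IAdd (iscalar ''i'') (IConst 1)) (iscalar ''n'')) (gap_step D) ;;
     ''i'' :=\<^sub>i IConst 0 ;;
     While (ILess (IAdd (iscalar ''i'') (IConst 1)) (iscalar ''n''))
       (RAssign ''g'' (iscalar ''i'') (RGet ''h'' (iscalar ''i'')) ;; ''i'' :=\<^sub>i IAdd (iscalar ''i'') (IConst 1)) ;;
     ''N'' :=\<^sub>i ISub (iscalar ''n'') (IConst 1) ;; sparse_table"

text \<open>Coinciding points show up as a gap of level 0 and are reported beforehand, since the
  enumeration of pairs rests on positive gaps.\<close>

definition lipschitz :: "string \<Rightarrow> nat \<Rightarrow> string \<Rightarrow> nat \<Rightarrow> com" where
  "lipschitz X D Y E =
     coordinate_tree X D ;; zsort D ;; gaps D ;;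
     ''delta'' :=\<^sub>r RDiv (rscalar ''eps'') (RConst (24 * int D)) ;;
     Cond (ILess (IConst 0) (iscalar ''infinite'')) Skip (pair_loop X D Y E)"

lemma writes_iota [simp]: "iwrites iota = {''i'', ''A''}" "rwrites iota = {}"
  and writes_ranks [simp]: "iwrites ranks = {''i'', ''R''}" "rwrites ranks = {}"
  and writes_value_compare [simp]: "iwrites (value_compare X) = {''c''}" "rwrites (value_compare X) = {}"
  and writes_sparse_table [simp]: "iwrites sparse_table = {''i'', ''l'', ''row'', ''T'', ''y'', ''z''}" "rwrites sparse_table = {}"
  and writes_fair_split [simp]:
    "iwrites (fair_split X) = {''a'', ''t'', ''S'', ''b'', ''lo'', ''hi'', ''q''}" "rwrites (fair_split X) = {''mid'', ''g''}"
  by (auto simp: iota_def ranks_def value_compare_def sparse_table_def sparse_row_def sparse_cell_def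
      fair_split_def bisect_def)

lemma icost_imult [simp]: "icost (imult d e) = 1 + d * (1 + icost e)"
  by (induction d) auto

lemma runs_iota:
  assumes "icell s ''N'' 0 = N"
  shows "runs iota s (50 * (N + 1)) (\<lambda>s'. icell s' ''A'' ` {..<N} = {..<N})"
  unfolding iota_def
proof (rule runs_seq_wp[where Y = "40 * (N + 1)"], unfold wp.simps,
    rule runs_while[where T = 20 and \<mu> = "\<lambda>s'. N - icell s' ''i'' 0" and
      I = "\<lambda>s'. icell s' ''i'' 0 \<le> N \<and> (\<forall>i<icell s' ''i'' 0. icell s' ''A'' i = i)"], goal_cases init step exit time cost)
  case (step s')
  have "icell s' ''N'' 0 = N" using frame_icell[OF step(3), of "''N''"] assms by simp
  then show ?case using step by (intro runs_wp) auto
next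
  case (exit s')
  have "icell s' ''N'' 0 = N" using frame_icell[OF exit(3), of "''N''"] assms by simp
  then have "icell s' ''A'' i = i" if "i < N" for i using exit that by auto
  then show ?case by (simp add: image_def)
qed auto

lemma inj_on_perm: "A ` {..<N} = {..<N} \<Longrightarrow> inj_on A {..<N::nat}"
  by (rule eq_card_imp_inj_on) auto

lemma runs_ranks:
  assumes N: "icell s ''N'' 0 = N" and A: "icell s ''A'' ` {..<N} = {..<N}"
  shows "runs ranks s (60 * (N + 1)) (\<lambda>s'. \<forall>i<N. icell s' ''R'' (icell s ''A'' i) = i)"
  unfolding ranks_def
proof (rule runs_seq_wp[where Y = "50 * (N + 1)"], unfold wp.simps,
    rule runs_while[where T = 30 and \<mu> = "\<lambda>s'. N - icell s' ''i'' 0" and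
      I = "\<lambda>s'. icell s' ''i'' 0 \<le> N \<and> (\<forall>i<icell s' ''i'' 0. icell s' ''R'' (icell s ''A'' i) = i)"],
    goal_cases init step exit time cost)
  case (step s')
  have N': "icell s' ''N'' 0 = N" "icell s' ''A'' = icell s ''A''"
    using frame_icell[OF step(3), of "''N''"] frame_icell[OF step(3), of "''A''"] N by simp_all
  have "icell s ''A'' i \<noteq> icell s ''A'' (icell s' ''i'' 0)" if "i < icell s' ''i'' 0" for i
    using inj_on_perm[OF A] that step(2) N' by (auto simp: inj_on_def)
  then show ?case using step N' by (intro runs_wp) (auto simp: less_Suc_eq)
next
  case (exit s')
  have "icell s' ''N'' 0 = N" using frame_icell[OF exit(3), of "''N''"] N by simp
  then show ?case using exit by auto
qed auto

section \<open>The coordinate tree\<close>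

text \<open>The sorted sequence \<open>x\<close> is ghost data: the array \<open>A\<close> is soon
  reused for sorting the points. The store only keeps the positions in \<open>R\<close>, the weights
  in \<open>g\<close> and the table; \<open>D * n\<close> values have \<open>D * n - 1\<close>
  gaps.\<close>

definition coordinate_tree_of :: "store \<Rightarrow> nat \<Rightarrow> nat \<Rightarrow> (nat \<Rightarrow> real) \<Rightarrow> (nat \<Rightarrow> real) \<Rightarrow> (nat \<Rightarrow> nat \<Rightarrow> nat) \<Rightarrow> bool" where
  "coordinate_tree_of s D n X x rk \<longleftrightarrow>
     fair x (rcell s ''g'') 0 (D * n - 1) \<and> (\<forall>i k. i \<le> k \<longrightarrow> k < D * n \<longrightarrow> x i \<le> x k) \<and>
     has_sparse_table s (D * n - 1) \<and> (\<forall>p j. rk p j = icell s ''R'' (D * p + j)) \<and>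
     (\<forall>p<n. \<forall>j<D. rk p j < D * n \<and> x (rk p j) = X (D * p + j))"

lemma runs_coordinate_tree:
  assumes tabs: "has_log_tables s M" "D * n \<le> M" and n: "icell s ''n'' 0 = n" "2 \<le> n" and D: "0 < D"
    and X: "X \<in> {''P'', ''fP''}"
  shows "runs (coordinate_tree X D) s ((2000 + D) * (D * n * (floor_log (D * n) + 2)))
    (\<lambda>s'. \<exists>x rk. coordinate_tree_of s' D n (rcell s X) x rk)"
proof -
  define N where "N = D * n"
  define W where "W = N * (floor_log N + 2)"
  have N: "2 \<le> N" "N \<le> M" using n D tabs mult_le_mono[of 1 D 2 n] by (auto simp: N_def)
  have W: "N \<le> W" "4 \<le> W" using N mult_le_mono[of 2 N 2 "floor_log N + 2"] by (auto simp: W_def)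
  let ?Xa = "rcell s X"
  have inj: "False" if "X \<in> {''mid'', ''g''}" using that X by auto
  have "runs (coordinate_tree X D) s ((2000 + D) * W) (\<lambda>s'. \<exists>x rk. coordinate_tree_of s' D n ?Xa x rk)"
    unfolding coordinate_tree_def
  proof (rule runs_seq_wp[where Y = "1900 * W"], unfold wp.simps,
      rule runs_seq[OF runs_iota[where N = N], where Y = "1800 * W"], goal_cases N sort cost1 cost2)
    case N
    show ?case using n by (simp add: N_def)
  next
    case (sort s1)
    have s1: "has_log_tables s1 M" "icell s1 ''N'' 0 = N" "icell s1 ''n'' 0 = n" "rcell s1 = rcell s"
      using sort(2) tabs n by (auto simp: frame_def has_log_tables_def N_def)
    have cmp: "wp (value_compare X) (\<lambda>t. (icell t ''c'' 0 \<noteq> 0) = (?Xa (icell s' ''x'' 0) \<le> ?Xa (icell s' ''y'' 0))) s'"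
      if "frame (merge_sort (value_compare X)) s1 s'" for s'
    proof -
      have "rcell s' = rcell s1" using that by (auto simp: frame_def rwrites_merge_sort)
      then show ?thesis using s1 by (simp add: value_compare_def)
    qed
    show ?case
    proof (rule runs_seq[OF runs_merge_sort[where N = N and le = "\<lambda>p q. ?Xa p \<le> ?Xa q"], where Y = "1200 * W"],
        goal_cases tot trans A N N0 cmp disj ranks cost)
      case (cmp s')
      then show ?case using \<open>\<And>s'. frame (merge_sort (value_compare X)) s1 s' \<Longrightarrow> _\<close> by blast
    next
      case (ranks s2)
      have s2: "has_log_tables s2 M" "icell s2 ''N'' 0 = N" "icell s2 ''n'' 0 = n" "rcell s2 = rcell s"
        using ranks(2) s1 by (auto simp: frame_def has_log_tables_def iwrites_merge_sort rwrites_merge_sort)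
      let ?A = "icell s2 ''A''"
      define x where "x i = ?Xa (?A i)" for i
      have mono: "x i \<le> x k" if "i \<le> k" "k < N" for i k
        using ranks(1) that by (cases "i = k") (auto simp: x_def)
      show ?case
      proof (rule runs_seq[OF runs_ranks[where N = N], where Y = "1000 * W"], goal_cases N A split cost)
        case (split s3)
        have s3: "has_log_tables s3 M" "icell s3 ''N'' 0 = N" "rcell s3 = rcell s" "icell s3 ''A'' = ?A"
          using split(2) s2 by (auto simp: frame_def has_log_tables_def)
        show ?case
        proof (rule runs_seq[OF runs_fair_split[where N = N and M = M and x = x], where Y = "400 * W"],
            goal_cases tabs NM N N0 x mono X1 X2 sparse cost)
          case (sparse s4)
          have s4: "has_log_tables s4 M" "icell s4 ''N'' 0 = N" "icell s4 ''R'' = icell s3 ''R''"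
            using sparse(2) s3 by (auto simp: frame_def has_log_tables_def)
          have tabs4: "has_log_tables (iupd ''N'' 0 (N - 1) s4) M" using s4(1) by (simp add: has_log_tables_def)
          have cost4: "350 * (N - 1) * (floor_log (N - 1) + 1) \<le> 350 * W"
            unfolding W_def mult.assoc by (intro mult_le_mono2 mult_le_mono add_mono floor_log_le_iff) auto
          show ?case
          proof (rule runs_seq_wp[where Y = "350 * W"], unfold wp.simps,
              rule runs_conseq[OF runs_sparse_table[where N = "N - 1" and M = M]], goal_cases tabs NM N N0 post cost1 cost2)
            case (post s5)
            have s5: "rcell s5 ''g'' = rcell s4 ''g''" "icell s5 ''R'' = icell s3 ''R''"
              using post(2) s4(3) by (auto simp: frame_def)
            have rk: "icell s5 ''R'' (D * p + j) < N \<and> x (icell s5 ''R'' (D * p + j)) = ?Xa (D * p + j)"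
              if pj: "p < n" "j < D" for p j
            proof -
              have "D * p + j < D * Suc p" using pj by simp
              also have "\<dots> \<le> N" unfolding N_def using pj by (intro mult_le_mono2) simp
              finally have "D * p + j \<in> ?A ` {..<N}" using ranks(1) by simp
              then obtain i where "i < N" "?A i = D * p + j" by auto
              then show ?thesis using split(1) s5(2) by (auto simp: x_def)
            qed
            have "coordinate_tree_of s5 D n ?Xa x (\<lambda>p j. icell s5 ''R'' (D * p + j))"
              using sparse(1) post(1) mono rk s5 by (simp add: coordinate_tree_of_def N_def)
            then show ?case by blast
          qed (use N s4 tabs4 cost4 W in auto)
        next
          case x
          then show ?case using s3 by (simp add: x_def)
        qed (use s3 N mono inj W in \<open>auto simp: W_def\<close>)
      qed (use s2 ranks(1) N W in auto)
    qed (use sort(1) s1 N W in \<open>auto simp: value_compare_def sort_scratch_def W_def\<close>)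
  next
    case cost2
    have "D * 3 \<le> D * W" using W(2) by (intro mult_le_mono2) simp
    then have "3 + D * 3 \<le> D * W + W * 100" using W(2) by linarith
    then show ?case by (simp add: algebra_simps)
  qed (use N W in auto)
  then show ?thesis by (simp add: W_def N_def)
qed

lemma coordinate_tree_of_cong:
  assumes eq: "icell s' ''R'' = icell s ''R''" "icell s' ''row'' = icell s ''row''" "icell s' ''T'' = icell s ''T''"
    "rcell s' ''g'' = rcell s ''g''" and tree: "coordinate_tree_of s D n X x rk"
  shows "coordinate_tree_of s' D n X x rk"
  unfolding coordinate_tree_of_def has_sparse_table_cong[OF eq(2,3,4)] eq
  by (rule tree[unfolded coordinate_tree_of_def])

lemma wp_zcompare_tree:
  assumes tree: "coordinate_tree_of s D n X x rk" and tabs: "has_log_tables s M" "D * n \<le> M" and D: "0 < D"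
    and pq: "icell s ''x'' 0 < n" "icell s ''y'' 0 < n"
  shows "wp (zcompare D) (\<lambda>s'. (icell s' ''c'' 0 \<noteq> 0) = zle D (rcell s ''g'') rk (icell s ''x'' 0) (icell s ''y'' 0) \<and>
    rcell s' ''best'' 0 = level D (rcell s ''g'') rk (icell s ''x'' 0) (icell s ''y'' 0)) s"
proof (rule wp_zcompare[OF tabs(1), where N = "D * n - 1"])
  have fair: "fair x (rcell s ''g'') 0 (D * n - 1)" and mono: "\<And>i k. i \<le> k \<Longrightarrow> k < D * n \<Longrightarrow> x i \<le> x k"
    using tree unfolding coordinate_tree_of_def by blast+
  have pos: "0 < D * n" using D pq by simp
  show "0 \<le> rcell s ''g'' i" if "i < D * n - 1" for i
    by (rule fair_nonneg[OF fair]) (use mono that pos in auto)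
  show "D * n - 1 \<le> M" using tabs(2) by simp
  show "has_sparse_table s (D * n - 1)" "\<And>p j. rk p j = icell s ''R'' (D * p + j)"
    using tree unfolding coordinate_tree_of_def by blast+
  fix j assume "j < D"
  then have "rk (icell s ''x'' 0) j < D * n" "rk (icell s ''y'' 0) j < D * n"
    using tree pq unfolding coordinate_tree_of_def by blast+
  then show "rk (icell s ''x'' 0) j \<le> D * n - 1 \<and> rk (icell s ''y'' 0) j \<le> D * n - 1" by linarith
qed (use D in auto)

section \<open>Sorting the points and finding the gaps\<close>

text \<open>Sorting leaves the positions, the weights and the tables alone, so every comparison sees
  the same coordinate tree and takes constant time.\<close>

lemma runs_zsort:
  assumes tree: "coordinate_tree_of s D n X x rk" and tabs: "has_log_tables s M" "D * n \<le> M" and D: "0 < D"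
    and n: "icell s ''n'' 0 = n" "2 \<le> n"
  shows "runs (zsort D) s ((2 * ccost (zcompare D) + 600) * (n * (floor_log n + 2)))
    (\<lambda>s'. icell s' ''A'' ` {..<n} = {..<n} \<and>
       (\<forall>p q. p < q \<longrightarrow> q < n \<longrightarrow> zle D (rcell s ''g'') rk (icell s' ''A'' p) (icell s' ''A'' q)))"
proof -
  define W where "W = n * (floor_log n + 2)"
  have W: "n \<le> W" "4 \<le> W" using n(2) mult_le_mono[of 2 n 2 "floor_log n + 2"] by (auto simp: W_def)
  let ?K = "ccost (zcompare D)"
  have iw: "a \<notin> iwrites (zcompare D)" if "a \<in> {''R'', ''row'', ''T'', ''lg'', ''pw'', ''A'', ''B'', ''N'', ''w'', ''k'', ''e'', ''i'', ''j'', ''d''}" for a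
    using iwrites_zcompare_coords[of D D] that by auto
  have rw: "''g'' \<notin> rwrites (zcompare D)" using rwrites_zcompare_coords[of D D] by auto
  have "runs (zsort D) s ((2 * ?K + 600) * W)
    (\<lambda>s'. icell s' ''A'' ` {..<n} = {..<n} \<and>
       (\<forall>p q. p < q \<longrightarrow> q < n \<longrightarrow> zle D (rcell s ''g'') rk (icell s' ''A'' p) (icell s' ''A'' q)))"
    unfolding zsort_def
  proof (rule runs_seq_wp[where Y = "(2 * ?K + 590) * W"], unfold wp.simps,
      rule runs_seq[OF runs_iota[where N = n], where Y = "(2 * ?K + 420) * W"], goal_cases N sort cost1 cost2)
    case N
    show ?case using n by simp
  next
    case (sort s1)
    have s1: "icell s1 ''N'' 0 = n" "rcell s1 ''g'' = rcell s ''g''" "has_log_tables s1 M"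
      using sort(2) tabs n by (auto simp: frame_def has_log_tables_def)
    have tree1: "coordinate_tree_of s1 D n X x rk"
      by (rule coordinate_tree_of_cong[OF _ _ _ _ tree]) (use sort(2) in \<open>auto simp: frame_def\<close>)
    show ?case unfolding W_def
    proof (rule runs_merge_sort)
      show "zle D (rcell s ''g'') rk p q \<or> zle D (rcell s ''g'') rk q p" for p q using D by (rule zle_total)
      show "zle D (rcell s ''g'') rk p q \<Longrightarrow> zle D (rcell s ''g'') rk q r \<Longrightarrow> zle D (rcell s ''g'') rk p r" for p q r
        using zle_trans_level by blast
      show "icell s1 ''A'' ` {..<n} = {..<n}" "icell s1 ''N'' 0 = n" "0 < n" using sort(1) s1 n by auto
      show "iwrites (zcompare D) \<inter> sort_scratch = {}" using iw by (auto simp: sort_scratch_def)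
      fix s' assume fr: "frame (merge_sort (zcompare D)) s1 s'" and xy: "icell s' ''x'' 0 < n" "icell s' ''y'' 0 < n"
      have I: "icell s' a = icell s1 a" if "a \<in> {''R'', ''row'', ''T'', ''lg'', ''pw''}" for a
        by (rule frame_icell[OF fr]) (use iw[of a] that in \<open>auto simp: iwrites_merge_sort\<close>)
      have G: "rcell s' ''g'' = rcell s1 ''g''"
        by (rule frame_rcell[OF fr]) (use rw in \<open>auto simp: rwrites_merge_sort\<close>)
      have "coordinate_tree_of s' D n X x rk" "has_log_tables s' M"
        by (rule coordinate_tree_of_cong[OF _ _ _ _ tree1]; simp add: I G)
          (use s1(3) I in \<open>simp add: has_log_tables_def\<close>)
      from wp_zcompare_tree[OF this tabs(2) D xy]
      show "wp (zcompare D) (\<lambda>t. (icell t ''c'' 0 \<noteq> 0) = zle D (rcell s ''g'') rk (icell s' ''x'' 0) (icell s' ''y'' 0)) s'"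
        by (rule wp_mono) (simp add: G s1)
    qed
  qed (use W in \<open>auto simp: algebra_simps\<close>)
  then show ?thesis by (simp add: W_def)
qed

lemma runs_gaps:
  assumes tree: "coordinate_tree_of s D n X x rk" and tabs: "has_log_tables s M" "D * n \<le> M" and D: "0 < D"
    and n: "icell s ''n'' 0 = n" "2 \<le> n" and A: "icell s ''A'' ` {..<n} = {..<n}" and inf: "icell s ''infinite'' 0 = 0"
  defines "lev \<equiv> \<lambda>i. level D (rcell s ''g'') rk (icell s ''A'' i) (icell s ''A'' (Suc i))"
  shows "runs (gaps D) s ((2 * ccost (zcompare D) + 700) * (n * (floor_log n + 2)))
    (\<lambda>s'. (\<forall>i. Suc i < n \<longrightarrow> rcell s' ''g'' i = lev i) \<and> has_sparse_table s' (n - 1) \<and>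
       (icell s' ''infinite'' 0 = 0 \<longleftrightarrow> (\<forall>i. Suc i < n \<longrightarrow> 0 < lev i)))"
proof -
  define W where "W = n * (floor_log n + 2)"
  have W: "n \<le> W" "4 \<le> W" using n(2) mult_le_mono[of 2 n 2 "floor_log n + 2"] by (auto simp: W_def)
  let ?K = "ccost (zcompare D)"
  have iw: "a \<notin> iwrites (zcompare D)" if "a \<in> {''R'', ''row'', ''T'', ''lg'', ''pw'', ''A'', ''n'', ''i'', ''infinite''}" for a
    using iwrites_zcompare_coords[of D D] that by auto
  have rw: "a \<notin> rwrites (zcompare D)" if "a \<in> {''g'', ''h''}" for a using rwrites_zcompare_coords[of D D] that by auto
  have An: "icell s ''A'' i < n" if "i < n" for i using A that by blast
  define Inv where "Inv s' \<longleftrightarrow> icell s' ''i'' 0 < n \<and> (\<forall>i<icell s' ''i'' 0. rcell s' ''h'' i = lev i) \<and>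
      (icell s' ''infinite'' 0 = 0 \<longleftrightarrow> (\<forall>i<icell s' ''i'' 0. 0 < lev i))" for s' :: store
  have "runs (gaps D) s ((2 * ?K + 700) * W)
    (\<lambda>s'. (\<forall>i. Suc i < n \<longrightarrow> rcell s' ''g'' i = lev i) \<and> has_sparse_table s' (n - 1) \<and>
       (icell s' ''infinite'' 0 = 0 \<longleftrightarrow> (\<forall>i. Suc i < n \<longrightarrow> 0 < lev i)))"
    unfolding gaps_def
  proof (rule runs_seq_wp[where Y = "(2 * ?K + 690) * W"], unfold wp.simps,
      rule runs_seq[where X = "(?K + 80) * n" and Y = "550 * W" and
        R = "\<lambda>s1. (\<forall>i. Suc i < n \<longrightarrow> rcell s1 ''h'' i = lev i) \<and>
          (icell s1 ''infinite'' 0 = 0 \<longleftrightarrow> (\<forall>i. Suc i < n \<longrightarrow> 0 < lev i)) \<and>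
          icell s1 ''n'' 0 = n \<and> has_log_tables s1 M"],
      rule runs_while[where T = "?K + 50" and I = Inv and \<mu> = "\<lambda>s'. n - 1 - icell s' ''i'' 0"],
      goal_cases init step exit time copy cost1 cost2)
    case init
    show ?case using n inf by (simp add: Inv_def)
  next
    case (step s1)
    have I: "icell s1 a = icell s a" if "a \<in> {''R'', ''row'', ''T'', ''lg'', ''pw'', ''A'', ''n''}" for a
      using frame_icell[OF step(3), of a] iw[of a] that by (auto simp: gap_step_def)
    have G: "rcell s1 ''g'' = rcell s ''g''"
      using frame_rcell[OF step(3), of "''g''"] rw[of "''g''"] by (auto simp: gap_step_def)
    let ?i = "icell s1 ''i'' 0"
    have i: "Suc ?i < n" using step(2) I n by simp
    define z where "z = iupd ''y'' 0 (icell s ''A'' (Suc ?i)) (iupd ''x'' 0 (icell s ''A'' ?i) s1)"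
    have z: "icell z ''x'' 0 = icell s ''A'' ?i" "icell z ''y'' 0 = icell s ''A'' (Suc ?i)" "rcell z = rcell s1"
      "\<And>a. a \<notin> {''x'', ''y''} \<Longrightarrow> icell z a = icell s1 a" by (auto simp: z_def)
    have "coordinate_tree_of z D n X x rk"
      by (rule coordinate_tree_of_cong[OF _ _ _ _ tree]) (simp_all add: z I G)
    moreover have "has_log_tables z M" using tabs(1) by (simp add: has_log_tables_def z I)
    ultimately have "wp (zcompare D) (\<lambda>s'. (icell s' ''c'' 0 \<noteq> 0) = zle D (rcell z ''g'') rk (icell z ''x'' 0) (icell z ''y'' 0) \<and>
        rcell s' ''best'' 0 = level D (rcell z ''g'') rk (icell z ''x'' 0) (icell z ''y'' 0)) z"
      by (rule wp_zcompare_tree[OF _ _ tabs(2) D]) (use An i z in auto)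
    then have best: "wp (zcompare D) (\<lambda>s'. rcell s' ''best'' 0 = lev ?i) z"
      by (rule wp_mono) (simp add: z G lev_def)
    show ?case
    proof (rule runs_wp)
      show "wp (gap_step D) (\<lambda>s2. Inv s2 \<and> n - 1 - icell s2 ''i'' 0 < n - 1 - icell s1 ''i'' 0) s1"
        unfolding gap_step_def
      proof (rule wp_seq[where R = "\<lambda>s'. s' = z"], goal_cases load cmp)
        case load
        show ?case using I by (simp add: z_def)
      next
        case (cmp s2)
        show ?case unfolding cmp(1)
        proof (rule wp_seq[OF best], goal_cases store)
          case (store s3)
          have "icell s3 ''i'' = icell s1 ''i''" "icell s3 ''infinite'' = icell s1 ''infinite''" "rcell s3 ''h'' = rcell s1 ''h''"
            using frame_icell[OF store(2), of "''i''"] frame_icell[OF store(2), of "''infinite''"]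
              frame_rcell[OF store(2), of "''h''"] iw rw z by auto
          then show ?case using store(1) step(1) i by (auto simp: Inv_def less_Suc_eq)
        qed
      qed
    qed (simp add: gap_step_def)
  next
    case (exit s1)
    have I: "icell s1 a = icell s a" if "a \<in> {''lg'', ''pw'', ''n''}" for a
      using frame_icell[OF exit(3), of a] iw[of a] that by (auto simp: gap_step_def)
    have "Suc (icell s1 ''i'' 0) = n" using exit(1,2) n(1) I by (simp add: Inv_def)
    then show ?case using exit(1) n(1) I tabs(1) by (auto simp: Inv_def has_log_tables_def)
  next
    case time
    have "n - 1 + 1 = n" using n by simp
    then show ?case by simp
  next
    case (copy s1)
    show ?case
    proof (rule runs_seq_wp[where Y = "540 * W"], unfold wp.simps,
        rule runs_seq[where X = "50 * n" and Y = "400 * W" and R = "\<lambda>s2. \<forall>i. Suc i < n \<longrightarrow> rcell s2 ''g'' i = lev i"],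
        rule runs_while[where T = 30 and \<mu> = "\<lambda>s'. n - 1 - icell s' ''i'' 0" and
          I = "\<lambda>s2. icell s2 ''i'' 0 < n \<and> (\<forall>i<icell s2 ''i'' 0. rcell s2 ''g'' i = lev i)"],
        goal_cases init step exit time table cost1 cost2)
      case init
      show ?case using n by simp
    next
      case (step s2)
      have "icell s2 ''n'' 0 = n" "rcell s2 ''h'' = rcell s1 ''h''"
        using frame_icell[OF step(3), of "''n''"] frame_rcell[OF step(3), of "''h''"] copy(1) by auto
      then show ?case using step(1,2) copy(1) by (intro runs_wp) (auto simp: less_Suc_eq)
    next
      case (exit s2)
      have "icell s2 ''n'' 0 = n" using frame_icell[OF exit(3), of "''n''"] copy(1) by auto
      then have "Suc (icell s2 ''i'' 0) = n" using exit(1,2) by simp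
      then show ?case using exit(1) by auto
    next
      case time
      have "n - 1 + 1 = n" using n by simp
      then show ?case by simp
    next
      case (table s2)
      have s2: "icell s2 ''n'' 0 = n" "has_log_tables s2 M" "icell s2 ''infinite'' = icell s1 ''infinite''"
        using table(2) copy(1) by (auto simp: frame_def has_log_tables_def)
      have M: "n - 1 \<le> M" proof -
        have "n \<le> D * n" using D by simp
        then show ?thesis using tabs(2) by linarith
      qed
      have cost: "350 * (n - 1) * (floor_log (n - 1) + 1) \<le> 350 * W"
        unfolding W_def mult.assoc by (intro mult_le_mono2 mult_le_mono add_mono floor_log_le_iff) auto
      show ?case
      proof (rule runs_seq_wp[where Y = "350 * W"], unfold wp.simps,
          rule runs_conseq[OF runs_sparse_table[where N = "n - 1" and M = M]], goal_cases tabs NM N N0 post cost1 cost2)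
        case (post s3)
        have "rcell s3 ''g'' = rcell s2 ''g''" "icell s3 ''infinite'' = icell s2 ''infinite''"
          using post(2) by (auto simp: frame_def)
        then show ?case using post(1) table(1) copy(1) s2 by simp
      qed (use s2 M n cost W in \<open>auto simp: has_log_tables_def\<close>)
    qed (use n W in auto)
  next
    case cost1
    have "(?K + 80) * n \<le> (?K + 80) * W" using W by (intro mult_le_mono2) simp
    then show ?case by (simp add: algebra_simps)
  qed (use n W in \<open>auto simp: algebra_simps\<close>)
  then show ?thesis by (simp add: W_def)
qed

section \<open>Accuracy of the representatives\<close>

lemma array_dist_nonneg [simp]: "0 \<le> array_dist X D p q"
  by (simp add: array_dist_def)

lemma array_dist_same [simp]: "array_dist X D p p = 0"
  by (simp add: array_dist_def L2_set_def)

lemma array_dist_commute: "array_dist X D p q = array_dist X D q p"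
  by (simp add: array_dist_def L2_set_def power2_commute)

lemma array_dist_triangle: "array_dist X D p r \<le> array_dist X D p q + array_dist X D q r"
proof -
  have "array_dist X D p r = L2_set (\<lambda>j. (X (D * p + j) - X (D * q + j)) + (X (D * q + j) - X (D * r + j))) {..<D}"
    by (simp add: array_dist_def)
  also have "\<dots> \<le> array_dist X D p q + array_dist X D q r"
    unfolding array_dist_def by (rule L2_set_triangle_ineq)
  finally show ?thesis .
qed

lemma coord_le_array_dist: "j < D \<Longrightarrow> \<bar>X (D * p + j) - X (D * q + j)\<bar> \<le> array_dist X D p q"
  using member_le_L2_set[of "{..<D}" j "\<lambda>j. \<bar>X (D * p + j) - X (D * q + j)\<bar>"]
  by (simp add: array_dist_def L2_set_def)

text \<open>If \<open>M\<close> is the true Lipschitz constant, attained at \<open>i\<close> and \<open>k\<close>, and \<open>a\<close>, \<open>c\<close> represent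
  this pair, then moving from the pair to its representatives costs at most
  \<open>M * (dX a i + dX c k)\<close>, a small fraction of \<open>M * dX a c\<close>.\<close>

lemma lipschitz_estimate:
  fixes dX dY :: "nat \<Rightarrow> nat \<Rightarrow> real" and D :: real
  assumes dX: "\<And>p q r. dX p r \<le> dX p q + dX q r" "\<And>p q. dX p q = dX q p"
      "\<And>p q. p < n \<Longrightarrow> q < n \<Longrightarrow> p \<noteq> q \<Longrightarrow> 0 < dX p q"
    and dY: "\<And>p q r. dY p r \<le> dY p q + dY q r" "\<And>p q. dY p q = dY q p" "\<And>p q. 0 \<le> dY p q" "\<And>p. dY p p = 0"
      "\<And>p. dX p p = 0"
    and near: "\<And>a i. a < n \<Longrightarrow> i < n \<Longrightarrow> dX a i \<le> D * lev a i" and D: "0 < D" and \<epsilon>: "0 < \<epsilon>" "\<epsilon> < 1"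
    and rep: "\<And>i k. i < k \<Longrightarrow> k < n \<Longrightarrow> \<exists>a<n. \<exists>c<n. a \<noteq> c \<and> lev a i \<le> \<epsilon> / (24 * D) * dX a c \<and>
      lev c k \<le> \<epsilon> / (24 * D) * dX a c \<and> dY a c \<le> L * dX a c"
    and pq: "p < n" "q < n"
  shows "dY p q \<le> (1 + \<epsilon> / 3) * L * dX p q"
proof (cases "p = q")
  case True
  then show ?thesis using dY by simp
next
  case False
  define Z where "Z = {(i, k). i < n \<and> k < n \<and> i \<noteq> k}"
  define M where "M = Max ((\<lambda>(i, k). dY i k / dX i k) ` Z)"
  have Z: "finite Z" "Z \<noteq> {}"
    using False pq by (auto simp: Z_def intro: finite_subset[of _ "{..<n} \<times> {..<n}"])
  have "M \<in> (\<lambda>(i, k). dY i k / dX i k) ` Z" unfolding M_def using Z by (intro Max_in) auto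
  then obtain i' k' where ik': "i' < n" "k' < n" "i' \<noteq> k'" "M = dY i' k' / dX i' k'" by (auto simp: Z_def)
  obtain i k where ik: "i < k" "k < n" "M = dY i k / dX i k"
    using ik' dX(2) dY(2) by (metis linorder_neqE_nat)
  have Mge: "dY u v \<le> M * dX u v" if "u < n" "v < n" for u v
  proof (cases "u = v")
    case True
    then show ?thesis using dY by simp
  next
    case False
    then have "dY u v / dX u v \<le> M" unfolding M_def using that Z by (intro Max_ge) (auto simp: Z_def)
    then show ?thesis using dX(3)[OF that False] by (simp add: pos_divide_le_eq)
  qed
  have dik: "0 < dX i k" using dX(3)[of i k] ik by simp
  have M0: "0 \<le> M" using ik(3) dY(3)[of i k] dik by simp
  obtain a c where ac: "a < n" "c < n" "a \<noteq> c" "lev a i \<le> \<epsilon> / (24 * D) * dX a c"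
      "lev c k \<le> \<epsilon> / (24 * D) * dX a c" "dY a c \<le> L * dX a c" using rep[OF ik(1,2)] by blast
  define t where "t = dX a c"
  have t: "0 < t" using dX(3) ac by (simp add: t_def)
  \<comment> \<open>The factor \<open>D\<close> between weights and distances cancels the
    \<open>D\<close> in the threshold.\<close>
  have small: "dX a i \<le> \<epsilon> / 24 * t" "dX c k \<le> \<epsilon> / 24 * t"
  proof -
    have "dX a i \<le> D * (\<epsilon> / (24 * D) * t)"
      using near[of a i] ac ik D mult_left_mono[OF ac(4), of D] by (simp add: t_def)
    then show "dX a i \<le> \<epsilon> / 24 * t" using D by simp
    have "dX c k \<le> D * (\<epsilon> / (24 * D) * t)"
      using near[of c k] ac ik D mult_left_mono[OF ac(5), of D] by (simp add: t_def)
    then show "dX c k \<le> \<epsilon> / 24 * t" using D by simp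
  qed
  have "t \<le> dX i k + \<epsilon> / 12 * t"
    using dX(1)[of a c i] dX(1)[of i c k] dX(2)[of k c] small by (simp add: t_def)
  then have "M * (t - \<epsilon> / 12 * t) \<le> M * dX i k" using M0 by (intro mult_left_mono) auto
  also have "M * dX i k = dY i k" using ik(3) dik by simp
  also have "dY i k \<le> dY a i + dY a c + dY c k"
    using dY(1)[of i k a] dY(1)[of a k c] dY(2)[of i a] by simp
  also have "dY a i + dY a c + dY c k \<le> M * (\<epsilon> / 24 * t) + L * t + M * (\<epsilon> / 24 * t)"
  proof -
    have "i < n" using ik by simp
    then show ?thesis
      using Mge[OF ac(1), of i] Mge[OF ac(2) ik(2)] ac(6) mult_left_mono[OF small(1) M0]
        mult_left_mono[OF small(2) M0] unfolding t_def by linarith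
  qed
  \<comment> \<open>The two displacements of \<epsilon> / 24 enter twice, in the distance of the
    pair and in that of its image, which makes \<epsilon> / 6.\<close>
  finally have "(M * (1 - \<epsilon> / 6)) * t \<le> L * t" by (simp add: algebra_simps)
  then have ratio_le: "M * (1 - \<epsilon> / 6) \<le> L" using t by simp
  have "\<epsilon> * \<epsilon> \<le> \<epsilon>" using \<epsilon> by (simp add: mult_left_le)
  \<comment> \<open>The product is 1 + \<epsilon> / 6 - \<epsilon>^2 / 18.\<close>
  then have "1 \<le> (1 + \<epsilon> / 3) * (1 - \<epsilon> / 6)" using \<epsilon> by (simp add: algebra_simps)
  then have "M * 1 \<le> M * ((1 + \<epsilon> / 3) * (1 - \<epsilon> / 6))" using M0 by (intro mult_left_mono)
  also have "\<dots> = (1 + \<epsilon> / 3) * (M * (1 - \<epsilon> / 6))" by simp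
  also have "\<dots> \<le> (1 + \<epsilon> / 3) * L" using ratio_le \<epsilon> by (intro mult_left_mono) auto
  finally have "M * dX p q \<le> (1 + \<epsilon> / 3) * L * dX p q"
    using dX(3)[OF pq False] by (intro mult_right_mono) auto
  then show ?thesis using Mge[OF pq] by linarith
qed

section \<open>Levels compared with distances\<close>

lemma tree_coord_diff:
  assumes "fair x g 0 (N - 1)" "\<And>i k. i \<le> k \<Longrightarrow> k < N \<Longrightarrow> x i \<le> x k" "i < N" "k < (N::nat)"
  shows "\<bar>x i - x k\<bar> \<le> wmax g i k"
proof (cases "i \<le> k")
  case True
  have "x k - x i \<le> wmax g i k" by (rule fair_diam[OF assms(1)]) (use assms True in auto)
  then show ?thesis using assms(2)[of i k] assms True by simp
next
  case False
  have "x i - x k \<le> wmax g k i" by (rule fair_diam[OF assms(1)]) (use assms False in auto)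
  then show ?thesis using assms(2)[of k i] assms False by (simp add: wmax_commute)
qed

lemma tree_coord_pos:
  assumes fair: "fair x g 0 (N - 1)" and mono: "\<And>i k. i \<le> k \<Longrightarrow> k < N \<Longrightarrow> x i \<le> x k"
    and ik: "i < N" "k < (N::nat)" and pos: "0 < wmax g i k"
  shows "x i \<noteq> x k"
proof -
  obtain m where m: "min i k \<le> m" "m < max i k" "0 < g m"
    using pos wmax_le_iff[of g i k 0] by (auto simp: not_le)
  have "x (min i k) \<le> x m" using m ik by (intro mono) auto
  also have "x m < x (Suc m)" by (rule fair_pos[OF fair]) (use mono m ik in auto)
  also have "x (Suc m) \<le> x (max i k)" using m ik by (intro mono) auto
  finally show ?thesis by (auto simp: min_def max_def split: if_splits)
qed

text \<open>The Euclidean norm is at most the sum of the coordinate differences, each bounded by the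
  level; hence the factor \<open>D\<close>. Conversely, a positive level comes with a positive gap,
  which separates two coordinate values strictly.\<close>

lemma tree_dist_level:
  assumes tree: "coordinate_tree_of s D n X x rk" and pq: "p < n" "q < n"
  shows "array_dist X D p q \<le> real D * level D (rcell s ''g'') rk p q"
    and "0 < level D (rcell s ''g'') rk p q \<Longrightarrow> 0 < array_dist X D p q"
proof -
  let ?g = "rcell s ''g''"
  have fair: "fair x ?g 0 (D * n - 1)" and mono: "\<And>i k. i \<le> k \<Longrightarrow> k < D * n \<Longrightarrow> x i \<le> x k"
    and rk: "\<And>p j. p < n \<Longrightarrow> j < D \<Longrightarrow> rk p j < D * n \<and> x (rk p j) = X (D * p + j)"
    using tree unfolding coordinate_tree_of_def by blast+
  have "array_dist X D p q \<le> (\<Sum>j<D. \<bar>X (D * p + j) - X (D * q + j)\<bar>)"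
    unfolding array_dist_def by (rule L2_set_le_sum_abs)
  also have "\<dots> \<le> (\<Sum>j<D. level D ?g rk p q)"
  proof (rule sum_mono)
    fix j assume "j \<in> {..<D}"
    then have j: "j < D" by simp
    have "\<bar>X (D * p + j) - X (D * q + j)\<bar> \<le> coord_level ?g rk p q j"
      using tree_coord_diff[OF fair mono, of "rk p j" "rk q j"] rk[OF pq(1) j] rk[OF pq(2) j]
      by (simp add: coord_level_def)
    also have "\<dots> \<le> level D ?g rk p q" by (rule coord_level_le_level[OF j])
    finally show "\<bar>X (D * p + j) - X (D * q + j)\<bar> \<le> level D ?g rk p q" .
  qed
  finally show "array_dist X D p q \<le> real D * level D ?g rk p q" by simp
  assume "0 < level D ?g rk p q"
  then obtain j where j: "j < D" "level D ?g rk p q \<le> coord_level ?g rk p q j"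
    using le_level_iff[of "level D ?g rk p q" D ?g rk p q] by auto
  then have "X (D * p + j) \<noteq> X (D * q + j)"
    using tree_coord_pos[OF fair mono, of "rk p j" "rk q j"] rk[OF pq(1) j(1)] rk[OF pq(2) j(1)]
      \<open>0 < level D ?g rk p q\<close> by (simp add: coord_level_def)
  then show "0 < array_dist X D p q" using coord_le_array_dist[OF j(1), of X p q] by linarith
qed

text \<open>The packing hypothesis is \<open>level_packing\<close> with the window
  \<open>W = r / \<delta>\<close>, for which \<open>4 * W / r + 3\<close> no longer depends on
  \<open>r\<close>.\<close>

lemma pair_tree_of_coordinate_tree:
  assumes tree: "coordinate_tree_of s D n X x rk" and n: "0 < n" and \<delta>: "0 < \<delta>"
    and A: "A ` {..<n} = {..<n}"
    and sorted: "\<And>i k. i < k \<Longrightarrow> k < n \<Longrightarrow> zle D (rcell s ''g'') rk (A i) (A k)"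
    and h: "\<And>i. Suc i < n \<Longrightarrow> h i = level D (rcell s ''g'') rk (A i) (A (Suc i))"
    and pos: "\<And>i. Suc i < n \<Longrightarrow> 0 < h i"
  shows "pair_tree n h (\<lambda>i k. array_dist X D (A i) (A k)) \<delta> (nat \<lfloor>(4 / \<delta> + 3) ^ D\<rfloor>)"
    and "\<And>i k. i < n \<Longrightarrow> k < n \<Longrightarrow> array_dist X D (A i) (A k) \<le> real D * wmax h i k"
    and "\<And>i k. i < n \<Longrightarrow> k < n \<Longrightarrow> i \<noteq> k \<Longrightarrow> 0 < array_dist X D (A i) (A k)"
proof -
  let ?g = "rcell s ''g''"
  have fair: "fair x ?g 0 (D * n - 1)" and mono: "\<And>i k. i \<le> k \<Longrightarrow> k < D * n \<Longrightarrow> x i \<le> x k"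
    and rk: "\<And>p j. p < n \<Longrightarrow> j < D \<Longrightarrow> rk p j < D * n \<and> x (rk p j) = X (D * p + j)"
    using tree unfolding coordinate_tree_of_def by blast+
  have An: "A i < n" if "i < n" for i using A that by blast
  have chain: "level D ?g rk (A i) (A k) = wmax h i k" if "i < n" "k < n" for i k
  proof (cases "i \<le> k")
    case True
    show ?thesis
      by (rule level_chain[where n = n]) (use sorted h True that in auto)
  next
    case False
    have "level D ?g rk (A k) (A i) = wmax h k i"
      by (rule level_chain[where n = n]) (use sorted h False that in auto)
    then show ?thesis using level_commute[of D ?g rk "A i"] wmax_commute[of h i] by simp
  qed
  show "array_dist X D (A i) (A k) \<le> real D * wmax h i k" if "i < n" "k < n" for i k
    using tree_dist_level(1)[OF tree An[OF that(1)] An[OF that(2)]] chain[OF that] by simp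
  show "0 < array_dist X D (A i) (A k)" if ik: "i < n" "k < n" "i \<noteq> k" for i k
  proof (rule tree_dist_level(2)[OF tree An[OF ik(1)] An[OF ik(2)]])
    have "0 < wmax h (min i k) (max i k)"
      using ik pos[of "min i k"] wmax_ge[of "min i k" "min i k" "max i k" h] by (auto simp: min_def max_def)
    then show "0 < level D ?g rk (A i) (A k)"
      unfolding chain[OF ik(1,2)] by (simp add: min_def max_def wmax_commute split: if_splits)
  qed
  show "pair_tree n h (\<lambda>i k. array_dist X D (A i) (A k)) \<delta> (nat \<lfloor>(4 / \<delta> + 3) ^ D\<rfloor>)"
  proof
    fix S a r
    assume r: "0 < (r::real)" and S: "S \<subseteq> {..<n}" and a: "a < n"
      and near: "\<And>c. c \<in> S \<Longrightarrow> \<delta> * array_dist X D (A a) (A c) < r"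
      and far: "\<And>c c'. c \<in> S \<Longrightarrow> c' \<in> S \<Longrightarrow> c < c' \<Longrightarrow> r \<le> wmax h c c'"
    have finS: "finite S" using S finite_subset by blast
    have "inj_on A S" using inj_on_perm[OF A] S inj_on_subset by blast
    then have card: "card S = card (A ` S)" by (simp add: card_image)
    have "real (card (A ` S)) \<le> (4 * (r / \<delta>) / r + 3) ^ D"
    proof (rule level_packing[OF fair, where c = "A a"])
      show "x i \<le> x k" if "i \<le> k" "k \<le> D * n - 1" for i k
      proof (cases "0 < D * n")
        case True
        then have "k < D * n" using that by linarith
        then show ?thesis using mono that by blast
      next
        case False
        then show ?thesis using that n by auto
      qed
      fix p q assume "p \<in> A ` S" "q \<in> A ` S" "p \<noteq> q"
      then obtain c c' where c: "c \<in> S" "c' \<in> S" "p = A c" "q = A c'" "c \<noteq> c'" by auto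
      then have "level D ?g rk p q = wmax h c c'" using chain S by auto
      moreover have "r \<le> wmax h c c'"
        using far[of c c'] far[of c' c] c by (metis linorder_neqE_nat wmax_commute)
      ultimately show "r \<le> level D ?g rk p q" by simp
    next
      fix p j assume p: "p \<in> A ` S" and j: "j < D"
      then obtain c where c: "c \<in> S" "p = A c" by auto
      then have pn: "p < n" "A a < n" using S a An by auto
      have "\<bar>x (rk p j) - x (rk (A a) j)\<bar> \<le> array_dist X D (A a) p"
        using coord_le_array_dist[OF j, of X p "A a"] rk[OF pn(1) j] rk[OF pn(2) j] array_dist_commute[of X D p] by simp
      also have "\<dots> \<le> r / \<delta>" using near[OF c(1)] \<delta> c(2) by (simp add: pos_le_divide_eq mult.commute less_imp_le)
      finally show "rk p j \<le> D * n - 1 \<and> \<bar>x (rk p j) - x (rk (A a) j)\<bar> \<le> r / \<delta>"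
        using rk[OF pn(1) j] by auto
    next
      fix j assume "j < D"
      then show "rk (A a) j \<le> D * n - 1" using rk[of "A a" j] An[OF a] by auto
    qed (use finS r \<delta> in auto)
    then have "real (card S) \<le> (4 / \<delta> + 3) ^ D" using r by (simp add: card)
    then show "card S \<le> nat \<lfloor>(4 / \<delta> + 3) ^ D\<rfloor>" by (rule le_nat_floor)
  qed (use n \<delta> pos in \<open>auto simp: array_dist_commute\<close>)
qed

section \<open>Specification and total time of one Lipschitz estimate\<close>

lemma writes_coordinate_tree:
  "iwrites (coordinate_tree X D) \<inter> {''n'', ''lg'', ''pw'', ''infinite''} = {}"
  "rwrites (coordinate_tree X D) = {''mid'', ''g''}"
  by (auto simp: coordinate_tree_def iwrites_merge_sort rwrites_merge_sort)

lemma writes_zsort: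
  "iwrites (zsort D) \<inter> {''n'', ''lg'', ''pw'', ''infinite'', ''R'', ''row'', ''T''} = {}"
  "rwrites (zsort D) \<subseteq> {''best'', ''val''}"
  using iwrites_zcompare_coords[of D D] rwrites_zcompare_coords[of D D]
  by (auto simp: zsort_def iwrites_merge_sort rwrites_merge_sort)

lemma writes_gaps:
  "iwrites (gaps D) \<inter> {''n'', ''lg'', ''pw'', ''A''} = {}"
  "rwrites (gaps D) \<subseteq> {''best'', ''val'', ''h'', ''g''}"
  using iwrites_zcompare_coords[of D D] rwrites_zcompare_coords[of D D]
  by (auto simp: gaps_def gap_step_def)

lemma writes_pair_loop:
  "iwrites (pair_loop X D Y E) \<inter> {''n'', ''lg'', ''pw'', ''infinite''} = {}"
  "rwrites (pair_loop X D Y E) \<subseteq> {''h1'', ''h2'', ''sep'', ''ratio'', ''L''}"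
  using iwrites_pair_step[of X D Y E] rwrites_pair_step[of X D Y E]
  by (auto simp: pair_loop_def push_pair_def)

lemma writes_lipschitz:
  "iwrites (lipschitz X D Y E) \<inter> {''n'', ''lg'', ''pw''} = {}"
  "rwrites (lipschitz X D Y E) \<subseteq> {''mid'', ''g'', ''best'', ''val'', ''h'', ''delta'', ''h1'', ''h2'', ''sep'', ''ratio'', ''L''}"
proof -
  show "iwrites (lipschitz X D Y E) \<inter> {''n'', ''lg'', ''pw''} = {}"
    using writes_coordinate_tree(1)[of X D] writes_zsort(1)[of D] writes_gaps(1)[of D] writes_pair_loop(1)[of X D Y E]
    by (simp add: lipschitz_def)
  show "rwrites (lipschitz X D Y E) \<subseteq> {''mid'', ''g'', ''best'', ''val'', ''h'', ''delta'', ''h1'', ''h2'', ''sep'', ''ratio'', ''L''}"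
    unfolding lipschitz_def rwrites.simps writes_coordinate_tree(2)
    by (intro Un_least order_trans[OF writes_zsort(2)] order_trans[OF writes_gaps(2)]
        order_trans[OF writes_pair_loop(2)]) simp_all
qed

text \<open>A two-sided estimate that does not name the optimal constant: \<open>L\<close> is below
  every valid constant, and its multiple by 1 + \<epsilon> / 3 is valid.\<close>

definition lipschitz_bounds :: "nat \<Rightarrow> real \<Rightarrow> (nat \<Rightarrow> nat \<Rightarrow> real) \<Rightarrow> (nat \<Rightarrow> nat \<Rightarrow> real) \<Rightarrow> real \<Rightarrow> bool" where
  "lipschitz_bounds n \<epsilon> dX dY L \<longleftrightarrow> 0 \<le> L \<and>
     (\<forall>p<n. \<forall>q<n. dY p q \<le> (1 + \<epsilon> / 3) * L * dX p q) \<and>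
     (\<forall>c\<ge>0. (\<forall>p<n. \<forall>q<n. dY p q \<le> c * dX p q) \<longrightarrow> L \<le> c)"

definition lipschitz_result :: "nat \<Rightarrow> real \<Rightarrow> (nat \<Rightarrow> nat \<Rightarrow> real) \<Rightarrow> (nat \<Rightarrow> nat \<Rightarrow> real) \<Rightarrow> store \<Rightarrow> bool" where
  "lipschitz_result n \<epsilon> dX dY s \<longleftrightarrow>
     (if icell s ''infinite'' 0 = 0
      then (\<forall>p<n. \<forall>q<n. p \<noteq> q \<longrightarrow> 0 < dX p q) \<and> lipschitz_bounds n \<epsilon> dX dY (rcell s ''L'' 0)
      else \<exists>p<n. \<exists>q<n. p \<noteq> q \<and> dX p q = 0)"

lemma lipschitz_bounds_perm:
  assumes A: "A ` {..<n} = {..<n}"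
    and 1: "0 \<le> L" "\<And>i k. i < n \<Longrightarrow> k < n \<Longrightarrow> dY (A i) (A k) \<le> (1 + \<epsilon> / 3) * L * dX (A i) (A k)"
    and 2: "\<And>c. 0 \<le> c \<Longrightarrow> (\<And>i k. i < n \<Longrightarrow> k < n \<Longrightarrow> dY (A i) (A k) \<le> c * dX (A i) (A k)) \<Longrightarrow> L \<le> c"
  shows "lipschitz_bounds n \<epsilon> dX dY L"
proof -
  have ex: "\<exists>i<n. p = A i" if "p < n" for p
  proof -
    have "p \<in> A ` {..<n}" using that A by simp
    then show ?thesis by auto
  qed
  have An: "A i < n" if "i < n" for i using A that by blast
  show ?thesis unfolding lipschitz_bounds_def
  proof (intro conjI allI impI)
    show "dY p q \<le> (1 + \<epsilon> / 3) * L * dX p q" if "p < n" "q < n" for p q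
      using ex[OF that(1)] ex[OF that(2)] 1(2) by blast
    show "L \<le> c" if "0 \<le> c" "\<forall>p<n. \<forall>q<n. dY p q \<le> c * dX p q" for c
      using that An by (intro 2) auto
  qed (rule 1(1))
qed

lemma runs_pair_loop_lipschitz:
  assumes tree: "pair_tree n h (\<lambda>i k. array_dist (rcell s X) D (icell s ''A'' i) (icell s ''A'' k)) (\<epsilon> / (24 * real D)) B"
    and near: "\<And>i k. i < n \<Longrightarrow> k < n \<Longrightarrow> array_dist (rcell s X) D (icell s ''A'' i) (icell s ''A'' k) \<le> real D * wmax h i k"
    and pos: "\<And>i k. i < n \<Longrightarrow> k < n \<Longrightarrow> i \<noteq> k \<Longrightarrow> 0 < array_dist (rcell s X) D (icell s ''A'' i) (icell s ''A'' k)"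
    and A: "icell s ''A'' ` {..<n} = {..<n}" and D: "0 < D" and \<epsilon>: "0 < \<epsilon>" "\<epsilon> < 1"
    and tabs: "has_log_tables s M" "n - 1 \<le> M" "has_sparse_table s (n - 1)" and h: "rcell s ''g'' = h"
    and \<delta>: "rcell s ''delta'' 0 = \<epsilon> / (24 * real D)" and n: "icell s ''n'' 0 = n"
    and XY: "X \<in> {''P'', ''fP''}" "Y \<in> {''P'', ''fP''}"
  shows "runs (pair_loop X D Y E) s ((2 + 3 * (n + 2 * (n * B))) * (ccost (pair_step X D Y E) + 50))
    (\<lambda>s'. lipschitz_bounds n \<epsilon> (array_dist (rcell s X) D) (array_dist (rcell s Y) E) (rcell s' ''L'' 0))"
proof -
  let ?A = "icell s ''A''"
  let ?dX = "array_dist (rcell s X) D" and ?dY = "array_dist (rcell s Y) E"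
  interpret pair_tree n h "\<lambda>i k. ?dX (?A i) (?A k)" "\<epsilon> / (24 * real D)" B by (rule tree)
  let ?c = "calls (0, n - 1, 0, n - 1)"
  have "runs (pair_loop X D Y E) s ((?c + 1) * (ccost (pair_step X D Y E) + 50))
    (\<lambda>s'. attained (\<lambda>i k. ?dY (?A i) (?A k)) (rcell s' ''L'' 0) \<and>
      (\<forall>i k. i < k \<longrightarrow> k < n \<longrightarrow> represented (\<lambda>i k. ?dY (?A i) (?A k)) (rcell s' ''L'' 0) i k))"
    by (rule runs_pair_loop[OF tabs h refl refl \<delta> n _ _ pos]) (use XY in auto)
  then show ?thesis
  proof (rule runs_conseq)
    fix s' assume *: "attained (\<lambda>i k. ?dY (?A i) (?A k)) (rcell s' ''L'' 0) \<and>
      (\<forall>i k. i < k \<longrightarrow> k < n \<longrightarrow> represented (\<lambda>i k. ?dY (?A i) (?A k)) (rcell s' ''L'' 0) i k)"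
    let ?L = "rcell s' ''L'' 0"
    show "lipschitz_bounds n \<epsilon> ?dX ?dY ?L"
    proof (rule lipschitz_bounds_perm[OF A])
      show "0 \<le> ?L" using * by (auto simp: attained_def)
      show "?dY (?A i) (?A k) \<le> (1 + \<epsilon> / 3) * ?L * ?dX (?A i) (?A k)" if "i < n" "k < n" for i k
      proof (rule lipschitz_estimate[where dX = "\<lambda>i k. ?dX (?A i) (?A k)" and dY = "\<lambda>i k. ?dY (?A i) (?A k)"
            and n = n and D = "real D" and lev = "wmax h"])
        show "\<exists>a<n. \<exists>c<n. a \<noteq> c \<and> wmax h a i \<le> \<epsilon> / (24 * real D) * ?dX (?A a) (?A c) \<and>
            wmax h c k \<le> \<epsilon> / (24 * real D) * ?dX (?A a) (?A c) \<and> ?dY (?A a) (?A c) \<le> ?L * ?dX (?A a) (?A c)"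
          if "i < k" "k < n" for i k using * that unfolding represented_def by blast
      qed (use that D \<epsilon> near pos in \<open>auto intro: array_dist_commute array_dist_triangle\<close>)
      show "?L \<le> c" if c: "0 \<le> c" "\<And>i k. i < n \<Longrightarrow> k < n \<Longrightarrow> ?dY (?A i) (?A k) \<le> c * ?dX (?A i) (?A k)" for c
      proof (cases "?L = 0")
        case False
        then obtain i k where ik: "i < n" "k < n" "i \<noteq> k" "?L = ?dY (?A i) (?A k) / ?dX (?A i) (?A k)"
          using * unfolding attained_def by blast
        then show ?thesis using c(2)[OF ik(1,2)] pos[OF ik(1-3)] by (simp add: pos_divide_le_eq)
      qed (use c in simp)
    qed
  next
    show "(?c + 1) * (ccost (pair_step X D Y E) + 50) \<le> (2 + 3 * (n + 2 * (n * B))) * (ccost (pair_step X D Y E) + 50)"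
      using calls_root by (intro mult_le_mono1) simp
  qed
qed

text \<open>The first summand of the time pays for sorting, splitting and tables on the
  \<open>D * n\<close> coordinates, the second one for the enumeration of pairs.\<close>

lemma runs_lipschitz:
  assumes tabs: "has_log_tables s M" "D * n \<le> M" and n: "icell s ''n'' 0 = n" "2 \<le> n" and D: "0 < D"
    and XY: "X \<in> {''P'', ''fP''}" "Y \<in> {''P'', ''fP''}" and inf: "icell s ''infinite'' 0 = 0"
    and \<epsilon>: "rcell s ''eps'' 0 = \<epsilon>" "0 < \<epsilon>" "\<epsilon> < 1"
  shows "runs (lipschitz X D Y E) s
    ((3500 + D + 4 * ccost (zcompare D)) * (D * n * (floor_log (D * n) + 2)) +
      (2 + 3 * (n + 2 * (n * nat \<lfloor>(4 / (\<epsilon> / (24 * real D)) + 3) ^ D\<rfloor>))) * (ccost (pair_step X D Y E) + 50))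
    (lipschitz_result n \<epsilon> (array_dist (rcell s X) D) (array_dist (rcell s Y) E))"
proof -
  define W where "W = D * n * (floor_log (D * n) + 2)"
  define w where "w = n * (floor_log n + 2)"
  have Dn: "n \<le> D * n" using D by simp
  have wW: "w \<le> W" unfolding w_def W_def by (intro mult_le_mono Dn add_mono floor_log_le_iff order_refl)
  have W: "4 \<le> W" using wW n(2) mult_le_mono[of 2 n 2 "floor_log n + 2"] by (simp add: w_def)
  let ?dX = "array_dist (rcell s X) D" and ?dY = "array_dist (rcell s Y) E"
  let ?\<delta> = "\<epsilon> / (24 * real D)"
  let ?P = "(2 + 3 * (n + 2 * (n * nat \<lfloor>(4 / ?\<delta> + 3) ^ D\<rfloor>))) * (ccost (pair_step X D Y E) + 50)"
  let ?K = "ccost (zcompare D)"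
  have "runs (lipschitz X D Y E) s ((3500 + D + 4 * ?K) * W + ?P) (lipschitz_result n \<epsilon> ?dX ?dY)"
    unfolding lipschitz_def
  proof (rule runs_seq[OF runs_coordinate_tree[OF tabs n D XY(1)], where Y = "(1500 + 4 * ?K) * W + ?P"], goal_cases s1 cost)
    case cost
    show ?case unfolding W_def[symmetric] by (simp add: algebra_simps)
  next
    case (s1 s1)
    have e1: "icell s1 a = icell s a" if "a \<in> {''n'', ''lg'', ''pw'', ''infinite''}" for a
      by (rule frame_icell[OF s1(2)]) (use writes_coordinate_tree(1)[of X D] that in auto)
    have r1: "rcell s1 a = rcell s a" if "a \<in> {X, Y, ''eps''}" for a
      by (rule frame_rcell[OF s1(2)]) (use writes_coordinate_tree(2)[of X D] that XY in auto)
    have tabs1: "has_log_tables s1 M" using tabs(1) by (simp add: has_log_tables_def e1)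
    obtain x rk where tree1: "coordinate_tree_of s1 D n (rcell s X) x rk" using s1(1) by blast
    have n1: "icell s1 ''n'' 0 = n" using n e1 by simp
    show ?case
    proof (rule runs_seq[OF runs_zsort[OF tree1 tabs1 tabs(2) D n1 n(2)], where Y = "(800 + 2 * ?K) * W + ?P"], goal_cases s2 cost)
      case cost
      have "(2 * ?K + 600) * w \<le> (2 * ?K + 600) * W" using wW by (rule mult_le_mono2)
      then show ?case unfolding w_def[symmetric] by (simp add: algebra_simps)
    next
      case (s2 s2)
      let ?A = "icell s2 ''A''"
      have e2: "icell s2 a = icell s1 a" if "a \<in> {''n'', ''lg'', ''pw'', ''infinite'', ''R'', ''row'', ''T''}" for a
        by (rule frame_icell[OF s2(2)]) (use writes_zsort(1)[of D] that in auto)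
      have r2: "rcell s2 a = rcell s1 a" if "a \<in> {X, Y, ''eps'', ''g''}" for a
        by (rule frame_rcell[OF s2(2)]) (use writes_zsort(2)[of D] that XY in auto)
      have tabs2: "has_log_tables s2 M" using tabs1 by (simp add: has_log_tables_def e2)
      have tree2: "coordinate_tree_of s2 D n (rcell s X) x rk"
        by (rule coordinate_tree_of_cong[OF _ _ _ _ tree1]) (simp_all add: e2 r2)
      have n2: "icell s2 ''n'' 0 = n" "icell s2 ''infinite'' 0 = 0" using n1 inf e1 e2 by simp_all
      have A: "?A ` {..<n} = {..<n}" using s2(1) by blast
      have An: "?A i < n" if "i < n" for i using A that by blast
      have sorted: "zle D (rcell s2 ''g'') rk (?A i) (?A k)" if "i < k" "k < n" for i k
        using s2(1) that r2 by simp
      show ?case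
      proof (rule runs_seq[OF runs_gaps[OF tree2 tabs2 tabs(2) D n2(1) n(2) A n2(2)], where Y = "50 * W + ?P"], goal_cases s3 cost)
        case cost
        have "(2 * ?K + 700) * w \<le> (2 * ?K + 700) * W" using wW by (rule mult_le_mono2)
        then show ?case unfolding w_def[symmetric] by (simp add: algebra_simps)
      next
        case (s3 s3)
        have e3: "icell s3 a = icell s2 a" if "a \<in> {''n'', ''lg'', ''pw'', ''A''}" for a
          by (rule frame_icell[OF s3(2)]) (use writes_gaps(1)[of D] that in auto)
        have r3: "rcell s3 a = rcell s2 a" if "a \<in> {X, Y, ''eps''}" for a
          by (rule frame_rcell[OF s3(2)]) (use writes_gaps(2)[of D] that XY in auto)
        let ?h = "rcell s3 ''g''"
        have h: "?h i = level D (rcell s2 ''g'') rk (?A i) (?A (Suc i))" if "Suc i < n" for i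
          using s3(1) that by blast
        define s4 where "s4 = rupd ''delta'' 0 ?\<delta> s3"
        have arr: "rcell s4 X = rcell s X" "rcell s4 Y = rcell s Y" "icell s4 ''A'' = ?A" "rcell s4 ''g'' = ?h"
          using r1 r2 r3 e3 XY by (auto simp: s4_def)
        have tabs4: "has_log_tables s4 M" "has_sparse_table s4 (n - 1)"
          using tabs2 s3(1) e3 by (simp_all add: s4_def has_log_tables_def has_sparse_table_def has_sparse_row_def)
        have inf4: "icell s4 ''infinite'' 0 = 0 \<longleftrightarrow> (\<forall>i. Suc i < n \<longrightarrow> 0 < ?h i)"
          using s3(1) h by (simp add: s4_def)
        have "runs (Cond (ILess (IConst 0) (iscalar ''infinite'')) Skip (pair_loop X D Y E)) s4 (10 * W + ?P)
            (lipschitz_result n \<epsilon> ?dX ?dY)"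
        proof (rule runs_cond[where T = "1 + ?P"], goal_cases infinite finite cost)
          case infinite
          then obtain i where i: "Suc i < n" "\<not> 0 < ?h i" using inf4 by auto
          have lt: "i < n" using i by simp
          \<comment> \<open>A gap of level 0 forces the distance of the two neighbours to be
            0.\<close>
          have "?dX (?A i) (?A (Suc i)) \<le> real D * ?h i"
            using tree_dist_level(1)[OF tree2 An[OF lt] An[OF i(1)]] h[OF i(1)] by simp
          also have "\<dots> \<le> 0" using i(2) by (simp add: mult_nonneg_nonpos)
          finally have "?dX (?A i) (?A (Suc i)) = 0" using array_dist_nonneg[of "rcell s X" D "?A i" "?A (Suc i)"] by linarith
          moreover have "?A i \<noteq> ?A (Suc i)"
            using inj_onD[OF inj_on_perm[OF A], of i "Suc i"] lt i(1) by auto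
          ultimately have "\<exists>p<n. \<exists>q<n. p \<noteq> q \<and> ?dX p q = 0" using An[OF lt] An[OF i(1)] by blast
          then show ?case using infinite by (intro runs_wp) (simp_all add: lipschitz_result_def)
        next
          case finite
          then have inf0: "icell s4 ''infinite'' 0 = 0" by simp
          have hpos: "0 < ?h i" if "Suc i < n" for i using inf4 inf0 that by blast
          have n0: "0 < n" and \<delta>0: "0 < ?\<delta>" using n(2) \<epsilon> D by auto
          have pt1: "pair_tree n ?h (\<lambda>i k. ?dX (?A i) (?A k)) ?\<delta> (nat \<lfloor>(4 / ?\<delta> + 3) ^ D\<rfloor>)"
            by (rule pair_tree_of_coordinate_tree(1)[OF tree2 n0 \<delta>0 A]; fact sorted h hpos)
          have pt2: "?dX (?A i) (?A k) \<le> real D * wmax ?h i k" if "i < n" "k < n" for i k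
            by (rule pair_tree_of_coordinate_tree(2)[OF tree2 n0 \<delta>0 A]; fact sorted h hpos that)
          have pt3: "0 < ?dX (?A i) (?A k)" if "i < n" "k < n" "i \<noteq> k" for i k
            by (rule pair_tree_of_coordinate_tree(3)[OF tree2 n0 \<delta>0 A]; fact sorted h hpos that)
          have "runs (pair_loop X D Y E) s4 ?P
              (\<lambda>s'. lipschitz_bounds n \<epsilon> (array_dist (rcell s4 X) D) (array_dist (rcell s4 Y) E) (rcell s' ''L'' 0))"
          proof (rule runs_pair_loop_lipschitz[where h = ?h and M = M, OF _ _ _ _ D \<epsilon>(2,3) tabs4(1) _ tabs4(2) arr(4) _ _ XY])
            show "pair_tree n ?h (\<lambda>i k. array_dist (rcell s4 X) D (icell s4 ''A'' i) (icell s4 ''A'' k)) ?\<delta>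
                (nat \<lfloor>(4 / ?\<delta> + 3) ^ D\<rfloor>)"
              unfolding arr by (rule pt1)
            show "array_dist (rcell s4 X) D (icell s4 ''A'' i) (icell s4 ''A'' k) \<le> real D * wmax ?h i k"
              if "i < n" "k < n" for i k unfolding arr by (rule pt2[OF that])
            show "0 < array_dist (rcell s4 X) D (icell s4 ''A'' i) (icell s4 ''A'' k)"
              if "i < n" "k < n" "i \<noteq> k" for i k unfolding arr by (rule pt3[OF that])
            show "icell s4 ''A'' ` {..<n} = {..<n}" unfolding arr by (rule A)
            show "n - 1 \<le> M" using tabs(2) Dn by linarith
            show "rcell s4 ''delta'' 0 = ?\<delta>" by (simp add: s4_def)
            show "icell s4 ''n'' 0 = n" using n2(1) e3 by (simp add: s4_def)
          qed
          then show ?case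
          proof (rule runs_conseq)
            fix s' assume b: "lipschitz_bounds n \<epsilon> (array_dist (rcell s4 X) D) (array_dist (rcell s4 Y) E) (rcell s' ''L'' 0)"
              and fr: "frame (pair_loop X D Y E) s4 s'"
            have "icell s' ''infinite'' = icell s4 ''infinite''"
              by (rule frame_icell[OF fr]) (use writes_pair_loop(1)[of X D Y E] in auto)
            moreover have "0 < ?dX p q" if pq: "p < n" "q < n" "p \<noteq> q" for p q
            proof -
              have "p \<in> ?A ` {..<n}" "q \<in> ?A ` {..<n}" using pq A by auto
              then show ?thesis using pt3 pq(3) by blast
            qed
            ultimately show "lipschitz_result n \<epsilon> ?dX ?dY s'"
              using b inf0 by (simp add: lipschitz_result_def arr)
          qed simp
        next
          case cost
          show ?case using W by simp
        qed
        then show ?case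
          by (intro runs_seq_wp[where Y = "10 * W + ?P"])
            (use W r1 r2 r3 \<epsilon>(1) in \<open>auto simp: s4_def\<close>)
      qed
    qed
  qed
  then show ?thesis by (simp add: W_def)
qed

section \<open>Distortion\<close>

definition combine :: com where
  "combine = ''result'' :=\<^sub>r RMul (RMul (rscalar ''L1'') (rscalar ''L''))
     (RMul (RAdd (RConst 1) (RDiv (rscalar ''eps'') (RConst 3))) (RAdd (RConst 1) (RDiv (rscalar ''eps'') (RConst 3))))"

text \<open>With fewer than two points there are no ratios, and the distortion is 1 by the
  requirement that K be at least 1. Otherwise the logarithm tables are computed once, large enough
  for both dimensions.\<close>

definition distortion_program :: "nat \<Rightarrow> nat \<Rightarrow> com" where
  "distortion_program d k =
     Cond (ILess (iscalar ''n'') (IConst 2)) (''result'' :=\<^sub>r RConst 1)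
       (''M'' :=\<^sub>i imult (d + k) (iscalar ''n'') ;; log_tables ;;
        lipschitz ''P'' d ''fP'' k ;; ''L1'' :=\<^sub>r rscalar ''L'' ;; lipschitz ''fP'' k ''P'' d ;; combine)"

section \<open>The asymptotic time bound\<close>

definition lipschitz_time :: "nat \<Rightarrow> nat \<Rightarrow> nat \<Rightarrow> nat \<Rightarrow> real \<Rightarrow> nat" where
  "lipschitz_time K K' D n \<epsilon> = K * (D * n * (floor_log (D * n) + 2)) +
     (2 + 3 * (n + 2 * (n * nat \<lfloor>(4 / (\<epsilon> / (24 * real D)) + 3) ^ D\<rfloor>))) * K'"

text \<open>The factor 2 comes from ln 2 being at least 1/2.\<close>

lemma floor_log_le_ln: "0 < m \<Longrightarrow> real (floor_log m) \<le> 2 * ln (real m)"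
proof -
  assume m: "0 < m"
  have "2 ^ floor_log m \<le> m" using m by (rule floor_log_exp2_le)
  then have "ln (2 ^ floor_log m) \<le> ln (real m)"
    using m by (subst ln_le_cancel_iff) (simp_all flip: of_nat_le_iff)
  then have le: "real (floor_log m) * ln 2 \<le> ln (real m)" by (simp add: ln_realpow)
  have "(1::real) / 2 \<le> ln 2" using ln2_ge_two_thirds by simp
  then have "real (floor_log m) * (1 / 2) \<le> real (floor_log m) * ln 2" by (intro mult_left_mono) auto
  then show ?thesis using le by simp
qed

lemma lipschitz_time_bound:
  assumes D: "0 < D" "D \<le> m"
  shows "\<exists>C\<ge>0. \<forall>n \<epsilon>. 0 < n \<longrightarrow> 0 < \<epsilon> \<longrightarrow> \<epsilon> < 1 \<longrightarrow>
    real (lipschitz_time K K' D n \<epsilon>) \<le> C * (real n * ln (real n) + real n / \<epsilon> ^ m)"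
proof -
  \<comment> \<open>Collects the terms of 2 * ln (D * n) + 2 that do not depend on n; being at least
    2, it also absorbs the factor 2 of n * ln n.\<close>
  define c where "c = 2 * ln (real D) + 2"
  define C where "C = real K * (real D * c) + real K' * (5 + 6 * (99 * real D) ^ D)"
  have c: "2 \<le> c" using D by (simp add: c_def)
  have "real (lipschitz_time K K' D n \<epsilon>) \<le> C * (real n * ln (real n) + real n / \<epsilon> ^ m)"
    if n: "0 < n" and \<epsilon>: "0 < \<epsilon>" "\<epsilon> < 1" for n \<epsilon>
  proof -
    define G where "G = real n * ln (real n)"
    define E where "E = real n / \<epsilon> ^ m"
    have G: "0 \<le> G" using n by (simp add: G_def)
    have "\<epsilon> ^ m \<le> 1" using \<epsilon> by (simp add: power_le_one)
    then have E: "real n \<le> E" using \<epsilon> n by (simp add: E_def field_simps)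
    have "real (floor_log (D * n)) + 2 \<le> 2 * ln (real n) + c"
      using floor_log_le_ln[of "D * n"] D n by (simp add: c_def ln_mult)
    then have "real n * (real (floor_log (D * n)) + 2) \<le> real n * (2 * ln (real n) + c)"
      by (intro mult_left_mono) auto
    also have "\<dots> = 2 * G + c * real n" by (simp add: G_def algebra_simps)
    also have "\<dots> \<le> c * G + c * E" using c G E by (intro add_mono mult_right_mono mult_left_mono) auto
    finally have "real n * (real (floor_log (D * n)) + 2) \<le> c * (G + E)" by (simp add: algebra_simps)
    then have t1: "real K * (real D * (real n * (real (floor_log (D * n)) + 2))) \<le> real K * (real D * (c * (G + E)))"
      by (intro mult_left_mono) auto
    define B where "B = nat \<lfloor>(4 / (\<epsilon> / (24 * real D)) + 3) ^ D\<rfloor>"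
    \<comment> \<open>\<open>4 / (\<epsilon> / (24 * real D))\<close> is 96 * D / \<epsilon>, and 3
      is at most 3 * D / \<epsilon>; this explains 99.\<close>
    have "1 \<le> real D / \<epsilon>" using D \<epsilon> by (simp add: field_simps)
    then have base: "0 \<le> 4 / (\<epsilon> / (24 * real D)) + 3" "4 / (\<epsilon> / (24 * real D)) + 3 \<le> 99 * real D / \<epsilon>"
      using \<epsilon> by (auto simp: field_simps)
    have "real B \<le> (4 / (\<epsilon> / (24 * real D)) + 3) ^ D"
      unfolding B_def using base by (simp add: zero_le_power)
    also have "\<dots> \<le> (99 * real D / \<epsilon>) ^ D" using base by (rule power_mono[rotated])
    also have "\<dots> = (99 * real D) ^ D / \<epsilon> ^ D" by (simp add: power_divide)
    also have "\<dots> \<le> (99 * real D) ^ D / \<epsilon> ^ m"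
      using \<epsilon> D by (intro divide_left_mono power_decreasing) auto
    finally have "real n * real B \<le> real n * ((99 * real D) ^ D / \<epsilon> ^ m)" by (intro mult_left_mono) auto
    then have nB: "real n * real B \<le> (99 * real D) ^ D * E" by (simp add: E_def algebra_simps)
    have "2 + 3 * (real n + 2 * (real n * real B)) \<le> 5 * E + 6 * ((99 * real D) ^ D * E)"
      using nB E n by simp
    also have "\<dots> = (5 + 6 * (99 * real D) ^ D) * E" by (simp add: algebra_simps)
    also have "\<dots> \<le> (5 + 6 * (99 * real D) ^ D) * (G + E)" using G by (intro mult_left_mono) auto
    finally have t2: "(2 + 3 * (real n + 2 * (real n * real B))) * real K' \<le> (5 + 6 * (99 * real D) ^ D) * (G + E) * real K'"
      by (intro mult_right_mono) auto
    have "real (lipschitz_time K K' D n \<epsilon>) = real K * (real D * (real n * (real (floor_log (D * n)) + 2))) +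
        (2 + 3 * (real n + 2 * (real n * real B))) * real K'"
      unfolding lipschitz_time_def B_def[symmetric] by (simp add: algebra_simps)
    also have "\<dots> \<le> real K * (real D * (c * (G + E))) + (5 + 6 * (99 * real D) ^ D) * (G + E) * real K'"
      using t1 t2 by (rule add_mono)
    also have "\<dots> = C * (G + E)" by (simp add: C_def algebra_simps)
    finally show ?thesis by (simp add: G_def E_def)
  qed
  moreover have "0 \<le> C" using c by (simp add: C_def)
  ultimately show ?thesis by blast
qed

section \<open>Input arrays and distortion\<close>

text \<open>The enumeration of the index type is a bijection, so a sum over the cells of a point is
  a sum over its coordinates.\<close>

lemma array_dist_point_array:
  fixes xs :: "(real ^ 'd::finite) list"
  assumes "p < length xs" "q < length xs"
  shows "array_dist (point_array xs) CARD('d) p q = dist (xs ! p) (xs ! q)"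
proof -
  have coord: "point_array xs (CARD('d) * p + j) = xs ! p $ from_nat_into UNIV j"
    if "p < length xs" "j < CARD('d)" for p j
  proof -
    have "CARD('d) * p + j < CARD('d) * Suc p" using that by simp
    also have "\<dots> \<le> CARD('d) * length xs" using that by (intro mult_le_mono2) simp
    finally show ?thesis using that by (simp add: point_array_def coordinate_def mult.commute)
  qed
  have bij: "bij_betw (from_nat_into (UNIV :: 'd set)) {..<CARD('d)} UNIV"
    by (rule bij_betw_from_nat_into_finite) simp
  have "array_dist (point_array xs) CARD('d) p q =
      sqrt (\<Sum>j<CARD('d). (xs ! p $ from_nat_into UNIV j - xs ! q $ from_nat_into UNIV j)\<^sup>2)"
    using assms by (simp add: array_dist_def L2_set_def coord)
  also have "(\<Sum>j<CARD('d). (xs ! p $ from_nat_into UNIV j - xs ! q $ from_nat_into UNIV j)\<^sup>2) =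
      (\<Sum>i\<in>UNIV. (xs ! p $ i - xs ! q $ i)\<^sup>2)"
    using sum.reindex_bij_betw[OF bij, of "\<lambda>i. (xs ! p $ i - xs ! q $ i)\<^sup>2"] by simp
  also have "sqrt \<dots> = dist (xs ! p) (xs ! q)"
    by (simp add: dist_vec_def L2_set_def dist_real_def)
  finally show ?thesis .
qed

lemma distortion_subsingleton:
  assumes "card P \<le> 1" "finite P"
  shows "distortion P f = 1"
proof -
  have eq: "x = y" if "x \<in> P" "y \<in> P" for x y
    using assms that by (metis One_nat_def card_le_Suc0_iff_eq)
  have "bi_lipschitz 1 P f" unfolding bi_lipschitz_def using eq by (intro conjI exI[of _ 1]) (auto dest: eq)
  then have "(LEAST K. bi_lipschitz K P f) = 1"
    by (intro Least_equality) (auto simp: bi_lipschitz_def)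
  moreover have "inj_on f P" using eq by (auto simp: inj_on_def)
  ultimately show ?thesis by (simp add: distortion_def one_ereal_def)
qed

text \<open>The distortion is the product of the least Lipschitz constants of \<open>f\<close> and
  of its inverse; each factor of \<open>l\<close> overestimates one of them by at most 1 +
  \<epsilon> / 3. A pair of distinct points makes both constants positive.\<close>

lemma distortion_estimate:
  assumes fin: "finite P" and inj: "inj_on f P" and xy: "x0 \<in> P" "y0 \<in> P" "x0 \<noteq> y0" and \<epsilon>: "0 < \<epsilon>" "\<epsilon> < 1"
    and L1: "0 \<le> L1" "\<And>x y. x \<in> P \<Longrightarrow> y \<in> P \<Longrightarrow> dist (f x) (f y) \<le> (1 + \<epsilon> / 3) * L1 * dist x y"
      "\<And>c. 0 \<le> c \<Longrightarrow> (\<And>x y. x \<in> P \<Longrightarrow> y \<in> P \<Longrightarrow> dist (f x) (f y) \<le> c * dist x y) \<Longrightarrow> L1 \<le> c"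
    and L2: "0 \<le> L2" "\<And>x y. x \<in> P \<Longrightarrow> y \<in> P \<Longrightarrow> dist x y \<le> (1 + \<epsilon> / 3) * L2 * dist (f x) (f y)"
      "\<And>c. 0 \<le> c \<Longrightarrow> (\<And>x y. x \<in> P \<Longrightarrow> y \<in> P \<Longrightarrow> dist x y \<le> c * dist (f x) (f y)) \<Longrightarrow> L2 \<le> c"
  defines "l \<equiv> L1 * L2 * ((1 + \<epsilon> / 3) * (1 + \<epsilon> / 3))"
  shows "distortion P f \<le> ereal l \<and> ereal l \<le> ereal (1 + \<epsilon>) * distortion P f"
proof -
  define K where "K = (LEAST K. bi_lipschitz K P f)"
  have D: "distortion P f = ereal K" using inj by (simp add: distortion_def K_def)
  let ?e = "1 + \<epsilon> / 3"
  have e: "0 < ?e" using \<epsilon> by simp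
  have pos: "0 < dist x0 y0" "0 < dist (f x0) (f y0)" using xy inj by (auto simp: inj_on_def)
  have "0 < ?e * L1 * dist x0 y0" using L1(2)[OF xy(1,2)] pos by linarith
  then have L1pos: "0 < L1" using pos e by (simp add: zero_less_mult_iff)
  have "0 < ?e * L2 * dist (f x0) (f y0)" using L2(2)[OF xy(1,2)] pos by linarith
  then have L2pos: "0 < L2" using pos e by (simp add: zero_less_mult_iff)
  \<comment> \<open>Going to the domain by the second estimate and back by the first one multiplies
    a positive distance by \<open>l\<close>, so \<open>l\<close> is at least 1.\<close>
  have "?e * L1 * dist x0 y0 \<le> ?e * L1 * (?e * L2 * dist (f x0) (f y0))"
    using L1pos e by (intro mult_left_mono L2(2) xy) auto
  with L1(2)[OF xy(1,2)] have "dist (f x0) (f y0) \<le> ?e * L1 * (?e * L2 * dist (f x0) (f y0))"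
    by (rule order_trans)
  then have "1 * dist (f x0) (f y0) \<le> l * dist (f x0) (f y0)" by (simp only: l_def mult_1 mult_ac)
  then have l1: "1 \<le> l" using pos(2) by (simp only: mult_le_cancel_right_pos)
  \<comment> \<open>The scale is \<open>?e * L1\<close>; divided by \<open>l\<close> it leaves the
    inverse of \<open>?e * L2\<close>.\<close>
  have "bi_lipschitz l P f"
    unfolding bi_lipschitz_def
  proof (intro conjI exI[of _ "?e * L1"] ballI)
    show "0 < ?e * L1" using e L1pos by simp
    fix x y assume "x \<in> P" "y \<in> P"
    then show "dist (f x) (f y) \<le> ?e * L1 * dist x y" by (rule L1(2))
    have "l = (?e * L1) * (?e * L2)" by (simp only: l_def mult_ac)
    moreover have "u * inverse (u * v) = inverse v" if "0 < u" for u v :: real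
      using that by simp
    ultimately have "?e * L1 * inverse l = inverse (?e * L2)" using e L1pos by (metis mult_pos_pos)
    moreover have "inverse (?e * L2) * dist x y \<le> dist (f x) (f y)"
    proof -
      have "inverse v * a \<le> b" if "0 < v" "a \<le> v * b" for a b v :: real
        using that by (simp add: field_simps)
      then show ?thesis using L2(2)[OF \<open>x \<in> P\<close> \<open>y \<in> P\<close>] mult_pos_pos[OF e L2pos] by blast
    qed
    ultimately show "?e * L1 * inverse l * dist x y \<le> dist (f x) (f y)" by simp
  qed (rule l1)
  then have Kl: "K \<le> l" unfolding K_def by (rule bi_lipschitz_LEAST(2)[OF fin inj])
  have "bi_lipschitz K P f" unfolding K_def by (rule bi_lipschitz_LEAST(1)[OF fin inj])
  then obtain c where K: "1 \<le> K" and c: "0 < c"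
    "\<And>x y. x \<in> P \<Longrightarrow> y \<in> P \<Longrightarrow> c * inverse K * dist x y \<le> dist (f x) (f y) \<and> dist (f x) (f y) \<le> c * dist x y"
    unfolding bi_lipschitz_def by blast
  \<comment> \<open>In an optimal bi-Lipschitz pair of bounds, \<open>c\<close> is a Lipschitz
    constant of \<open>f\<close> and \<open>K / c\<close> one of its inverse; the scale cancels in
    the product.\<close>
  have "L1 \<le> c" using c by (intro L1(3)) auto
  moreover have "L2 \<le> K / c"
  proof (rule L2(3))
    fix x y assume "x \<in> P" "y \<in> P"
    then have "c * inverse K * dist x y \<le> dist (f x) (f y)" using c(2) by blast
    then show "dist x y \<le> K / c * dist (f x) (f y)" using c(1) K by (simp add: field_simps)
  qed (use c K in simp)
  ultimately have "L1 * L2 \<le> c * (K / c)" using L1(1) L2(1) c(1) by (intro mult_mono) auto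
  then have LK: "L1 * L2 \<le> K" using c(1) by simp
  have "\<epsilon> * \<epsilon> \<le> \<epsilon>" using \<epsilon> by (simp add: mult_left_le)
  moreover have "?e * ?e = 1 + 2 * \<epsilon> / 3 + \<epsilon> * \<epsilon> / 9" by (simp add: field_simps)
  ultimately have ee: "?e * ?e \<le> 1 + \<epsilon>" using \<epsilon> by linarith
  have "l \<le> K * (1 + \<epsilon>)" unfolding l_def using LK ee e K by (intro mult_mono) auto
  then show ?thesis using Kl D by (simp add: mult.commute)
qed

section \<open>Correctness of the whole program\<close>

lemma runs_distortion_program:
  fixes f :: "real ^ 'd::finite \<Rightarrow> real ^ 'k::finite" and xs :: "(real ^ 'd) list" and \<epsilon> :: real
  defines "d \<equiv> CARD('d)" and "k \<equiv> CARD('k)"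
  defines "T1 \<equiv> lipschitz_time (3500 + d + 4 * ccost (zcompare d)) (ccost (pair_step ''P'' d ''fP'' k) + 50) d (length xs) \<epsilon>"
    and "T2 \<equiv> lipschitz_time (3500 + k + 4 * ccost (zcompare k)) (ccost (pair_step ''fP'' k ''P'' d) + 50) k (length xs) \<epsilon>"
  assumes xs: "distinct xs" and \<epsilon>: "0 < \<epsilon>" "\<epsilon> < 1"
  shows "runs (distortion_program d k) (input_store xs f \<epsilon>)
    (60 + 100 * ((d + k) * Suc (length xs)) + T1 + T2)
    (\<lambda>s. distortion (set xs) f \<le> reported s \<and> reported s \<le> ereal (1 + \<epsilon>) * distortion (set xs) f)"
proof -
  define n where "n = length xs"
  let ?s0 = "input_store xs f \<epsilon>"
  let ?Q = "\<lambda>s. distortion (set xs) f \<le> reported s \<and> reported s \<le> ereal (1 + \<epsilon>) * distortion (set xs) f"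
  have s0: "icell ?s0 ''n'' 0 = n" "icell ?s0 ''infinite'' 0 = 0" "rcell ?s0 ''eps'' 0 = \<epsilon>"
    "rcell ?s0 ''P'' = point_array xs" "rcell ?s0 ''fP'' = point_array (map f xs)"
    by (auto simp: input_store_def n_def)
  have d: "0 < d" and k: "0 < k" by (simp_all add: d_def k_def)
  have card: "card (set xs) = n" using xs by (simp add: distinct_card n_def)
  let ?dX = "array_dist (point_array xs) d" and ?dY = "array_dist (point_array (map f xs)) k"
  have dX: "?dX p q = dist (xs ! p) (xs ! q)" if "p < n" "q < n" for p q
    using array_dist_point_array[of p xs q] that by (simp add: d_def n_def)
  have dY: "?dY p q = dist (f (xs ! p)) (f (xs ! q))" if "p < n" "q < n" for p q
    using array_dist_point_array[of p "map f xs" q] that by (simp add: k_def n_def)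
  have dXpos: "?dX p q \<noteq> 0" if "p < n" "q < n" "p \<noteq> q" for p q
    using dX[OF that(1,2)] xs that by (simp add: nth_eq_iff_index_eq n_def)
  show ?thesis unfolding distortion_program_def
  proof (rule runs_cond[where T = "50 + 100 * ((d + k) * Suc (length xs)) + T1 + T2"], goal_cases small large cost)
    case small
    then have "card (set xs) \<le> 1" using s0 card by simp
    then have "distortion (set xs) f = 1" by (intro distortion_subsingleton) auto
    then show ?case using s0 \<epsilon> by (intro runs_wp) (auto simp: reported_def one_ereal_def)
  next
    case large
    then have n2: "2 \<le> n" using s0 by simp
    define M where "M = (d + k) * n"
    have M: "1 \<le> M" "d * n \<le> M" "k * n \<le> M" using n2 d by (auto simp: M_def add_mult_distrib Suc_le_eq)
    define s1 where "s1 = iupd ''M'' 0 M ?s0"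
    have cs: "icell s1 ''M'' 0 = M" by (simp add: s1_def)
    have "runs (log_tables ;; lipschitz ''P'' d ''fP'' k ;; ''L1'' :=\<^sub>r rscalar ''L'' ;; lipschitz ''fP'' k ''P'' d ;; combine)
        s1 (100 * M + (T1 + (T2 + 30))) ?Q"
    proof (rule runs_seq[OF runs_log_tables[OF cs M(1)] _ order_refl], goal_cases tables)
      case (tables s2)
      have e2: "icell s2 a = icell ?s0 a" if "a \<in> {''n'', ''infinite''}" for a
        using frame_icell[OF tables(2), of a] that by (auto simp: s1_def log_tables_def)
      have r2: "rcell s2 = rcell ?s0"
        using tables(2) by (auto simp: frame_def s1_def log_tables_def)
      have "runs (lipschitz ''P'' d ''fP'' k) s2 T1 (lipschitz_result n \<epsilon> ?dX ?dY)"
        using runs_lipschitz[of s2 M d n "''P''" "''fP''" \<epsilon> k] tables(1) M n2 d e2 r2 s0 \<epsilon>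
        by (simp add: T1_def lipschitz_time_def n_def[symmetric])
      then show ?case
      proof (rule runs_seq[OF _ _ order_refl], goal_cases first)
        case (first s3)
        \<comment> \<open>The listed points are distinct, so the first run cannot raise the flag; a
          flag raised later means that two images coincide.\<close>
        have inf3: "icell s3 ''infinite'' 0 = 0"
          using first(1) dXpos unfolding lipschitz_result_def by (metis (no_types, lifting))
        have b1: "lipschitz_bounds n \<epsilon> ?dX ?dY (rcell s3 ''L'' 0)"
          using first(1) inf3 by (simp add: lipschitz_result_def)
        have e3: "icell s3 a = icell s2 a" if "a \<in> {''n'', ''lg'', ''pw''}" for a
          by (rule frame_icell[OF first(2)]) (use writes_lipschitz(1)[of "''P''" d "''fP''" k] that in auto)
        have r3: "rcell s3 a = rcell s2 a" if "a \<in> {''P'', ''fP'', ''eps''}" for a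
          by (rule frame_rcell[OF first(2)]) (use writes_lipschitz(2)[of "''P''" d "''fP''" k] that in auto)
        define s4 where "s4 = rupd ''L1'' 0 (rcell s3 ''L'' 0) s3"
        have s4: "has_log_tables s4 M" "icell s4 ''n'' 0 = n" "icell s4 ''infinite'' 0 = 0" "rcell s4 ''eps'' 0 = \<epsilon>"
          "rcell s4 ''P'' = point_array xs" "rcell s4 ''fP'' = point_array (map f xs)" "rcell s4 ''L1'' 0 = rcell s3 ''L'' 0"
          using tables(1) e2 e3 r2 r3 inf3 s0 by (simp_all add: s4_def has_log_tables_def)
        have "runs (lipschitz ''fP'' k ''P'' d ;; combine)
            s4 (T2 + 25) ?Q"
        proof (rule runs_seq[where X = T2 and Y = 25 and R = "lipschitz_result n \<epsilon> ?dY ?dX"], goal_cases run final cost)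
          case run
          show ?case
            using runs_lipschitz[of s4 M k n "''fP''" "''P''" \<epsilon> d] s4 M n2 k \<epsilon>
            by (simp add: T2_def lipschitz_time_def n_def[symmetric])
        next
          case (final s5)
          have r5: "rcell s5 a = rcell s4 a" if "a \<in> {''eps'', ''L1''}" for a
            by (rule frame_rcell[OF final(2)]) (use writes_lipschitz(2)[of "''fP''" k "''P''" d] that in auto)
          let ?l = "rcell s3 ''L'' 0 * rcell s5 ''L'' 0 * ((1 + \<epsilon> / 3) * (1 + \<epsilon> / 3))"
          have "?Q (rupd ''result'' 0 ?l s5)"
          proof (cases "icell s5 ''infinite'' 0 = 0")
            case False
            then obtain p q where pq: "p < n" "q < n" "p \<noteq> q" "?dY p q = 0"
              using final(1) by (auto simp: lipschitz_result_def)
            then have "\<not> inj_on f (set xs)"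
              using dY[OF pq(1,2)] xs unfolding inj_on_def n_def
              by (metis dist_eq_0_iff nth_eq_iff_index_eq nth_mem)
            then show ?thesis using False \<epsilon> by (simp add: distortion_def reported_def)
          next
            case True
            have b2: "lipschitz_bounds n \<epsilon> ?dY ?dX (rcell s5 ''L'' 0)"
              and sep: "\<And>p q. p < n \<Longrightarrow> q < n \<Longrightarrow> p \<noteq> q \<Longrightarrow> 0 < ?dY p q"
              using final(1) True by (auto simp: lipschitz_result_def)
            have idx: "\<exists>p<n. x = xs ! p" if "x \<in> set xs" for x
              using that by (metis in_set_conv_nth n_def)
            have nset: "xs ! p \<in> set xs" if "p < n" for p using that by (simp add: n_def)
            have inj: "inj_on f (set xs)"
            proof (rule inj_onI)
              fix x y assume xy: "x \<in> set xs" "y \<in> set xs" "f x = f y"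
              obtain p q where pq: "p < n" "x = xs ! p" "q < n" "y = xs ! q" using idx xy by metis
              then show "x = y" using sep[of p q] dY[of p q] xy(3) by (cases "p = q") auto
            qed
            have est: "distortion (set xs) f \<le> ereal ?l \<and> ereal ?l \<le> ereal (1 + \<epsilon>) * distortion (set xs) f"
            proof (rule distortion_estimate[OF _ inj, where ?x0.0 = "xs ! 0" and ?y0.0 = "xs ! 1"])
              show "xs ! 0 \<in> set xs" "xs ! 1 \<in> set xs" using n2 by (auto intro!: nset)
              show "xs ! 0 \<noteq> xs ! 1" proof -
                have "0 < length xs" "1 < length xs" using n2[unfolded n_def] by linarith+
                then show ?thesis using nth_eq_iff_index_eq[OF xs, of 0 1] by simp
              qed
              show "0 \<le> rcell s3 ''L'' 0" "0 \<le> rcell s5 ''L'' 0"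
                using b1 b2 by (auto simp: lipschitz_bounds_def)
              show "dist (f x) (f y) \<le> (1 + \<epsilon> / 3) * rcell s3 ''L'' 0 * dist x y"
                if xy: "x \<in> set xs" "y \<in> set xs" for x y
              proof -
                obtain p q where pq: "p < n" "x = xs ! p" "q < n" "y = xs ! q" using idx xy by metis
                then show ?thesis using b1 dX[OF pq(1,3)] dY[OF pq(1,3)] unfolding lipschitz_bounds_def by metis
              qed
              show "dist x y \<le> (1 + \<epsilon> / 3) * rcell s5 ''L'' 0 * dist (f x) (f y)"
                if xy: "x \<in> set xs" "y \<in> set xs" for x y
              proof -
                obtain p q where pq: "p < n" "x = xs ! p" "q < n" "y = xs ! q" using idx xy by metis
                then show ?thesis using b2 dX[OF pq(1,3)] dY[OF pq(1,3)] unfolding lipschitz_bounds_def by metis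
              qed
              show "rcell s3 ''L'' 0 \<le> c"
                if c: "0 \<le> c" "\<And>x y. x \<in> set xs \<Longrightarrow> y \<in> set xs \<Longrightarrow> dist (f x) (f y) \<le> c * dist x y" for c
              proof -
                have "\<forall>p<n. \<forall>q<n. ?dY p q \<le> c * ?dX p q" using c(2) nset dX dY by simp
                then show ?thesis using b1 c(1) unfolding lipschitz_bounds_def by blast
              qed
              show "rcell s5 ''L'' 0 \<le> c"
                if c: "0 \<le> c" "\<And>x y. x \<in> set xs \<Longrightarrow> y \<in> set xs \<Longrightarrow> dist x y \<le> c * dist (f x) (f y)" for c
              proof -
                have "\<forall>p<n. \<forall>q<n. ?dX p q \<le> c * ?dY p q" using c(2) nset dX dY by simp
                then show ?thesis using b2 c(1) unfolding lipschitz_bounds_def by blast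
              qed
            qed (use \<epsilon> in auto)
            then show ?thesis using True by (simp add: reported_def)
          qed
          then show ?case using r5 s4 by (intro runs_wp) (simp_all add: combine_def mult.assoc)
        qed simp
        then show ?case by (intro runs_seq_wp[where Y = "T2 + 25"]) (simp_all add: s4_def)
      qed
    qed
    then have "runs (log_tables ;; lipschitz ''P'' d ''fP'' k ;; ''L1'' :=\<^sub>r rscalar ''L'' ;; lipschitz ''fP'' k ''P'' d ;; combine)
        (iupd ''M'' 0 ((d + k) * n) ?s0) (100 * M + (T1 + (T2 + 30))) ?Q"
      by (simp add: s1_def M_def)
    then show ?case
      by (intro runs_seq_wp[where Y = "100 * M + (T1 + (T2 + 30))"])
        (simp_all add: s0 M_def n_def algebra_simps)
  next
    case cost
    show ?case by simp
  qed
qed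

theorem theorem4p5:
  shows "\<exists>(prog :: com) (C :: real).
    \<forall>(P :: (real ^ 'd::finite) set) (n :: nat) (xs :: (real ^ 'd) list)
      (f :: real ^ 'd \<Rightarrow> real ^ 'k::finite) (\<epsilon> :: real).
      finite P \<and> card P = n \<and> set xs = P \<and> distinct xs \<and> 0 < \<epsilon> \<and> \<epsilon> < 1 \<longrightarrow>
      (\<exists>t s. exec prog (input_store xs f \<epsilon>) t s \<and>
         (n \<ge> 1 \<longrightarrow>
            real t \<le> C * (real n * ln (real n) + real n / \<epsilon> ^ max CARD('d) CARD('k))) \<and>
         distortion P f \<le> reported s \<and>
         reported s \<le> ereal (1 + \<epsilon>) * distortion P f)"
proof -
  let ?d = "CARD('d)" and ?k = "CARD('k)"
  let ?m = "max ?d ?k"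
  let ?T1 = "lipschitz_time (3500 + ?d + 4 * ccost (zcompare ?d)) (ccost (pair_step ''P'' ?d ''fP'' ?k) + 50) ?d"
  let ?T2 = "lipschitz_time (3500 + ?k + 4 * ccost (zcompare ?k)) (ccost (pair_step ''fP'' ?k ''P'' ?d) + 50) ?k"
  obtain C1 where C1: "0 \<le> C1" "\<And>n \<epsilon>. 0 < n \<Longrightarrow> 0 < \<epsilon> \<Longrightarrow> \<epsilon> < 1 \<Longrightarrow>
      real (?T1 n \<epsilon>) \<le> C1 * (real n * ln (real n) + real n / \<epsilon> ^ ?m)"
    using lipschitz_time_bound[of ?d ?m] by (metis max.cobounded1 zero_less_card_finite)
  obtain C2 where C2: "0 \<le> C2" "\<And>n \<epsilon>. 0 < n \<Longrightarrow> 0 < \<epsilon> \<Longrightarrow> \<epsilon> < 1 \<Longrightarrow>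
      real (?T2 n \<epsilon>) \<le> C2 * (real n * ln (real n) + real n / \<epsilon> ^ ?m)"
    using lipschitz_time_bound[of ?k ?m] by (metis max.cobounded2 zero_less_card_finite)
  \<comment> \<open>Since \<epsilon> < 1, n is at most n / \<epsilon>^m; this absorbs the constant
    and the linear terms, also for n = 1, where the logarithm vanishes. The 200 comes from n + 1
    \<le> 2 * n.\<close>
  define C where "C = 60 + 200 * real (?d + ?k) + C1 + C2"
  show ?thesis
  proof (intro exI[of _ "distortion_program ?d ?k"] exI[of _ C] allI impI)
    fix P :: "(real ^ 'd) set" and n xs and f :: "real ^ 'd \<Rightarrow> real ^ 'k" and \<epsilon> :: real
    assume A: "finite P \<and> card P = n \<and> set xs = P \<and> distinct xs \<and> 0 < \<epsilon> \<and> \<epsilon> < 1"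
    then have n: "length xs = n" by (auto simp: distinct_card)
    obtain t s where ts: "exec (distortion_program ?d ?k) (input_store xs f \<epsilon>) t s"
      "t \<le> 60 + 100 * ((?d + ?k) * Suc n) + ?T1 n \<epsilon> + ?T2 n \<epsilon>"
      "distortion P f \<le> reported s" "reported s \<le> ereal (1 + \<epsilon>) * distortion P f"
      using runs_distortion_program[where xs = xs and f = f and \<epsilon> = \<epsilon>] A n unfolding runs_def by metis
    have "real t \<le> C * (real n * ln (real n) + real n / \<epsilon> ^ ?m)" if n1: "1 \<le> n"
    proof -
      define F where "F = real n * ln (real n) + real n / \<epsilon> ^ ?m"
      have "\<epsilon> ^ ?m \<le> 1" using A by (simp add: power_le_one)
      then have "real n \<le> real n / \<epsilon> ^ ?m" using A n1 by (simp add: field_simps)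
      moreover have "0 \<le> real n * ln (real n)" using n1 by simp
      ultimately have F: "real n \<le> F" by (simp add: F_def)
      have "real t \<le> real (60 + 100 * ((?d + ?k) * Suc n) + ?T1 n \<epsilon> + ?T2 n \<epsilon>)"
        using ts(2) by (simp only: of_nat_le_iff)
      also have "\<dots> = 60 + 100 * (real (?d + ?k) * (real n + 1)) + real (?T1 n \<epsilon>) + real (?T2 n \<epsilon>)"
        by (simp add: algebra_simps)
      also have "\<dots> \<le> 60 * F + 100 * (real (?d + ?k) * (2 * F)) + C1 * F + C2 * F"
      proof (intro add_mono mult_left_mono)
        show "real (?T1 n \<epsilon>) \<le> C1 * F" "real (?T2 n \<epsilon>) \<le> C2 * F"
          using C1(2)[of n \<epsilon>] C2(2)[of n \<epsilon>] n1 A by (auto simp: F_def)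
      qed (use F n1 in auto)
      also have "\<dots> = C * F" by (simp add: C_def algebra_simps)
      finally show ?thesis by (simp add: F_def)
    qed
    then show "\<exists>t s. exec (distortion_program ?d ?k) (input_store xs f \<epsilon>) t s \<and>
         (n \<ge> 1 \<longrightarrow> real t \<le> C * (real n * ln (real n) + real n / \<epsilon> ^ ?m)) \<and>
         distortion P f \<le> reported s \<and> reported s \<le> ereal (1 + \<epsilon>) * distortion P f"
      using ts by blast
  qed
qed

end
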